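(* Let $D\subset\mathbb{Z}^d$ be finite and let $f=(f(x))_{x\in D}$ be a non-degenerate centred Gaussian vector. Let $\Phi:\mathbb{R}^D\to\mathbb{R}$ be a smooth function such that $\Phi$ and its derivatives of all orders have at most polynomial growth at infinity. Then $\Phi$ has the chaos expansion $$\Phi(f)=\mathbb{E}[\Phi(f)]+\sum_{m=1}^\infty Q_m[\Phi(f)],$$ where convergence occurs in $L^2$ and $$Q_m[\Phi(f)]=\frac1{m!}\sum_{x_1,\dots,x_m\in D}{:}f(x_1)\cdots f(x_m){:}\ \mathbb{E}[\partial_{x_1}\cdots\partial_{x_m}\Phi(f)].$$
   Context: Let $H$ be the Gaussian Hilbert space spanned by $\{f(x)\}_{x\in D}$, and let $\overline{\mathcal{P}_m(H)}$ be the $L^2$-closure of the set of random variables that are real polynomials of degree at most $m$ in finitely many elements of $H$. The $m$-th homogeneous chaos $H^{:m:}$ is the orthogonal complement of $\overline{\mathcal{P}_{m-1}(H)}$ in $\overline{\mathcal{P}_m(H)}$ (with $H^{:0:}$ the constants), and $Q_m$ denotes the orthogonal projection in $L^2$ onto $H^{:m:}$. For $X_1,\dots,X_n\in H$ the Wick product is ${:}X_1\cdots X_n{:}=Q_n[X_1\cdots X_n]$. $\partial_x$ denotes the partial derivative in the coordinate indexed by $x\in D$. *)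

theory Defs
  imports "HOL-Probability.Probability"
begin

section \<open>Smooth functions on $\mathbb{R}^D$\<close>

text \<open>
  For a finite index set \<open>D\<close> the space of real families indexed by \<open>D\<close> is the set
  \<open>D \<rightarrow>\<^sub>E UNIV\<close> of functions that are \<open>undefined\<close> off \<open>D\<close>.  Functions on it are total
  HOL functions of which only the values on this set matter: updating such a family at an index
  in \<open>D\<close> stays inside the set.  The topology is the product topology of
  \<open>HOL-Analysis.Function_Topology\<close>.
\<close>

abbreviation families :: "'i set \<Rightarrow> ('i \<Rightarrow> real) set"
  where "families D \<equiv> D \<rightarrow>\<^sub>E UNIV"

definition partial :: "'i \<Rightarrow> (('i \<Rightarrow> real) \<Rightarrow> real) \<Rightarrow> ('i \<Rightarrow> real) \<Rightarrow> real"
  where "partial x \<Phi> v = deriv (\<lambda>t. \<Phi> (v(x := t))) (v x)"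

text \<open>\<open>partials [x1, \<dots>, xm] \<Phi>\<close> is $\partial_{x_1} \cdots \partial_{x_m} \Phi$.\<close>

definition partials :: "'i list \<Rightarrow> (('i \<Rightarrow> real) \<Rightarrow> real) \<Rightarrow> ('i \<Rightarrow> real) \<Rightarrow> real"
  where "partials xs \<Phi> = foldr partial xs \<Phi>"

definition smooth_fun :: "'i set \<Rightarrow> (('i \<Rightarrow> real) \<Rightarrow> real) \<Rightarrow> bool"
  where "smooth_fun D \<Phi> \<longleftrightarrow>
    (\<forall>xs\<in>lists D.
      continuous_on (families D) (partials xs \<Phi>) \<and>
      (\<forall>x\<in>D. \<forall>v\<in>families D. (\<lambda>t. partials xs \<Phi> (v(x := t))) differentiable at (v x)))"

definition polynomial_growth :: "'i set \<Rightarrow> (('i \<Rightarrow> real) \<Rightarrow> real) \<Rightarrow> bool"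
  where "polynomial_growth D \<Psi> \<longleftrightarrow>
    (\<exists>C k. \<forall>v\<in>families D. \<bar>\<Psi> v\<bar> \<le> C * (1 + L2_set v D) ^ k)"


section \<open>Square-integrable random variables\<close>

text \<open>
  Elements of $L^2$ are represented by functions, so all identities between them are to be read
  almost everywhere.
\<close>

definition L2 :: "'w measure \<Rightarrow> ('w \<Rightarrow> real) set"
  where "L2 M = {X \<in> borel_measurable M. integrable M (\<lambda>w. (X w)\<^sup>2)}"

definition L2_inner :: "'w measure \<Rightarrow> ('w \<Rightarrow> real) \<Rightarrow> ('w \<Rightarrow> real) \<Rightarrow> real"
  where "L2_inner M X Y = (LINT w|M. X w * Y w)"

definition L2_dist :: "'w measure \<Rightarrow> ('w \<Rightarrow> real) \<Rightarrow> ('w \<Rightarrow> real) \<Rightarrow> real"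
  where "L2_dist M X Y = sqrt (LINT w|M. (X w - Y w)\<^sup>2)"

text \<open>
  In the next two definitions membership in \<open>L2\<close> is required explicitly, because the Bochner
  integral of a non-integrable function is \<open>0\<close>.
\<close>

definition L2_tendsto ::
    "'w measure \<Rightarrow> (nat \<Rightarrow> 'w \<Rightarrow> real) \<Rightarrow> ('w \<Rightarrow> real) \<Rightarrow> bool"
  where "L2_tendsto M F X \<longleftrightarrow>
    (\<forall>n. F n \<in> L2 M) \<and> X \<in> L2 M \<and> (\<lambda>n. L2_dist M (F n) X) \<longlonglongrightarrow> 0"

definition L2_closure :: "'w measure \<Rightarrow> ('w \<Rightarrow> real) set \<Rightarrow> ('w \<Rightarrow> real) set"
  where "L2_closure M S = {X \<in> L2 M. \<forall>\<epsilon>>0. \<exists>Y \<in> S \<inter> L2 M. L2_dist M X Y < \<epsilon>}"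


section \<open>Gaussian vectors\<close>

text \<open>The point mass at \<open>0\<close> counts as a (degenerate) centred Gaussian distribution.\<close>

definition centred_gaussian :: "'w measure \<Rightarrow> ('w \<Rightarrow> real) \<Rightarrow> bool"
  where "centred_gaussian M X \<longleftrightarrow> X \<in> borel_measurable M \<and>
    ((AE w in M. X w = 0) \<or>
     (\<exists>\<sigma>>0. distributed M lborel X (\<lambda>t. ennreal (normal_density 0 \<sigma> t))))"

definition centred_gaussian_vector :: "'w measure \<Rightarrow> 'i set \<Rightarrow> ('i \<Rightarrow> 'w \<Rightarrow> real) \<Rightarrow> bool"
  where "centred_gaussian_vector M D f \<longleftrightarrow>
    (\<forall>a :: 'i \<Rightarrow> real. centred_gaussian M (\<lambda>w. \<Sum>x\<in>D. a x * f x w))"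

text \<open>
  Non-degeneracy: the covariance matrix is positive definite.  For centred variables the
  covariance is the $L^2$ inner product.
\<close>

definition nondegenerate :: "'w measure \<Rightarrow> 'i set \<Rightarrow> ('i \<Rightarrow> 'w \<Rightarrow> real) \<Rightarrow> bool"
  where "nondegenerate M D f \<longleftrightarrow>
    (\<forall>a :: 'i \<Rightarrow> real. (\<exists>x\<in>D. a x \<noteq> 0) \<longrightarrow>
      (\<Sum>x\<in>D. \<Sum>y\<in>D. a x * L2_inner M (f x) (f y) * a y) > 0)"

definition gaussian_hilbert_space ::
    "'w measure \<Rightarrow> 'i set \<Rightarrow> ('i \<Rightarrow> 'w \<Rightarrow> real) \<Rightarrow> ('w \<Rightarrow> real) set"
  where "gaussian_hilbert_space M D f =
    L2_closure M (range (\<lambda>(a :: 'i \<Rightarrow> real) w. \<Sum>x\<in>D. a x * f x w))"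


section \<open>Homogeneous chaos and Wick products\<close>

text \<open>
  A real polynomial of degree at most \<open>m\<close> in \<open>n\<close> variables is given by its coefficients \<open>c \<alpha>\<close>,
  where \<open>\<alpha>\<close> ranges over the multi-indices of total degree at most \<open>m\<close>.
\<close>

definition multi_indices :: "nat \<Rightarrow> nat \<Rightarrow> (nat \<Rightarrow> nat) set"
  where "multi_indices n m = {\<alpha> \<in> {..<n} \<rightarrow>\<^sub>E {..m}. (\<Sum>i<n. \<alpha> i) \<le> m}"

definition polynomials :: "('w \<Rightarrow> real) set \<Rightarrow> nat \<Rightarrow> ('w \<Rightarrow> real) set"
  where "polynomials H m =
    {\<lambda>w. \<Sum>\<alpha>\<in>multi_indices n m. c \<alpha> * (\<Prod>i<n. X i w ^ \<alpha> i)
      | n (X :: nat \<Rightarrow> 'w \<Rightarrow> real) (c :: (nat \<Rightarrow> nat) \<Rightarrow> real). \<forall>i<n. X i \<in> H}"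

fun chaos :: "'w measure \<Rightarrow> ('w \<Rightarrow> real) set \<Rightarrow> nat \<Rightarrow> ('w \<Rightarrow> real) set"
  where
    "chaos M H 0 = {Z \<in> L2 M. \<exists>c. AE w in M. Z w = c}"
  | "chaos M H (Suc m) =
      {Z \<in> L2_closure M (polynomials H (Suc m)).
        \<forall>Y \<in> L2_closure M (polynomials H m). L2_inner M Z Y = 0}"

text \<open>
  The orthogonal projection onto the \<open>m\<close>-th chaos.  It is determined only almost everywhere;
  \<open>SOME\<close> picks a version.
\<close>

definition chaos_proj ::
    "'w measure \<Rightarrow> ('w \<Rightarrow> real) set \<Rightarrow> nat \<Rightarrow> ('w \<Rightarrow> real) \<Rightarrow> 'w \<Rightarrow> real"
  where "chaos_proj M H m X =
    (SOME Z. Z \<in> chaos M H m \<and> (\<forall>Y \<in> chaos M H m. L2_inner M (\<lambda>w. X w - Z w) Y = 0))"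

definition wick ::
    "'w measure \<Rightarrow> ('w \<Rightarrow> real) set \<Rightarrow> ('w \<Rightarrow> real) list \<Rightarrow> 'w \<Rightarrow> real"
  where "wick M H Xs = chaos_proj M H (length Xs) (\<lambda>w. \<Prod>X\<leftarrow>Xs. X w)"

end

theory Submission imports Defs begin

text \<open>
  Let \<open>Z\<^sub>x\<close> be the basis of the span of the \<open>f y\<close> dual to \<open>f\<close> under the covariance. Gaussian integration
  by parts reads $\mathbb{E}[Z_x G(f)] = \mathbb{E}[\partial_x G(f)]$. The Hermite polynomials
  $h_{y \cdot ys} = Z_y h_{ys} - \partial_y h_{ys}$ therefore satisfy
  $\mathbb{E}[G(f) h_{ys}(f)] = \mathbb{E}[\partial_{ys} G(f)]$, so they are orthogonal to all
  polynomials of lower degree, and those of degree \<open>m\<close> span the \<open>m\<close>-th chaos. The formula for \<open>Q\<^sub>m\<close> is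
  checked by pairing both sides with them: writing $a_{xs} = \mathbb{E}[\partial_{xs} \Phi(f)]$, which is
  symmetric in \<open>xs\<close>, one has
  $\partial_{ys} \sum_{xs} a_{xs} v_{x_1} \cdots v_{x_m} = m!\, a_{ys}$.
  Convergence follows from completeness of \<open>L\<^sup>2\<close> once an \<open>R\<close> orthogonal to all polynomials in \<open>f\<close> is known to be
  orthogonal to \<open>\<Phi>(f)\<close>: expanding the exponential gives $\mathbb{E}[R e^{i a \cdot f}] = 0$ for all \<open>a\<close>, and
  Levy's uniqueness theorem, applied to one coordinate at a time, finishes the argument.
\<close>

section \<open>Square-integrable functions\<close>

text \<open>The variables dual to \<open>f\<close> are chosen so that integration by parts yields a
  plain partial derivative without covariance weights; non-degeneracy is what makes them exist. Two
  obstacles shape the rest. The chaos is defined by closures and its projection by an arbitrary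
  choice of version, so the identities hold almost everywhere only; since \<open>D\<close> is
  finite, the spaces to be closed are finite spans up to null sets, and projecting onto a finite
  span shows that the closure adds only other versions. Moreover, Hermite polynomials of the same
  degree are in general not orthogonal to one another, so coefficients are never compared: two
  elements of a chaos agree as soon as they pair equally with all Hermite polynomials of that
  degree. The symmetry of E[\<open>partials xs \<Phi>\<close>] in \<open>xs\<close> is not drawn
  from commuting derivatives but from the Hermite polynomials, whose index lists may be permuted up
  to null sets.\<close>

lemma L2_measurable [measurable_dest]: "X \<in> L2 M \<Longrightarrow> X \<in> borel_measurable M"
  by (simp add: L2_def)

lemma L2_square_integrable: "X \<in> L2 M \<Longrightarrow> integrable M (\<lambda>w. (X w)\<^sup>2)"
  by (simp add: L2_def)

lemma L2_mult_integrable: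
  assumes "X \<in> L2 M" "Y \<in> L2 M"
  shows "integrable M (\<lambda>w. X w * Y w)"
proof (rule Bochner_Integration.integrable_bound)
  show "integrable M (\<lambda>w. (X w)\<^sup>2 + (Y w)\<^sup>2)"
    using assms by (simp add: L2_square_integrable)
  show "(\<lambda>w. X w * Y w) \<in> borel_measurable M"
    using assms by measurable
  have "\<bar>x * y\<bar> \<le> x\<^sup>2 + y\<^sup>2" for x y :: real
  proof -
    have "0 \<le> (\<bar>x\<bar> - \<bar>y\<bar>)\<^sup>2" by simp
    then have "2 * (\<bar>x\<bar> * \<bar>y\<bar>) \<le> x\<^sup>2 + y\<^sup>2" by (simp add: power2_diff)
    moreover have "0 \<le> \<bar>x\<bar> * \<bar>y\<bar>" by simp
    ultimately show ?thesis unfolding abs_mult by linarith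
  qed
  then show "AE w in M. norm (X w * Y w) \<le> norm ((X w)\<^sup>2 + (Y w)\<^sup>2)"
    by (intro AE_I2) (simp add: order_trans[OF _ abs_ge_self])
qed

lemma L2_add: "X \<in> L2 M \<Longrightarrow> Y \<in> L2 M \<Longrightarrow> (\<lambda>w. X w + Y w) \<in> L2 M"
  using L2_mult_integrable[of X M Y] by (auto simp: L2_def power2_sum mult.assoc)

lemma L2_cmult: "X \<in> L2 M \<Longrightarrow> (\<lambda>w. c * X w) \<in> L2 M"
  by (auto simp: L2_def power_mult_distrib)

lemma L2_diff: "X \<in> L2 M \<Longrightarrow> Y \<in> L2 M \<Longrightarrow> (\<lambda>w. X w - Y w) \<in> L2 M"
  using L2_add[of X M "\<lambda>w. (-1) * Y w"] L2_cmult[of Y M "-1"] by simp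

lemma L2_zero: "(\<lambda>w. 0) \<in> L2 M"
  by (simp add: L2_def)

lemma L2_sum: "(\<And>i. i \<in> I \<Longrightarrow> g i \<in> L2 M) \<Longrightarrow> (\<lambda>w. \<Sum>i\<in>I. c i * g i w) \<in> L2 M"
  by (induction I rule: infinite_finite_induct) (auto intro!: L2_zero L2_add L2_cmult)

lemma L2_inner_commute: "L2_inner M X Y = L2_inner M Y X"
  by (simp add: L2_inner_def mult.commute)

lemma L2_inner_cong_AE:
  assumes "X \<in> borel_measurable M" "X' \<in> borel_measurable M" "Y \<in> borel_measurable M"
    and "AE w in M. X w = X' w"
  shows "L2_inner M X Y = L2_inner M X' Y"
  unfolding L2_inner_def using assms by (intro integral_cong_AE) auto

lemma L2_inner_diff_left:
  "X \<in> L2 M \<Longrightarrow> X' \<in> L2 M \<Longrightarrow> Y \<in> L2 M \<Longrightarrow>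
    L2_inner M (\<lambda>w. X w - X' w) Y = L2_inner M X Y - L2_inner M X' Y"
  by (simp add: L2_inner_def left_diff_distrib L2_mult_integrable)

lemma L2_inner_add_left:
  "X \<in> L2 M \<Longrightarrow> X' \<in> L2 M \<Longrightarrow> Y \<in> L2 M \<Longrightarrow>
    L2_inner M (\<lambda>w. X w + X' w) Y = L2_inner M X Y + L2_inner M X' Y"
  by (simp add: L2_inner_def distrib_right L2_mult_integrable)

lemma L2_inner_cmult_left: "L2_inner M (\<lambda>w. c * X w) Y = c * L2_inner M X Y"
  by (simp add: L2_inner_def mult.assoc)

lemma L2_inner_sum_left:
  assumes "\<And>i. i \<in> I \<Longrightarrow> g i \<in> L2 M" "Y \<in> L2 M"
  shows "L2_inner M (\<lambda>w. \<Sum>i\<in>I. c i * g i w) Y = (\<Sum>i\<in>I. c i * L2_inner M (g i) Y)"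
  using assms by (simp add: L2_inner_def sum_distrib_right mult.assoc L2_mult_integrable)

lemma L2_inner_sum_right:
  assumes "\<And>i. i \<in> I \<Longrightarrow> g i \<in> L2 M" "Y \<in> L2 M"
  shows "L2_inner M Y (\<lambda>w. \<Sum>i\<in>I. c i * g i w) = (\<Sum>i\<in>I. c i * L2_inner M Y (g i))"
  using L2_inner_sum_left[OF assms] by (simp add: L2_inner_commute)

lemma L2_inner_self_nonneg: "0 \<le> L2_inner M X X"
  by (simp add: L2_inner_def)

lemma L2_inner_self_eq_0_iff: "X \<in> L2 M \<Longrightarrow> L2_inner M X X = 0 \<longleftrightarrow> (AE w in M. X w = 0)"
  unfolding L2_inner_def
  by (subst integral_nonneg_eq_0_iff_AE) (auto simp: L2_mult_integrable)

lemma L2_pythagoras: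
  assumes "X \<in> L2 M" "Y \<in> L2 M" "L2_inner M X Y = 0"
  shows "L2_inner M (\<lambda>w. X w + Y w) (\<lambda>w. X w + Y w) = L2_inner M X X + L2_inner M Y Y"
proof -
  have XY: "(\<lambda>w. X w + Y w) \<in> L2 M"
    by (intro L2_add assms)
  have "L2_inner M X (\<lambda>w. X w + Y w) = L2_inner M X X"
    using assms L2_inner_add_left[of X M Y X]
    by (simp add: L2_inner_commute[of M Y X] L2_inner_commute[of M X "\<lambda>w. X w + Y w"])
  moreover have "L2_inner M Y (\<lambda>w. X w + Y w) = L2_inner M Y Y"
    using assms L2_inner_add_left[of X M Y Y]
    by (simp add: L2_inner_commute[of M Y "\<lambda>w. X w + Y w"])
  ultimately show ?thesis
    using assms XY by (simp add: L2_inner_add_left)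
qed

lemma L2_cauchy_schwarz:
  assumes X: "X \<in> L2 M" and Y: "Y \<in> L2 M"
  shows "(L2_inner M X Y)\<^sup>2 \<le> L2_inner M X X * L2_inner M Y Y"
proof (cases "L2_inner M Y Y = 0")
  case True
  then have "AE w in M. Y w = 0"
    using Y by (simp add: L2_inner_self_eq_0_iff)
  then have "L2_inner M Y X = L2_inner M (\<lambda>w. 0) X"
    using X Y by (intro L2_inner_cong_AE) auto
  then show ?thesis
    using True by (simp add: L2_inner_commute[of M X Y]) (simp add: L2_inner_def)
next
  case False
  define a b c where "a = L2_inner M X X" and "b = L2_inner M X Y" and "c = L2_inner M Y Y"
  have c: "c > 0" using False L2_inner_self_nonneg[of M Y] by (simp add: c_def)
  \<comment> \<open>\<open>U\<close> is \<open>c\<close> times the residual of \<open>X\<close>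
    after projection onto \<open>Y\<close>. Scaling by \<open>c\<close> avoids a division, and
    nonnegativity of \<open>L2_inner M U U = c * (c * a - b * b)\<close> is the claim.\<close>
  define U where "U = (\<lambda>w. c * X w - b * Y w)"
  have U: "U \<in> L2 M" unfolding U_def by (intro L2_diff L2_cmult X Y)
  have inner_U: "L2_inner M U V = c * L2_inner M X V - b * L2_inner M Y V" if "V \<in> L2 M" for V
    unfolding U_def using X Y that by (simp add: L2_inner_diff_left L2_cmult L2_inner_cmult_left)
  have "L2_inner M U U = c * L2_inner M U X - b * L2_inner M U Y"
    using inner_U[OF U] by (simp add: L2_inner_commute[of M X U] L2_inner_commute[of M Y U])
  moreover have "L2_inner M U X = c * a - b * b"
    using inner_U[OF X] by (simp add: a_def b_def L2_inner_commute[of M Y X])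
  moreover have "L2_inner M U Y = 0"
    using inner_U[OF Y] by (simp add: b_def c_def)
  ultimately have "L2_inner M U U = c * (c * a - b * b)"
    by simp
  then have "0 \<le> c * (c * a - b * b)"
    using L2_inner_self_nonneg[of M U] by simp
  then have "b * b \<le> a * c"
    using c by (simp add: zero_le_mult_iff mult.commute)
  then show ?thesis by (simp add: a_def b_def c_def power2_eq_square)
qed

lemma L2_dist_square: "(L2_dist M X Y)\<^sup>2 = L2_inner M (\<lambda>w. X w - Y w) (\<lambda>w. X w - Y w)"
  by (simp add: L2_dist_def L2_inner_def power2_eq_square)

lemma L2_dist_nonneg: "0 \<le> L2_dist M X Y"
  by (simp add: L2_dist_def)

lemma L2_closureI:
  assumes "X \<in> L2 M" "Y \<in> S" "Y \<in> L2 M" "L2_dist M X Y = 0"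
  shows "X \<in> L2_closure M S"
  unfolding L2_closure_def using assms by (intro CollectI conjI allI impI bexI[of _ Y]) auto

text \<open>Gram--Schmidt, one function at a time; a vanishing residual gives the coefficient \<open>_ / 0 = 0\<close>.\<close>

lemma L2_projection_exists:
  assumes "finite I" "\<And>i. i \<in> I \<Longrightarrow> g i \<in> L2 M" "X \<in> L2 M"
  shows "\<exists>c. \<forall>j\<in>I. L2_inner M (\<lambda>w. X w - (\<Sum>i\<in>I. c i * g i w)) (g j) = 0"
  using assms
proof (induction I arbitrary: X rule: finite_induct)
  case empty
  then show ?case by simp
next
  case (insert k I)
  have gI: "\<And>i. i \<in> I \<Longrightarrow> g i \<in> L2 M" and gk: "g k \<in> L2 M"
    using insert.prems by auto
  obtain c where c: "\<forall>j\<in>I. L2_inner M (\<lambda>w. X w - (\<Sum>i\<in>I. c i * g i w)) (g j) = 0"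
    using insert.IH[of X] insert.prems by auto
  \<comment> \<open>The second use of the induction hypothesis is for \<open>g k\<close> itself:
    \<open>r\<close> is the part of \<open>g k\<close> orthogonal to the earlier functions, so
    subtracting a multiple of it preserves the relations already achieved.\<close>
  obtain d where d: "\<forall>j\<in>I. L2_inner M (\<lambda>w. g k w - (\<Sum>i\<in>I. d i * g i w)) (g j) = 0"
    using insert.IH[of "g k"] insert.prems by auto
  define X0 where "X0 = (\<lambda>w. X w - (\<Sum>i\<in>I. c i * g i w))"
  define r where "r = (\<lambda>w. g k w - (\<Sum>i\<in>I. d i * g i w))"
  have X0: "X0 \<in> L2 M" and r: "r \<in> L2 M"
    using insert.prems gI gk by (auto simp: X0_def r_def intro!: L2_diff L2_sum)
  define \<alpha> where "\<alpha> = L2_inner M X0 r / L2_inner M r r"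
  define X1 where "X1 = (\<lambda>w. X0 w - \<alpha> * r w)"
  have X1: "X1 \<in> L2 M"
    unfolding X1_def by (intro L2_diff X0 L2_cmult r)
  have inner_X1: "L2_inner M X1 Y = L2_inner M X0 Y - \<alpha> * L2_inner M r Y" if "Y \<in> L2 M" for Y
    unfolding X1_def using that X0 r by (simp add: L2_inner_diff_left L2_cmult L2_inner_cmult_left)
  have orthI: "L2_inner M X1 (g j) = 0" if "j \<in> I" for j
    using inner_X1[OF gI[OF that]] c d that by (simp add: X0_def r_def)
  have "L2_inner M X0 r = \<alpha> * L2_inner M r r"
  proof (cases "L2_inner M r r = 0")
    case True
    then have "AE w in M. r w = 0"
      using r by (simp add: L2_inner_self_eq_0_iff)
    then have "L2_inner M r X0 = L2_inner M (\<lambda>w. 0) X0"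
      using r X0 by (intro L2_inner_cong_AE) auto
    then show ?thesis
      using True by (simp add: L2_inner_commute[of M X0]) (simp add: L2_inner_def)
  qed (simp add: \<alpha>_def)
  then have "L2_inner M X1 r = 0"
    using inner_X1[OF r] by simp
  moreover have "L2_inner M X1 (\<lambda>w. \<Sum>i\<in>I. d i * g i w) = 0"
    using X1 gI orthI by (simp add: L2_inner_sum_right)
  moreover have "L2_inner M X1 (g k) = L2_inner M (\<lambda>w. r w + (\<Sum>i\<in>I. d i * g i w)) X1"
    by (simp add: r_def L2_inner_commute[of M X1 "g k"])
  ultimately have orthk: "L2_inner M X1 (g k) = 0"
    using L2_inner_add_left[OF r L2_sum[of I g M d] X1] gI
    by (simp add: L2_inner_commute[of M r X1] L2_inner_commute[of M "\<lambda>w. \<Sum>i\<in>I. d i * g i w" X1])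
  define e where "e = (\<lambda>i. if i = k then \<alpha> else c i - \<alpha> * d i)"
  have "(\<Sum>i\<in>I. e i * g i w) = (\<Sum>i\<in>I. (c i - \<alpha> * d i) * g i w)" for w
    using insert.hyps by (intro sum.cong) (auto simp: e_def)
  then have "X1 = (\<lambda>w. X w - (\<Sum>i\<in>insert k I. e i * g i w))"
    using insert.hyps
    by (auto simp: X1_def X0_def r_def e_def fun_eq_iff algebra_simps sum.distrib sum_subtractf
        sum_distrib_left)
  with orthI orthk show ?case by auto
qed

text \<open>The residual \<open>U\<close> is orthogonal to the span, so by Pythagoras its norm is at
  most the distance from \<open>X\<close> to any element of the span. Arbitrarily good
  approximations therefore force \<open>U\<close> to vanish almost everywhere.\<close>

lemma L2_span_closed:
  assumes "finite I" "\<And>i. i \<in> I \<Longrightarrow> g i \<in> L2 M" "X \<in> L2 M"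
    and approx: "\<And>\<epsilon>. \<epsilon> > 0 \<Longrightarrow> \<exists>c. L2_dist M X (\<lambda>w. \<Sum>i\<in>I. c i * g i w) < \<epsilon>"
  shows "\<exists>c. AE w in M. X w = (\<Sum>i\<in>I. c i * g i w)"
proof -
  obtain c where c: "\<forall>j\<in>I. L2_inner M (\<lambda>w. X w - (\<Sum>i\<in>I. c i * g i w)) (g j) = 0"
    using L2_projection_exists[of I g M X] assms by auto
  define U where "U = (\<lambda>w. X w - (\<Sum>i\<in>I. c i * g i w))"
  have U: "U \<in> L2 M"
    unfolding U_def by (intro L2_diff L2_sum assms)
  have "L2_inner M U U \<le> \<epsilon>" if pos: "\<epsilon> > 0" for \<epsilon>
  proof -
    obtain d where d: "L2_dist M X (\<lambda>w. \<Sum>i\<in>I. d i * g i w) < sqrt \<epsilon>"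
      using approx[of "sqrt \<epsilon>"] pos by auto
    define V where "V = (\<lambda>w. \<Sum>i\<in>I. (c i - d i) * g i w)"
    have V: "V \<in> L2 M"
      unfolding V_def by (intro L2_sum assms)
    have UV: "L2_inner M U V = 0"
      unfolding V_def using c U assms(2) by (subst L2_inner_sum_right) (auto simp: U_def)
    have eq: "(\<lambda>w. X w - (\<Sum>i\<in>I. d i * g i w)) = (\<lambda>w. U w + V w)"
      by (simp add: U_def V_def fun_eq_iff algebra_simps sum_subtractf)
    have "L2_inner M U U \<le> L2_inner M (\<lambda>w. U w + V w) (\<lambda>w. U w + V w)"
      using L2_pythagoras[OF U V UV] L2_inner_self_nonneg[of M V] by simp
    also have "\<dots> = (L2_dist M X (\<lambda>w. \<Sum>i\<in>I. d i * g i w))\<^sup>2"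
      by (simp only: L2_dist_square eq)
    also have "\<dots> \<le> (sqrt \<epsilon>)\<^sup>2"
      using d by (intro power_mono) (auto simp: L2_dist_nonneg)
    finally show ?thesis using that by simp
  qed
  then have "L2_inner M U U \<le> 0"
    by (rule field_le_epsilon[of _ 0, simplified])
  then have "L2_inner M U U = 0"
    using L2_inner_self_nonneg[of M U] by simp
  then have "AE w in M. U w = 0"
    using U by (simp add: L2_inner_self_eq_0_iff)
  then show ?thesis
    by (auto simp: U_def)
qed

text \<open>A rapidly converging subsequence has integrable total variation, hence converges almost
  everywhere; Fatou's lemma then bounds the distance of the whole sequence to the pointwise
  limit.\<close>

lemma (in finite_measure) L2_complete:
  assumes F: "\<And>n. F n \<in> L2 M"
    and cauchy: "\<And>\<epsilon>. \<epsilon> > 0 \<Longrightarrow> \<exists>N. \<forall>m\<ge>N. \<forall>n\<ge>N. (LINT w|M. (F m w - F n w)\<^sup>2) < \<epsilon>"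
  shows "\<exists>X\<in>L2 M. (\<lambda>n. LINT w|M. (F n w - X w)\<^sup>2) \<longlonglongrightarrow> 0"
proof -
  have [measurable]: "F n \<in> borel_measurable M" for n
    using F by (rule L2_measurable)
  have sq: "integrable M (\<lambda>w. (F m w - F n w)\<^sup>2)" for m n
    by (intro L2_square_integrable L2_diff F)
  \<comment> \<open>A squared distance below \<open>(1/4)^k\<close> is a distance below
    \<open>(1/2)^k\<close>, which is summable.\<close>
  have "\<forall>k::nat. \<exists>N. \<forall>m\<ge>N. \<forall>n\<ge>N. (LINT w|M. (F m w - F n w)\<^sup>2) < (1/4)^k"
    by (intro allI cauchy) simp
  then obtain N where N: "\<And>k m n. m \<ge> N k \<Longrightarrow> n \<ge> N k \<Longrightarrow> (LINT w|M. (F m w - F n w)\<^sup>2) < (1/4)^k"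
    by metis
  \<comment> \<open>Summing the thresholds gives indices that are monotone in \<open>k\<close> and
    still at least \<open>N k\<close>.\<close>
  define r where "r k = (\<Sum>j\<le>k. N j)" for k :: nat
  have r_ge: "N k \<le> r k" for k
    unfolding r_def by (intro member_le_sum) auto
  have r_mono: "r k \<le> r l" if "k \<le> l" for k l
    unfolding r_def using that by (intro sum_mono2) auto
  define G where "G k = F (r k)" for k
  have [measurable]: "G k \<in> borel_measurable M" for k by (simp add: G_def)
  have Gsq: "(LINT w|M. (F n w - G k w)\<^sup>2) \<le> (1/4)^j" if "n \<ge> N j" "k \<ge> j" for n j k
    using N[of j n "r k"] that r_ge[of j] r_mono[of j k] by (auto simp: G_def)
  have Gdiff: "(\<integral>\<^sup>+w. ennreal \<bar>G (Suc k) w - G k w\<bar> \<partial>M) \<le> ennreal ((1/2)^k * (1 + measure M (space M)))" for k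
  proof -
    \<comment> \<open>The weight \<open>2^k\<close> balances the two terms: after integration both
      are of order \<open>(1/2)^k\<close>. On a finite measure space this turns the quadratic bound
      into a bound on the first absolute moment.\<close>
    have "\<bar>y\<bar> \<le> 2^k * y\<^sup>2 + (1/2)^k" for y :: real
    proof -
      define t where "t = (2::real)^k"
      have t: "t > 0" "(1/2)^k = 1/t" by (auto simp: t_def power_divide)
      have "0 \<le> (t * \<bar>y\<bar> - 1)\<^sup>2" by simp
      then have "2 * (t * \<bar>y\<bar>) \<le> (t * \<bar>y\<bar>)\<^sup>2 + 1"
        by (simp add: power2_diff)
      moreover have "0 \<le> t * \<bar>y\<bar>" using t by simp
      ultimately have "t * \<bar>y\<bar> \<le> (t * \<bar>y\<bar>)\<^sup>2 + 1" by linarith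
      also have "\<dots> = t * (t * y\<^sup>2 + 1 / t)"
        using t by (simp add: power_mult_distrib power2_eq_square algebra_simps)
      finally have "t * \<bar>y\<bar> \<le> t * (t * y\<^sup>2 + 1 / t)" .
      then show ?thesis
        using t(1) mult_le_cancel_left_pos unfolding t(2) t_def[symmetric] by blast
    qed
    then have "(\<integral>\<^sup>+w. ennreal \<bar>G (Suc k) w - G k w\<bar> \<partial>M)
        \<le> (\<integral>\<^sup>+w. ennreal (2^k * (G (Suc k) w - G k w)\<^sup>2 + (1/2)^k) \<partial>M)"
      by (intro nn_integral_mono ennreal_leI) auto
    also have "\<dots> = ennreal (LINT w|M. 2^k * (G (Suc k) w - G k w)\<^sup>2 + (1/2)^k)"
      by (intro nn_integral_eq_integral) (auto simp: G_def sq)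
    also have "(LINT w|M. 2^k * (G (Suc k) w - G k w)\<^sup>2 + (1/2)^k)
        = 2^k * (LINT w|M. (G (Suc k) w - G k w)\<^sup>2) + (1/2)^k * measure M (space M)"
      by (simp add: G_def sq mult.commute)
    also have "\<dots> \<le> 2^k * (1/4)^k + (1/2)^k * measure M (space M)"
      using Gsq[of k "r (Suc k)" k] r_ge[of k] r_mono[of k "Suc k"] by (simp add: G_def)
    also have "\<dots> = (1/2)^k * (1 + measure M (space M))"
      by (simp add: algebra_simps flip: power_mult_distrib)
    finally show ?thesis by (simp add: ennreal_leI)
  qed
  have "(\<integral>\<^sup>+w. (\<Sum>k. ennreal \<bar>G (Suc k) w - G k w\<bar>) \<partial>M) = (\<Sum>k. \<integral>\<^sup>+w. ennreal \<bar>G (Suc k) w - G k w\<bar> \<partial>M)"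
    by (rule nn_integral_suminf) auto
  also have "\<dots> \<le> (\<Sum>k. ennreal ((1/2)^k * (1 + measure M (space M))))"
    by (intro suminf_le Gdiff) auto
  also have "\<dots> = ennreal (\<Sum>k. (1/2)^k * (1 + measure M (space M)))"
    by (intro suminf_ennreal2) (auto intro!: summable_mult2)
  finally have "(\<integral>\<^sup>+w. (\<Sum>k. ennreal \<bar>G (Suc k) w - G k w\<bar>) \<partial>M) \<noteq> \<infinity>"
    by (auto simp: top_unique)
  then have "AE w in M. (\<Sum>k. ennreal \<bar>G (Suc k) w - G k w\<bar>) \<noteq> \<infinity>"
    by (intro nn_integral_PInf_AE) auto
  then have conv: "AE w in M. (\<lambda>k. G k w) \<longlonglongrightarrow> lim (\<lambda>k. G k w)"
  proof eventually_elim
    case (elim w)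
    then have "summable (\<lambda>k. \<bar>G (Suc k) w - G k w\<bar>)"
      by (intro summable_suminf_not_top) auto
    then have "summable (\<lambda>k. G (Suc k) w - G k w)"
      by (rule summable_rabs_cancel)
    then have "convergent (\<lambda>n. \<Sum>k<n. G (Suc k) w - G k w)"
      by (simp add: summable_iff_convergent)
    then have "convergent (\<lambda>n. (G n w - G 0 w) + G 0 w)"
      by (intro convergent_add convergent_const) (simp only: sum_lessThan_telescope[of "\<lambda>k. G k w"])
    then show ?case
      by (simp add: convergent_LIMSEQ_iff)
  qed
  define X where "X = (\<lambda>w. lim (\<lambda>k. G k w))"
  have X_meas [measurable]: "X \<in> borel_measurable M"
    unfolding X_def by (rule borel_measurable_lim_metric) simp
  \<comment> \<open>Only \<open>G\<close> runs along the subsequence; \<open>F n\<close> is fixed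
    with arbitrary \<open>n \<ge> N j\<close>, so the bound concerns the full sequence.\<close>
  have fatou: "(\<integral>\<^sup>+w. ennreal ((F n w - X w)\<^sup>2) \<partial>M) \<le> ennreal ((1/4)^j)" if n: "n \<ge> N j" for n j
  proof -
    have "(\<integral>\<^sup>+w. ennreal ((F n w - X w)\<^sup>2) \<partial>M) = (\<integral>\<^sup>+w. liminf (\<lambda>k. ennreal ((F n w - G k w)\<^sup>2)) \<partial>M)"
      using conv
    proof (intro nn_integral_cong_AE, eventually_elim)
      case (elim w)
      then have "(\<lambda>k. ennreal ((F n w - G k w)\<^sup>2)) \<longlonglongrightarrow> ennreal ((F n w - X w)\<^sup>2)"
        by (auto simp: X_def intro!: tendsto_intros)
      then show ?case
        by (rule lim_imp_Liminf[OF trivial_limit_sequentially, symmetric])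
    qed
    also have "\<dots> \<le> liminf (\<lambda>k. \<integral>\<^sup>+w. ennreal ((F n w - G k w)\<^sup>2) \<partial>M)"
      by (rule nn_integral_liminf) simp
    also have "\<dots> \<le> limsup (\<lambda>k. \<integral>\<^sup>+w. ennreal ((F n w - G k w)\<^sup>2) \<partial>M)"
      by (rule Liminf_le_Limsup) simp
    also have "\<dots> \<le> ennreal ((1/4)^j)"
    proof (rule Limsup_bounded)
      show "\<forall>\<^sub>F k in sequentially. (\<integral>\<^sup>+w. ennreal ((F n w - G k w)\<^sup>2) \<partial>M) \<le> ennreal ((1/4)^j)"
        using eventually_ge_at_top[of j]
      proof eventually_elim
        case (elim k)
        have "(\<integral>\<^sup>+w. ennreal ((F n w - G k w)\<^sup>2) \<partial>M) = ennreal (LINT w|M. (F n w - G k w)\<^sup>2)"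
          by (intro nn_integral_eq_integral) (auto simp: G_def sq)
        then show ?case
          using Gsq[OF n elim] by (simp add: ennreal_leI)
      qed
    qed
    finally show ?thesis .
  qed
  have diff_int: "integrable M (\<lambda>w. (F n w - X w)\<^sup>2)" if "n \<ge> N j" for n j
    using fatou[OF that] by (intro integrableI_bounded) (auto intro: le_less_trans)
  have diff_L2: "(\<lambda>w. F (N 0) w - X w) \<in> L2 M"
    using diff_int[of 0 "N 0"] by (simp add: L2_def)
  have "(\<lambda>w. F (N 0) w - (F (N 0) w - X w)) \<in> L2 M"
    by (intro L2_diff F diff_L2)
  then have X: "X \<in> L2 M" by simp
  have bound: "(LINT w|M. (F n w - X w)\<^sup>2) \<le> (1/4)^j" if "n \<ge> N j" for n j
    using fatou[OF that] diff_int[OF that] by (simp add: nn_integral_eq_integral)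
  have "(\<lambda>n. LINT w|M. (F n w - X w)\<^sup>2) \<longlonglongrightarrow> 0"
  proof (rule LIMSEQ_I)
    fix \<epsilon> :: real assume "\<epsilon> > 0"
    then obtain j where j: "(1/4::real)^j < \<epsilon>"
      using real_arch_pow_inv[of \<epsilon> "1/4"] by auto
    have "norm ((LINT w|M. (F n w - X w)\<^sup>2) - 0) < \<epsilon>" if "n \<ge> N j" for n
      using bound[OF that] j by simp
    then show "\<exists>no. \<forall>n\<ge>no. norm ((LINT w|M. (F n w - X w)\<^sup>2) - 0) < \<epsilon>" by blast
  qed
  with X show ?thesis by blast
qed

text \<open>Bessel's inequality makes the partial sums Cauchy.\<close>

lemma (in finite_measure) L2_orthogonal_series:
  fixes q :: "nat \<Rightarrow> 'a \<Rightarrow> real"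
  assumes q: "\<And>m. q m \<in> L2 M" and X: "X \<in> L2 M"
    and orth: "\<And>m n. m \<noteq> n \<Longrightarrow> L2_inner M (q m) (q n) = 0"
    and proj: "\<And>m. L2_inner M X (q m) = L2_inner M (q m) (q m)"
  shows "\<exists>Y\<in>L2 M. (\<lambda>N. L2_dist M (\<lambda>w. \<Sum>m\<le>N. q m w) Y) \<longlonglongrightarrow> 0 \<and>
    (\<forall>V\<in>L2 M. (\<lambda>N. L2_inner M (\<lambda>w. \<Sum>m\<le>N. q m w) V) \<longlonglongrightarrow> L2_inner M Y V)"
proof -
  define b where "b m = L2_inner M (q m) (q m)" for m
  have b: "b m \<ge> 0" for m unfolding b_def by (rule L2_inner_self_nonneg)
  have sum_L2: "(\<lambda>w. \<Sum>m\<in>I. q m w) \<in> L2 M" for I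
    using L2_sum[of I q M "\<lambda>_. 1"] q by simp
  have inner_sum: "L2_inner M (\<lambda>w. \<Sum>m\<in>I. q m w) V = (\<Sum>m\<in>I. L2_inner M (q m) V)" if "V \<in> L2 M" for I V
    using L2_inner_sum_left[of I q M V "\<lambda>_. 1"] q that by simp
  have sum_norm: "L2_inner M (\<lambda>w. \<Sum>m\<in>I. q m w) (\<lambda>w. \<Sum>m\<in>I. q m w) = sum b I" if "finite I" for I
  proof -
    have "L2_inner M (q m) (\<lambda>w. \<Sum>m\<in>I. q m w) = b m" if "m \<in> I" for m
    proof -
      have "L2_inner M (q m) (\<lambda>w. \<Sum>m\<in>I. q m w) = (\<Sum>n\<in>I. L2_inner M (q n) (q m))"
        by (subst L2_inner_commute) (rule inner_sum[OF q])
      also have "\<dots> = (\<Sum>n\<in>I. if n = m then b m else 0)"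
        by (intro sum.cong) (auto simp: orth b_def)
      finally show ?thesis using that \<open>finite I\<close> by simp
    qed
    then show ?thesis by (simp add: inner_sum sum_L2)
  qed
  have bessel: "sum b I \<le> L2_inner M X X" if "finite I" for I
  proof -
    let ?S = "\<lambda>w. \<Sum>m\<in>I. q m w"
    have XS: "L2_inner M ?S X = sum b I"
      using inner_sum[OF X, of I] by (simp add: L2_inner_commute[of M "q _" X] proj b_def)
    have U: "(\<lambda>w. X w - ?S w) \<in> L2 M" by (intro L2_diff X sum_L2)
    have "L2_inner M (\<lambda>w. X w - ?S w) ?S = 0"
      using XS sum_norm[OF that] X sum_L2 by (simp add: L2_inner_diff_left L2_inner_commute[of M X ?S])
    then have "L2_inner M X X = L2_inner M (\<lambda>w. X w - ?S w) (\<lambda>w. X w - ?S w) + sum b I"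
      using L2_pythagoras[OF U sum_L2[of I]] sum_norm[OF that] by simp
    then show ?thesis
      using L2_inner_self_nonneg[of M "\<lambda>w. X w - ?S w"] by simp
  qed
  then have "summable b"
    using b by (intro bounded_imp_summable[where B = "L2_inner M X X"]) auto
  have cauchy: "\<exists>N. \<forall>m\<ge>N. \<forall>n\<ge>N. (LINT w|M. ((\<Sum>i\<le>m. q i w) - (\<Sum>i\<le>n. q i w))\<^sup>2) < \<epsilon>" if \<epsilon>: "\<epsilon> > 0" for \<epsilon>
  proof -
    obtain N where N: "\<And>m n. m \<ge> N \<Longrightarrow> norm (sum b {m..<n}) < \<epsilon>"
      using \<open>summable b\<close> \<epsilon> unfolding summable_Cauchy by blast
    have le: "(LINT w|M. ((\<Sum>i\<le>n. q i w) - (\<Sum>i\<le>m. q i w))\<^sup>2) < \<epsilon>" if "N \<le> m" "m \<le> n" for m n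
    proof -
      have "(\<Sum>i\<le>n. q i w) - (\<Sum>i\<le>m. q i w) = (\<Sum>i\<in>{Suc m..<Suc n}. q i w)" for w
      proof -
        have "{..n} - {..m} = {Suc m..<Suc n}" by auto
        then show ?thesis
          using that(2) sum_diff[of "{..n}" "{..m}" "\<lambda>i. q i w"] by (simp del: sum.op_ivl_Suc)
      qed
      then have "(LINT w|M. ((\<Sum>i\<le>n. q i w) - (\<Sum>i\<le>m. q i w))\<^sup>2) = sum b {Suc m..<Suc n}"
        using sum_norm[of "{Suc m..<Suc n}"] by (simp add: L2_inner_def power2_eq_square)
      also have "\<dots> < \<epsilon>"
        using N[of "Suc m" "Suc n"] that(1) by simp
      finally show ?thesis .
    qed
    have "(LINT w|M. ((\<Sum>i\<le>m. q i w) - (\<Sum>i\<le>n. q i w))\<^sup>2) < \<epsilon>" if "m \<ge> N" "n \<ge> N" for m n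
      using le[of m n] le[of n m] that by (cases "m \<le> n") (auto simp: power2_commute)
    then show ?thesis by blast
  qed
  obtain Y where Y: "Y \<in> L2 M" and lim: "(\<lambda>N. LINT w|M. ((\<Sum>i\<le>N. q i w) - Y w)\<^sup>2) \<longlonglongrightarrow> 0"
    using L2_complete[of "\<lambda>N w. \<Sum>i\<le>N. q i w", OF sum_L2 cauchy] by blast
  have dist: "(\<lambda>N. L2_dist M (\<lambda>w. \<Sum>m\<le>N. q m w) Y) \<longlonglongrightarrow> 0"
    unfolding L2_dist_def using tendsto_real_sqrt[OF lim] by simp
  \<comment> \<open>By Cauchy-Schwarz, norm convergence passes to inner products. This form is what
    later identifies the limit.\<close>
  moreover have "(\<lambda>N. L2_inner M (\<lambda>w. \<Sum>m\<le>N. q m w) V) \<longlonglongrightarrow> L2_inner M Y V" if V: "V \<in> L2 M" for V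
  proof (rule LIM_zero_cancel, rule Lim_null_comparison)
    show "\<forall>\<^sub>F N in sequentially. norm (L2_inner M (\<lambda>w. \<Sum>m\<le>N. q m w) V - L2_inner M Y V)
        \<le> L2_dist M (\<lambda>w. \<Sum>m\<le>N. q m w) Y * sqrt (L2_inner M V V)"
    proof (intro always_eventually allI)
      fix N
      let ?U = "\<lambda>w. (\<Sum>m\<le>N. q m w) - Y w"
      have U: "?U \<in> L2 M" by (intro L2_diff sum_L2 Y)
      have "\<bar>L2_inner M ?U V\<bar> \<le> sqrt (L2_inner M ?U ?U * L2_inner M V V)"
        using real_sqrt_le_mono[OF L2_cauchy_schwarz[OF U V]] by simp
      also have "\<dots> = L2_dist M (\<lambda>w. \<Sum>m\<le>N. q m w) Y * sqrt (L2_inner M V V)"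
        by (simp add: real_sqrt_mult L2_dist_nonneg flip: L2_dist_square)
      finally show "norm (L2_inner M (\<lambda>w. \<Sum>m\<le>N. q m w) V - L2_inner M Y V)
        \<le> L2_dist M (\<lambda>w. \<Sum>m\<le>N. q m w) Y * sqrt (L2_inner M V V)"
        using sum_L2 Y V by (simp add: L2_inner_diff_left)
    qed
    show "(\<lambda>N. L2_dist M (\<lambda>w. \<Sum>m\<le>N. q m w) Y * sqrt (L2_inner M V V)) \<longlonglongrightarrow> 0"
      using tendsto_mult_left_zero[OF dist] .
  qed
  ultimately show ?thesis using Y by blast
qed

section \<open>Uniqueness for Fourier transforms of signed measures\<close>

text \<open>The positive part of the signed measure with density \<open>X\<close>. Used for
  \<open>X\<close> and for \<open>- X\<close>, it gives the Jordan decomposition as a pair of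
  ordinary measures.\<close>

definition pos_density :: "'w measure \<Rightarrow> ('w \<Rightarrow> real) \<Rightarrow> 'w measure"
  where "pos_density M X = density M (\<lambda>w. ennreal (max 0 (X w)))"

lemma measurable_pos_density: "measurable (pos_density M X) N = measurable M N"
  by (simp add: pos_density_def cong: measurable_cong_sets)

lemma integral_distr_pos_density:
  fixes h :: "'a \<Rightarrow> 'b :: {banach, second_countable_topology}"
  assumes [measurable]: "X \<in> borel_measurable M" "F \<in> measurable M N" "h \<in> borel_measurable N"
  shows "integral\<^sup>L (distr (pos_density M X) N F) h = (LINT w|M. max 0 (X w) *\<^sub>R h (F w))"
proof -
  have "integral\<^sup>L (distr (pos_density M X) N F) h = (LINT w|pos_density M X. h (F w))"
    by (rule integral_distr) (auto simp: measurable_pos_density)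
  also have "\<dots> = (LINT w|M. max 0 (X w) *\<^sub>R h (F w))"
    unfolding pos_density_def by (rule integral_density) auto
  finally show ?thesis .
qed

lemma finite_measure_distr_pos_density:
  assumes X: "integrable M X" and F: "F \<in> measurable M N"
  shows "finite_measure (distr (pos_density M X) N F)"
proof -
  have [measurable]: "X \<in> borel_measurable M" using X by auto
  have "emeasure (pos_density M X) (space M) = (\<integral>\<^sup>+w. ennreal (max 0 (X w)) \<partial>M)"
    unfolding pos_density_def by (subst emeasure_density) (auto intro!: nn_integral_cong)
  also have "\<dots> = ennreal (LINT w|M. max 0 (X w))"
    using X by (intro nn_integral_eq_integral) auto
  finally have "finite_measure (pos_density M X)"
    by (intro finite_measureI) (simp add: pos_density_def)
  then show ?thesis
    using F by (intro finite_measure.finite_measure_distr) (auto simp: measurable_pos_density)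
qed

lemma measure_distr_pos_density:
  assumes "X \<in> borel_measurable M" "F \<in> measurable M N" "B \<in> sets N"
  shows "measure (distr (pos_density M X) N F) B = (LINT w|M. max 0 (X w) * indicator B (F w))"
proof -
  have "measure (distr (pos_density M X) N F) B = (LINT x|distr (pos_density M X) N F. indicator B x)"
    using sets.sets_into_space[OF assms(3)] by (simp add: Int_absorb2)
  also have "\<dots> = (LINT w|M. max 0 (X w) *\<^sub>R indicator B (F w))"
    using assms by (intro integral_distr_pos_density) auto
  finally show ?thesis by simp
qed

lemma integrable_mult_bounded:
  fixes X h :: "'a \<Rightarrow> 'b :: {real_normed_algebra, banach, second_countable_topology}"
  assumes "integrable M X" "h \<in> borel_measurable M" "\<And>w. norm (h w) \<le> 1"
  shows "integrable M (\<lambda>w. X w * h w)"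
proof (rule Bochner_Integration.integrable_bound[OF assms(1)])
  show "AE w in M. norm (X w * h w) \<le> norm (X w)"
  proof (intro AE_I2)
    fix w
    have "norm (X w * h w) \<le> norm (X w) * norm (h w)"
      by (rule norm_mult_ineq)
    also have "\<dots> \<le> norm (X w)"
      using assms(3)[of w] by (simp add: mult_left_le)
    finally show "norm (X w * h w) \<le> norm (X w)" .
  qed
qed (use assms in auto)

lemma integral_pos_neg_parts:
  fixes X :: "'a \<Rightarrow> real" and h :: "'a \<Rightarrow> 'b :: {banach, second_countable_topology}"
  assumes "integrable M (\<lambda>w. X w *\<^sub>R h w)" "X \<in> borel_measurable M" "h \<in> borel_measurable M"
  shows "(LINT w|M. X w *\<^sub>R h w) = (LINT w|M. max 0 (X w) *\<^sub>R h w) - (LINT w|M. max 0 (- X w) *\<^sub>R h w)"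
proof -
  have int: "integrable M (\<lambda>w. max 0 (X w) *\<^sub>R h w)" "integrable M (\<lambda>w. max 0 (- X w) *\<^sub>R h w)"
    using assms by (auto intro!: Bochner_Integration.integrable_bound[OF assms(1)] AE_I2 mult_right_mono)
  have "(LINT w|M. X w *\<^sub>R h w) = (LINT w|M. max 0 (X w) *\<^sub>R h w - max 0 (- X w) *\<^sub>R h w)"
    by (intro Bochner_Integration.integral_cong refl) (auto simp: max_def simp flip: scaleR_diff_left)
  with int show ?thesis by simp
qed

lemma norm_indicator_le_one: "norm (indicator A x :: 'b :: real_normed_algebra_1) \<le> 1"
  by (simp add: indicator_def)

lemma real_distribution_distr_pos_density:
  assumes X: "integrable M X" and g: "g \<in> borel_measurable M" and mass: "(LINT w|M. max 0 (X w)) = 1"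
  shows "real_distribution (distr (pos_density M X) borel g)"
proof -
  interpret P: finite_measure "distr (pos_density M X) borel g"
    by (rule finite_measure_distr_pos_density[OF X g])
  have "measure (distr (pos_density M X) borel g) UNIV = 1"
    using X g mass by (subst measure_distr_pos_density) auto
  then have "prob_space (distr (pos_density M X) borel g)"
    by (intro prob_spaceI) (simp add: P.emeasure_eq_measure)
  then show ?thesis
    by (simp add: real_distribution_def real_distribution_axioms_def)
qed

text \<open>The images under \<open>g\<close> of the two parts of the signed measure have the same
  mass and, once normalised, the same characteristic function, so Levy's theorem identifies
  them.\<close>

lemma fourier_unique_real:
  fixes X g :: "'w \<Rightarrow> real"
  assumes X: "integrable M X" and g [measurable]: "g \<in> borel_measurable M"
    and zero: "\<And>t. (CLINT w|M. of_real (X w) * iexp (t * g w)) = 0"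
    and A: "A \<in> sets borel"
  shows "(LINT w|M. X w * indicator A (g w)) = 0"
proof -
  have [measurable]: "X \<in> borel_measurable M" using X by auto
  note [measurable] = A
  have X': "integrable M (\<lambda>w. - X w)" using X by simp
  \<comment> \<open>Frequency 0 says that the total signed mass vanishes, so one constant
    \<open>c\<close> normalises both parts.\<close>
  have "(CLINT w|M. complex_of_real (X w)) = 0"
    using zero[of 0] by simp
  then have "(LINT w|M. X w) = 0" by simp
  then have mass: "(LINT w|M. max 0 (X w)) = (LINT w|M. max 0 (- X w))"
    using integral_pos_neg_parts[of M X "\<lambda>_. 1::real"] X by simp
  define c where "c = (LINT w|M. max 0 (X w))"
  have c: "c \<ge> 0" unfolding c_def by (intro integral_nonneg_AE) auto
  have split: "(LINT w|M. X w * indicator A (g w)) =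
      (LINT w|M. max 0 (X w) * indicator A (g w)) - (LINT w|M. max 0 (- X w) * indicator A (g w))"
    using integral_pos_neg_parts[of M X "\<lambda>w. indicator A (g w) :: real"]
      integrable_mult_bounded[OF X, of "\<lambda>w. indicator A (g w)"] norm_indicator_le_one by simp
  show ?thesis
  proof (cases "c = 0")
    \<comment> \<open>With zero mass there is nothing to normalise, but then \<open>X\<close> itself
      vanishes almost everywhere.\<close>
    case True
    have "AE w in M. max 0 (X w) = 0" "AE w in M. max 0 (- X w) = 0"
      using True mass X unfolding c_def
      by (subst integral_nonneg_eq_0_iff_AE[symmetric]; auto)+
    then have "AE w in M. X w * indicator A (g w) = 0"
      by eventually_elim auto
    then show ?thesis
      by (intro integral_eq_zero_AE)
  next
    case False
    with c have c: "c > 0" by simp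
    define Y where "Y = (\<lambda>w. X w / c)"
    have Y: "integrable M Y" "integrable M (\<lambda>w. - Y w)"
      using X by (auto simp: Y_def)
    have [measurable]: "Y \<in> borel_measurable M" using Y by auto
    have maxY: "max 0 (Y w) = max 0 (X w) / c" "max 0 (- Y w) = max 0 (- X w) / c" for w
      using c by (auto simp: Y_def max_def field_simps)
    have "(LINT w|M. max 0 (Y w)) = 1" "(LINT w|M. max 0 (- Y w)) = 1"
      using c mass by (simp_all add: maxY c_def[symmetric])
    note real_dist = real_distribution_distr_pos_density[OF Y(1) g this(1)]
      real_distribution_distr_pos_density[OF Y(2) g this(2)]
    have "char (distr (pos_density M Y) borel g) = char (distr (pos_density M (\<lambda>w. - Y w)) borel g)"
    proof
      fix t
      have int: "integrable M (\<lambda>w. Y w *\<^sub>R iexp (t * g w))"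
        unfolding scaleR_conv_of_real using Y(1)
        by (intro integrable_mult_bounded) auto
      have "(CLINT w|M. Y w *\<^sub>R iexp (t * g w)) = (CLINT w|M. (of_real (X w) * iexp (t * g w)) / of_real c)"
        by (simp add: Y_def scaleR_conv_of_real)
      then have "(CLINT w|M. Y w *\<^sub>R iexp (t * g w)) = 0"
        using zero[of t] by simp
      then show "char (distr (pos_density M Y) borel g) t = char (distr (pos_density M (\<lambda>w. - Y w)) borel g) t"
        using integral_pos_neg_parts[OF int] by (simp add: char_def integral_distr_pos_density)
    qed
    from Levy_uniqueness[OF real_dist this]
    have "measure (distr (pos_density M Y) borel g) A = measure (distr (pos_density M (\<lambda>w. - Y w)) borel g) A"
      by simp
    then have "(LINT w|M. max 0 (X w) * indicator A (g w) / c) = (LINT w|M. max 0 (- X w) * indicator A (g w) / c)"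
      by (simp add: measure_distr_pos_density maxY)
    then show ?thesis
      using c by (simp add: split)
  qed
qed

text \<open>The hypothesis is stable under conjugation, which replaces \<open>t\<close> by
  \<open>- t\<close>; it therefore passes to the real and imaginary parts of
  \<open>X\<close>.\<close>

lemma fourier_unique_complex:
  fixes X :: "'w \<Rightarrow> complex" and g :: "'w \<Rightarrow> real"
  assumes X: "integrable M X" and g [measurable]: "g \<in> borel_measurable M"
    and zero: "\<And>t. (CLINT w|M. X w * iexp (t * g w)) = 0"
    and A [measurable]: "A \<in> sets borel"
  shows "(CLINT w|M. X w * indicator A (g w)) = 0"
proof -
  have [measurable]: "X \<in> borel_measurable M" using X by auto
  have int: "integrable M (\<lambda>w. X w * iexp (t * g w))" for t
    using X by (intro integrable_mult_bounded) auto
  have intc: "integrable M (\<lambda>w. cnj (X w) * iexp (t * g w))" for t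
    using X by (intro integrable_mult_bounded) auto
  have zeroc: "(CLINT w|M. cnj (X w) * iexp (t * g w)) = 0" for t
  proof -
    have "(CLINT w|M. cnj (X w) * iexp (t * g w)) = (CLINT w|M. cnj (X w * iexp (- t * g w)))"
      by (simp add: exp_cnj)
    also have "\<dots> = cnj (CLINT w|M. X w * iexp (- t * g w))"
      using Bochner_Integration.integral_cnj[of M "\<lambda>w. X w * iexp (- t * g w)"] by simp
    finally show ?thesis using zero[of "- t"] by simp
  qed
  have Re: "(LINT w|M. Re (X w) * indicator A (g w)) = 0"
  proof (rule fourier_unique_real[OF _ g _ A])
    fix t
    have eq: "of_real (Re (X w)) * iexp (t * g w) = (X w * iexp (t * g w) + cnj (X w) * iexp (t * g w)) / 2" for w
      by (simp add: complex_add_cnj flip: distrib_right)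
    show "(CLINT w|M. of_real (Re (X w)) * iexp (t * g w)) = 0"
      unfolding eq using zero zeroc int intc by simp
  qed (use X in auto)
  have Im: "(LINT w|M. Im (X w) * indicator A (g w)) = 0"
  proof (rule fourier_unique_real[OF _ g _ A])
    fix t
    have eq: "of_real (Im (X w)) * iexp (t * g w) = (X w * iexp (t * g w) - cnj (X w) * iexp (t * g w)) / (2 * \<i>)" for w
    proof -
      have "X w - cnj (X w) = of_real (Im (X w)) * (2 * \<i>)"
        by (simp add: complex_eq_iff)
      then have "of_real (Im (X w)) = (X w - cnj (X w)) / (2 * \<i>)"
        by (subst eq_divide_eq) simp
      then show ?thesis
        by (simp only: left_diff_distrib[symmetric] times_divide_eq_left)
    qed
    show "(CLINT w|M. of_real (Im (X w)) * iexp (t * g w)) = 0"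
      unfolding eq using zero zeroc int intc by simp
  qed (use X in auto)
  have int_A: "integrable M (\<lambda>w. X w * indicator A (g w))"
    using X norm_indicator_le_one by (intro integrable_mult_bounded) auto
  have "Re (X w * indicator A (g w)) = Re (X w) * indicator A (g w)"
    "Im (X w * indicator A (g w)) = Im (X w) * indicator A (g w)" for w
    by (simp_all add: indicator_def)
  then show ?thesis
    using integral_Re[OF int_A] integral_Im[OF int_A] Re Im by (simp add: complex_eq_iff)
qed

text \<open>Exponentials are exchanged for indicators one coordinate at a time. For a fixed
  frequency \<open>t\<close> the factor \<open>iexp (t * g j w)\<close> is absorbed into the weight
  and the induction hypothesis treats the other coordinates; then \<open>t\<close> varies and the
  one-dimensional result treats \<open>g j\<close>. Hence the weight is complex and arbitrary in the
  induction.\<close>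

lemma fourier_unique_box:
  fixes X :: "'w \<Rightarrow> complex" and g :: "'i \<Rightarrow> 'w \<Rightarrow> real"
  assumes "finite S" "integrable M X" "\<And>i. i \<in> S \<Longrightarrow> g i \<in> borel_measurable M"
    and "\<And>a. (CLINT w|M. X w * iexp (\<Sum>i\<in>S. a i * g i w)) = 0"
    and "\<And>i. i \<in> S \<Longrightarrow> A i \<in> sets borel"
  shows "(CLINT w|M. X w * (\<Prod>i\<in>S. indicator (A i) (g i w))) = 0"
  using assms
proof (induction S arbitrary: X rule: finite_induct)
  case empty
  then show ?case by simp
next
  case (insert j S)
  have [measurable]: "X \<in> borel_measurable M" "g j \<in> borel_measurable M" "A j \<in> sets borel"
    "\<And>i. i \<in> S \<Longrightarrow> g i \<in> borel_measurable M" "\<And>i. i \<in> S \<Longrightarrow> A i \<in> sets borel"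
    using insert.prems by auto
  have "(CLINT w|M. (X w * iexp (t * g j w)) * (\<Prod>i\<in>S. indicator (A i) (g i w))) = 0" for t
  proof (rule insert.IH)
    show "integrable M (\<lambda>w. X w * iexp (t * g j w))"
      using insert.prems(1) by (intro integrable_mult_bounded) auto
    fix a :: "'i \<Rightarrow> real"
    have "(\<Sum>i\<in>insert j S. (a(j := t)) i * g i w) = t * g j w + (\<Sum>i\<in>S. a i * g i w)" for w
    proof -
      have "(\<Sum>i\<in>S. (a(j := t)) i * g i w) = (\<Sum>i\<in>S. a i * g i w)"
        using insert.hyps by (intro sum.cong) auto
      then show ?thesis using insert.hyps by simp
    qed
    then show "(CLINT w|M. X w * iexp (t * g j w) * iexp (\<Sum>i\<in>S. a i * g i w)) = 0"
      using insert.prems(3)[of "a(j := t)"] by (simp only: of_real_add distrib_left exp_add mult.assoc)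
  qed auto
  then have "(CLINT w|M. (X w * (\<Prod>i\<in>S. indicator (A i) (g i w))) * iexp (t * g j w)) = 0" for t
    by (simp add: mult.assoc mult.commute mult.left_commute)
  moreover have "integrable M (\<lambda>w. X w * (\<Prod>i\<in>S. indicator (A i) (g i w)))"
    using insert.prems(1)
    by (intro integrable_mult_bounded) (auto simp: norm_indicator_le_one simp flip: prod_norm intro!: prod_le_1)
  ultimately have "(CLINT w|M. (X w * (\<Prod>i\<in>S. indicator (A i) (g i w))) * indicator (A j) (g j w)) = 0"
    by (intro fourier_unique_complex) auto
  then show ?case
    using insert.hyps by (simp add: mult.assoc mult.commute mult.left_commute)
qed

text \<open>Boxes are an intersection-stable generator of the product sigma-algebra, and the two
  parts of the signed measure agree on them, so their images \<open>P\<close> and \<open>Q\<close>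
  coincide. \<open>G\<close> may be unbounded as long as its product with \<open>X\<close> is
  integrable.\<close>

lemma fourier_unique_family:
  fixes X :: "'w \<Rightarrow> real" and g :: "'i \<Rightarrow> 'w \<Rightarrow> real" and S :: "'i set"
  defines "F \<equiv> \<lambda>w. restrict (\<lambda>i. g i w) S"
  assumes S: "finite S" and X: "integrable M X"
    and g: "\<And>i. i \<in> S \<Longrightarrow> g i \<in> borel_measurable M"
    and zero: "\<And>a. (CLINT w|M. of_real (X w) * iexp (\<Sum>i\<in>S. a i * g i w)) = 0"
    and G [measurable]: "G \<in> borel_measurable (Pi\<^sub>M S (\<lambda>_. borel :: real measure))"
    and int: "integrable M (\<lambda>w. X w * G (F w))"
  shows "(LINT w|M. X w * (G (F w) :: real)) = 0"
proof -
  let ?N = "Pi\<^sub>M S (\<lambda>_. borel :: real measure)"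
  have [measurable]: "X \<in> borel_measurable M" using X by auto
  have F [measurable]: "F \<in> measurable M ?N"
    unfolding F_def using g by (intro measurable_restrict) auto
  have X': "integrable M (\<lambda>w. - X w)" using X by simp
  define P where "P = distr (pos_density M X) ?N F"
  define Q where "Q = distr (pos_density M (\<lambda>w. - X w)) ?N F"
  interpret P: finite_measure P
    unfolding P_def by (rule finite_measure_distr_pos_density[OF X F])
  interpret Q: finite_measure Q
    unfolding Q_def by (rule finite_measure_distr_pos_density[OF X' F])
  have "P = Q"
  proof (rule measure_eqI_PiM_finite[OF S])
    show "sets P = sets ?N" "sets Q = sets ?N"
      by (simp_all add: P_def Q_def)
    fix A assume A: "\<And>i. i \<in> S \<Longrightarrow> A i \<in> sets (borel :: real measure)"
    then have [measurable]: "Pi\<^sub>E S A \<in> sets ?N"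
      using S by (intro sets_PiM_I_finite) auto
    have "indicator (Pi\<^sub>E S A) (F w) = (\<Prod>i\<in>S. indicator (A i) (g i w) :: complex)" for w
      using S by (auto simp: F_def indicator_def PiE_iff prod_zero_iff)
    then have "(CLINT w|M. of_real (X w) * indicator (Pi\<^sub>E S A) (F w)) = 0"
      using fourier_unique_box[of S M "\<lambda>w. of_real (X w)" g A] X g zero S A by simp
    moreover have "of_real (X w) * indicator (Pi\<^sub>E S A) (F w) = complex_of_real (X w * indicator (Pi\<^sub>E S A) (F w))" for w
      by (simp add: indicator_def)
    ultimately have "(LINT w|M. X w * indicator (Pi\<^sub>E S A) (F w)) = 0"
      by (simp only: integral_complex_of_real of_real_eq_0_iff)
    moreover have "integrable M (\<lambda>w. X w * indicator (Pi\<^sub>E S A) (F w))"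
      using X norm_indicator_le_one by (intro integrable_mult_bounded) auto
    ultimately have "measure P (Pi\<^sub>E S A) = measure Q (Pi\<^sub>E S A)"
      using integral_pos_neg_parts[of M X "\<lambda>w. indicator (Pi\<^sub>E S A) (F w) :: real"]
      by (simp add: P_def Q_def measure_distr_pos_density)
    then show "emeasure P (Pi\<^sub>E S A) = emeasure Q (Pi\<^sub>E S A)"
      by (simp add: P.emeasure_eq_measure Q.emeasure_eq_measure)
  next
    show "range (\<lambda>n::nat. Pi\<^sub>E S (\<lambda>_. UNIV :: real set)) \<subseteq> prod_algebra S (\<lambda>_. borel)"
      using S by (auto intro!: prod_algebraI_finite)
  qed (auto simp: space_PiM)
  then have "(LINT x|P. G x) = (LINT x|Q. G x)" by simp
  then have "(LINT w|M. max 0 (X w) *\<^sub>R G (F w)) = (LINT w|M. max 0 (- X w) *\<^sub>R G (F w))"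
    unfolding P_def Q_def by (simp add: integral_distr_pos_density)
  then show ?thesis
    using integral_pos_neg_parts[of M X "\<lambda>w. G (F w)"] int by simp
qed

section \<open>Centred Gaussian variables\<close>

text \<open>Completing the square: exponential tilting shifts the mean of a Gaussian to
  \<open>c * s\<^sup>2\<close>.\<close>

lemma normal_density_mult_exp:
  assumes "s > 0"
  shows "normal_density 0 s z * exp (c * z) = exp (c\<^sup>2 * s\<^sup>2 / 2) * normal_density (c * s\<^sup>2) s z"
proof -
  have "- z\<^sup>2 / (2 * s\<^sup>2) + c * z = c\<^sup>2 * s\<^sup>2 / 2 - (z - c * s\<^sup>2)\<^sup>2 / (2 * s\<^sup>2)"
    using assms by (simp add: field_simps power2_eq_square)
  then have "exp (- z\<^sup>2 / (2 * s\<^sup>2)) * exp (c * z) = exp (c\<^sup>2 * s\<^sup>2 / 2) * exp (- (z - c * s\<^sup>2)\<^sup>2 / (2 * s\<^sup>2))"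
    by (simp flip: exp_add)
  then show ?thesis
    by (simp add: normal_density_def)
qed

lemma integrable_normal_density_mult_exp_abs:
  assumes "s > 0"
  shows "integrable lborel (\<lambda>z. normal_density 0 s z * exp (c * \<bar>z\<bar>))"
proof (rule Bochner_Integration.integrable_bound)
  show "integrable lborel (\<lambda>z. normal_density 0 s z * exp (c * z) + normal_density 0 s z * exp (- c * z))"
    using assms by (simp only: normal_density_mult_exp) (simp add: integrable_normal_density)
  show "AE z in lborel. norm (normal_density 0 s z * exp (c * \<bar>z\<bar>))
      \<le> norm (normal_density 0 s z * exp (c * z) + normal_density 0 s z * exp (- c * z))"
  proof (intro AE_I2)
    fix z
    have "exp (c * \<bar>z\<bar>) \<le> exp (c * z) + exp (- c * z)"
      by (cases "z \<ge> 0") auto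
    then have "normal_density 0 s z * exp (c * \<bar>z\<bar>) \<le> normal_density 0 s z * (exp (c * z) + exp (- c * z))"
      by (intro mult_left_mono) auto
    then show "norm (normal_density 0 s z * exp (c * \<bar>z\<bar>))
      \<le> norm (normal_density 0 s z * exp (c * z) + normal_density 0 s z * exp (- c * z))"
      by (simp add: distrib_left)
  qed
qed simp

lemma (in prob_space) centred_gaussian_integrable_exp_abs:
  assumes "centred_gaussian M X"
  shows "integrable M (\<lambda>w. exp (c * \<bar>X w\<bar>))"
proof -
  have [measurable]: "X \<in> borel_measurable M" using assms by (simp add: centred_gaussian_def)
  from assms consider "AE w in M. X w = 0" |
    s where "s > 0" "distributed M lborel X (\<lambda>t. ennreal (normal_density 0 s t))"
    by (auto simp: centred_gaussian_def)
  then show ?thesis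
  proof cases
    case 1
    then have "AE w in M. exp (c * \<bar>X w\<bar>) = 1" by eventually_elim simp
    then show ?thesis
      by (subst integrable_cong_AE[where g = "\<lambda>_. 1"]) auto
  next
    case 2
    then show ?thesis
      using distributed_integrable[OF 2(2), of "\<lambda>z. exp (c * \<bar>z\<bar>)"]
        integrable_normal_density_mult_exp_abs[of s c] by simp
  qed
qed

text \<open>The left side is a single term of the exponential series, up to the factorial. The bound
  lets exponential moments control every polynomial moment.\<close>

lemma power_le_fact_mult_exp:
  fixes y :: real
  assumes "y \<ge> 0"
  shows "y ^ k \<le> fact k * exp y"
proof -
  have "sum (\<lambda>n. y ^ n /\<^sub>R fact n) {k} \<le> (\<Sum>n. y ^ n /\<^sub>R fact n)"
    using exp_converges[of y] assms by (intro sum_le_suminf) (auto simp: sums_iff)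
  then have "y ^ k / fact k \<le> exp y"
    using exp_converges[of y] by (simp add: sums_iff field_simps)
  then show ?thesis by (simp add: field_simps)
qed

lemma (in prob_space) centred_gaussian_integrable_power_abs:
  assumes "centred_gaussian M X"
  shows "integrable M (\<lambda>w. \<bar>X w\<bar> ^ k)"
proof (rule Bochner_Integration.integrable_bound)
  show "integrable M (\<lambda>w. fact k * exp (1 * \<bar>X w\<bar>))"
    using centred_gaussian_integrable_exp_abs[OF assms] by (intro integrable_mult_right)
  show "AE w in M. norm (\<bar>X w\<bar> ^ k) \<le> norm (fact k * exp (1 * \<bar>X w\<bar>))"
    using power_le_fact_mult_exp[of "\<bar>X _\<bar>" k] by (intro AE_I2) (simp add: power_abs)
qed (use assms in \<open>auto simp: centred_gaussian_def\<close>)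

lemma (in prob_space) normal_second_moment:
  assumes "s > 0" "distributed M lborel X (\<lambda>t. ennreal (normal_density 0 s t))"
  shows "L2_inner M X X = s\<^sup>2"
  using normal_distributed_variance[OF assms] normal_distributed_expectation[OF assms]
  by (simp add: L2_inner_def power2_eq_square)

text \<open>Writing the variance as an inner product covers the point mass by the same formula. That
  case does occur: the variables left after removing a dual variable are linearly dependent, and for
  a single index they vanish.\<close>

lemma (in prob_space) centred_gaussian_iexp:
  assumes "centred_gaussian M X"
  shows "(CLINT w|M. iexp (X w)) = of_real (exp (- L2_inner M X X / 2))"
proof -
  have [measurable]: "X \<in> borel_measurable M" using assms by (simp add: centred_gaussian_def)
  from assms consider "AE w in M. X w = 0" |
    s where "s > 0" "distributed M lborel X (\<lambda>t. ennreal (normal_density 0 s t))"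
    by (auto simp: centred_gaussian_def)
  then show ?thesis
  proof cases
    case 1
    then have "AE w in M. iexp (X w) = 1" by eventually_elim simp
    then have "(CLINT w|M. iexp (X w)) = (CLINT w|M. 1)"
      by (intro integral_cong_AE) auto
    moreover have "AE w in M. X w * X w = 0"
      using 1 by eventually_elim simp
    then have "L2_inner M X X = 0"
      unfolding L2_inner_def by (rule integral_eq_zero_AE)
    ultimately show ?thesis by (simp add: prob_space)
  next
    case 2
    have "distributed M lborel (\<lambda>w. X w / s) std_normal_density"
      using 2 normal_standard_normal_convert[of s X 0] by simp
    then have "std_normal_distribution = distr M lborel (\<lambda>w. X w / s)"
      by (simp add: distributed_def)
    then have "char std_normal_distribution s = (CLINT w|M. iexp (s * (X w / s)))"
      unfolding char_def by (simp only:) (rule integral_distr; simp)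
    then show ?thesis
      using 2(1) by (simp add: char_std_normal_distribution normal_second_moment[OF 2])
  qed
qed

lemma normal_density_has_derivative:
  assumes "s > 0"
  shows "(normal_density 0 s has_real_derivative - (z / s\<^sup>2) * normal_density 0 s z) (at z)"
  unfolding normal_density_def using assms
  by (auto intro!: derivative_eq_intros simp: field_simps power2_eq_square)

text \<open>The integrand is the derivative of \<open>- s\<^sup>2 * (\<phi> z * nd z)\<close>,
  because the density has logarithmic derivative \<open>- z / s\<^sup>2\<close>. The boundary terms
  vanish since Gaussian decay beats \<open>exp \<bar>z\<bar>\<close>.\<close>

lemma normal_stein:
  fixes \<phi> \<phi>' :: "real \<Rightarrow> real"
  assumes s: "s > 0"
    and deriv: "\<And>z. (\<phi> has_real_derivative \<phi>' z) (at z)"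
    and cont: "continuous_on UNIV \<phi>'"
    and bound: "\<And>z. \<bar>\<phi> z\<bar> \<le> C * exp \<bar>z\<bar>" "\<And>z. \<bar>\<phi>' z\<bar> \<le> C * exp \<bar>z\<bar>"
  shows "(LINT z|lborel. normal_density 0 s z * (z * \<phi> z - s\<^sup>2 * \<phi>' z)) = 0"
proof -
  define nd where "nd = normal_density 0 s"
  have nd: "nd z \<ge> 0" for z by (simp add: nd_def)
  have cont_\<phi>: "continuous_on UNIV \<phi>"
    using deriv by (intro continuous_at_imp_continuous_on) (auto intro: DERIV_isCont)
  have cont_nd: "continuous_on UNIV nd"
    unfolding nd_def using normal_density_has_derivative[OF s]
    by (intro continuous_at_imp_continuous_on) (auto intro: DERIV_isCont)
  have [measurable]: "\<phi> \<in> borel_measurable borel" "\<phi>' \<in> borel_measurable borel" "nd \<in> borel_measurable borel"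
    using cont cont_\<phi> cont_nd by (auto intro: borel_measurable_continuous_onI)
  define g where "g = (\<lambda>z. nd z * (z * \<phi> z - s\<^sup>2 * \<phi>' z))"
  have C: "C \<ge> 0" using bound(1)[of 0] by (simp add: order_trans[OF abs_ge_zero])
  have "integrable lborel g"
  proof (rule Bochner_Integration.integrable_bound)
    \<comment> \<open>Both \<open>\<bar>z\<bar>\<close> and 1 are at most
      \<open>exp \<bar>z\<bar>\<close>, so each of the two terms is dominated by a multiple of
      \<open>exp (2 * \<bar>z\<bar>)\<close>, with factors \<open>C\<close> and
      \<open>C * s\<^sup>2\<close>.\<close>
    show "integrable lborel (\<lambda>z. (C * (1 + s\<^sup>2)) * (nd z * exp (2 * \<bar>z\<bar>)))"
      using integrable_normal_density_mult_exp_abs[OF s] by (simp add: nd_def)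
    show "AE z in lborel. norm (g z) \<le> norm ((C * (1 + s\<^sup>2)) * (nd z * exp (2 * \<bar>z\<bar>)))"
    proof (intro AE_I2)
      fix z :: real
      have e: "\<bar>z\<bar> \<le> exp \<bar>z\<bar>" "1 \<le> exp \<bar>z\<bar>"
        using exp_ge_add_one_self[of "\<bar>z\<bar>"] by linarith+
      have "\<bar>z * \<phi> z\<bar> \<le> exp \<bar>z\<bar> * (C * exp \<bar>z\<bar>)"
        unfolding abs_mult using e bound by (intro mult_mono) auto
      moreover have "\<bar>s\<^sup>2 * \<phi>' z\<bar> \<le> s\<^sup>2 * (C * (exp \<bar>z\<bar> * exp \<bar>z\<bar>))"
        unfolding abs_mult
      proof (intro mult_mono)
        have "C * exp \<bar>z\<bar> \<le> C * (exp \<bar>z\<bar> * exp \<bar>z\<bar>)"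
          using e C by (intro mult_left_mono) auto
        then show "\<bar>\<phi>' z\<bar> \<le> C * (exp \<bar>z\<bar> * exp \<bar>z\<bar>)"
          using bound(2)[of z] by linarith
      qed auto
      ultimately have "\<bar>z * \<phi> z - s\<^sup>2 * \<phi>' z\<bar> \<le> C * (1 + s\<^sup>2) * exp (2 * \<bar>z\<bar>)"
        using abs_triangle_ineq4[of "z * \<phi> z" "s\<^sup>2 * \<phi>' z"]
        unfolding mult_2 exp_add by (simp add: algebra_simps)
      then have "nd z * \<bar>z * \<phi> z - s\<^sup>2 * \<phi>' z\<bar> \<le> nd z * (C * (1 + s\<^sup>2) * exp (2 * \<bar>z\<bar>))"
        using nd by (rule mult_left_mono)
      then show "norm (g z) \<le> norm ((C * (1 + s\<^sup>2)) * (nd z * exp (2 * \<bar>z\<bar>)))"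
        using nd[of z] C by (simp add: g_def abs_mult mult.left_commute)
    qed
  qed (simp add: g_def)
  define G where "G = (\<lambda>z. - s\<^sup>2 * (\<phi> z * nd z))"
  have G_deriv: "(G has_real_derivative g z) (at z)" for z
    unfolding G_def nd_def g_def using s
    by (auto intro!: derivative_eq_intros deriv normal_density_has_derivative simp: field_simps)
  have g_cont: "isCont g z" for z
    using cont cont_\<phi> cont_nd unfolding g_def
    by (intro continuous_intros) (auto simp: continuous_on_eq_continuous_at)
  have lim: "((\<lambda>z. s\<^sup>2 * (C * exp \<bar>z\<bar> * nd z)) \<longlongrightarrow> 0) F" if "F = at_top \<or> F = at_bot" for F
    using that
  proof
    assume F: "F = at_top"
    have "((\<lambda>z. s\<^sup>2 * (C * exp z * nd z)) \<longlongrightarrow> 0) at_top"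
      unfolding nd_def normal_density_def using s by real_asymp
    then show ?thesis unfolding F
      by (rule Lim_transform_eventually) (use eventually_ge_at_top[of 0] in eventually_elim, simp)
  next
    assume F: "F = at_bot"
    have "((\<lambda>z. s\<^sup>2 * (C * exp (- z) * nd z)) \<longlongrightarrow> 0) at_bot"
      unfolding nd_def normal_density_def using s by real_asymp
    then show ?thesis unfolding F
      by (rule Lim_transform_eventually) (use eventually_le_at_bot[of 0] in eventually_elim, simp)
  qed
  have G_lim: "(G \<longlongrightarrow> 0) F" if "F = at_top \<or> F = at_bot" for F
  proof (rule Lim_null_comparison[OF _ lim[OF that]])
    show "\<forall>\<^sub>F z in F. norm (G z) \<le> s\<^sup>2 * (C * exp \<bar>z\<bar> * nd z)"
      using bound(1) nd by (intro always_eventually allI) (auto simp: G_def abs_mult intro!: mult_left_mono mult_right_mono)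
  qed
  have "(LBINT z=-\<infinity>..\<infinity>. g z) = 0 - 0"
  proof (rule interval_integral_FTC_integrable)
    show "(G has_vector_derivative g z) (at z)" for z
      using G_deriv by (simp add: has_real_derivative_iff_has_vector_derivative)
    show "((G \<circ> real_of_ereal) \<longlongrightarrow> 0) (at_right (- \<infinity>))" "((G \<circ> real_of_ereal) \<longlongrightarrow> 0) (at_left \<infinity>)"
      using G_lim by (simp_all add: ereal_tendsto_simps)
  qed (use \<open>integrable lborel g\<close> g_cont in \<open>auto simp: set_integrable_def einterval_eq\<close>)
  then show ?thesis
    by (simp add: interval_lebesgue_integral_def einterval_eq set_lebesgue_integral_def g_def nd_def)
qed

lemma (in prob_space) centred_normal_stein:
  fixes \<phi> \<phi>' :: "real \<Rightarrow> real"
  assumes "s > 0" "distributed M lborel Z (\<lambda>t. ennreal (normal_density 0 s t))"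
    and deriv: "\<And>z. (\<phi> has_real_derivative \<phi>' z) (at z)"
    and cont: "continuous_on UNIV \<phi>'"
    and bound: "\<And>z. \<bar>\<phi> z\<bar> \<le> C * exp \<bar>z\<bar>" "\<And>z. \<bar>\<phi>' z\<bar> \<le> C * exp \<bar>z\<bar>"
  shows "(LINT w|M. Z w * \<phi> (Z w) - s\<^sup>2 * \<phi>' (Z w)) = 0"
proof -
  have "continuous_on UNIV \<phi>"
    using deriv by (intro continuous_at_imp_continuous_on) (auto intro: DERIV_isCont)
  then have [measurable]: "\<phi> \<in> borel_measurable borel" "\<phi>' \<in> borel_measurable borel"
    using cont by (auto intro: borel_measurable_continuous_onI)
  show ?thesis
    using distributed_integral[OF assms(2), of "\<lambda>z. z * \<phi> z - s\<^sup>2 * \<phi>' z"] normal_stein[OF assms(1) deriv cont bound]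
    by simp
qed

section \<open>Functions of polynomial growth\<close>

text \<open>Continuity provides measurability and the growth bound provides moments, so composition
  with a Gaussian vector is square integrable.\<close>

definition tame :: "'i set \<Rightarrow> (('i \<Rightarrow> real) \<Rightarrow> real) \<Rightarrow> bool"
  where "tame D \<Psi> \<longleftrightarrow> continuous_on (families D) \<Psi> \<and> polynomial_growth D \<Psi>"

lemma polynomial_growth_nonneg:
  assumes "polynomial_growth D \<Psi>"
  obtains C k where "C \<ge> 0" "\<And>v. v \<in> families D \<Longrightarrow> \<bar>\<Psi> v\<bar> \<le> C * (1 + L2_set v D) ^ k"
proof -
  obtain C k where C: "\<And>v. v \<in> families D \<Longrightarrow> \<bar>\<Psi> v\<bar> \<le> C * (1 + L2_set v D) ^ k"
    using assms by (auto simp: polynomial_growth_def)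
  have "\<bar>\<Psi> v\<bar> \<le> \<bar>C\<bar> * (1 + L2_set v D) ^ k" if "v \<in> families D" for v
  proof -
    have "C * (1 + L2_set v D) ^ k \<le> \<bar>C\<bar> * (1 + L2_set v D) ^ k"
      by (intro mult_right_mono) (auto simp: L2_set_nonneg)
    then show ?thesis using C[OF that] by linarith
  qed
  then show ?thesis using that[of "\<bar>C\<bar>" k] by simp
qed

lemma tame_cong:
  assumes "tame D \<Phi>" "\<And>v. v \<in> families D \<Longrightarrow> \<Phi> v = \<Psi> v"
  shows "tame D \<Psi>"
  using assms unfolding tame_def polynomial_growth_def
  by (auto cong: continuous_on_cong)

lemma tame_const: "tame D (\<lambda>v. c)"
proof -
  have "\<bar>c\<bar> \<le> \<bar>c\<bar> * (1 + L2_set v D) ^ 0" for v by simp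
  then show ?thesis
    unfolding tame_def polynomial_growth_def by (blast intro: continuous_on_const)
qed

lemma tame_coordinate:
  assumes "finite D" "x \<in> D"
  shows "tame D (\<lambda>v. v x)"
proof -
  have "\<bar>v x\<bar> \<le> 1 * (1 + L2_set v D) ^ 1" for v
    using member_le_L2_set[OF assms, of v] L2_set_nonneg[of v D]
      member_le_L2_set[OF assms, of "\<lambda>x. - v x"] by (simp add: L2_set_def)
  moreover have "continuous_on (families D) (\<lambda>v. v x)"
    by (intro continuous_on_product_coordinates continuous_on_subset[OF _ subset_UNIV])
  ultimately show ?thesis
    unfolding tame_def polynomial_growth_def by blast
qed

lemma tame_add:
  assumes "tame D \<Phi>" "tame D \<Psi>"
  shows "tame D (\<lambda>v. \<Phi> v + \<Psi> v)"
proof -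
  obtain C k where C: "C \<ge> 0" "\<And>v. v \<in> families D \<Longrightarrow> \<bar>\<Phi> v\<bar> \<le> C * (1 + L2_set v D) ^ k"
    using assms(1) polynomial_growth_nonneg unfolding tame_def by blast
  obtain C' k' where C': "C' \<ge> 0" "\<And>v. v \<in> families D \<Longrightarrow> \<bar>\<Psi> v\<bar> \<le> C' * (1 + L2_set v D) ^ k'"
    using assms(2) polynomial_growth_nonneg unfolding tame_def by blast
  have "\<bar>\<Phi> v + \<Psi> v\<bar> \<le> (C + C') * (1 + L2_set v D) ^ (k + k')" if "v \<in> families D" for v
  proof -
    have "(1 + L2_set v D) ^ k \<le> (1 + L2_set v D) ^ (k + k')" "(1 + L2_set v D) ^ k' \<le> (1 + L2_set v D) ^ (k + k')"
      by (intro power_increasing; simp add: L2_set_nonneg)+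
    then have "C * (1 + L2_set v D) ^ k \<le> C * (1 + L2_set v D) ^ (k + k')"
      "C' * (1 + L2_set v D) ^ k' \<le> C' * (1 + L2_set v D) ^ (k + k')"
      using C(1) C'(1) by (auto intro: mult_left_mono)
    then show ?thesis
      using C(2)[OF that] C'(2)[OF that] by (simp add: distrib_right)
  qed
  then have "polynomial_growth D (\<lambda>v. \<Phi> v + \<Psi> v)"
    unfolding polynomial_growth_def by blast
  then show ?thesis
    using assms by (simp add: tame_def continuous_on_add)
qed

lemma tame_mult:
  assumes "tame D \<Phi>" "tame D \<Psi>"
  shows "tame D (\<lambda>v. \<Phi> v * \<Psi> v)"
proof -
  obtain C k where C: "C \<ge> 0" "\<And>v. v \<in> families D \<Longrightarrow> \<bar>\<Phi> v\<bar> \<le> C * (1 + L2_set v D) ^ k"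
    using assms(1) polynomial_growth_nonneg unfolding tame_def by blast
  obtain C' k' where C': "C' \<ge> 0" "\<And>v. v \<in> families D \<Longrightarrow> \<bar>\<Psi> v\<bar> \<le> C' * (1 + L2_set v D) ^ k'"
    using assms(2) polynomial_growth_nonneg unfolding tame_def by blast
  have "\<bar>\<Phi> v * \<Psi> v\<bar> \<le> (C * C') * (1 + L2_set v D) ^ (k + k')" if "v \<in> families D" for v
  proof -
    have "\<bar>\<Phi> v\<bar> * \<bar>\<Psi> v\<bar> \<le> (C * (1 + L2_set v D) ^ k) * (C' * (1 + L2_set v D) ^ k')"
      using C C' that by (intro mult_mono) (auto simp: L2_set_nonneg)
    then show ?thesis by (simp add: abs_mult power_add ac_simps)
  qed
  then have "polynomial_growth D (\<lambda>v. \<Phi> v * \<Psi> v)"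
    unfolding polynomial_growth_def by blast
  then show ?thesis
    using assms by (simp add: tame_def continuous_on_mult)
qed

lemma continuous_on_fun_upd:
  assumes "continuous_on S g"
  shows "continuous_on S (\<lambda>z. r(x := g z :: 'b :: topological_space))"
proof (rule continuous_on_coordinatewise_then_product)
  show "continuous_on S (\<lambda>z. (r(x := g z)) y)" for y
    using assms by (cases "y = x") auto
qed

lemma fun_upd_families: "v \<in> families D \<Longrightarrow> x \<in> D \<Longrightarrow> v(x := t) \<in> families D"
  by (auto simp: PiE_iff extensional_def)

lemma tame_line_continuous:
  assumes "tame D \<Psi>" "r \<in> families D" "x \<in> D" "continuous_on UNIV g"
  shows "continuous_on UNIV (\<lambda>z. \<Psi> (r(x := g z)))"
proof (rule continuous_on_compose2[where f = "\<lambda>z. r(x := g z)" and g = \<Psi> and t = "families D"])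
  show "continuous_on (families D) \<Psi>"
    using assms(1) by (simp add: tame_def)
  show "continuous_on UNIV (\<lambda>z. r(x := g z))"
    by (rule continuous_on_fun_upd[OF assms(4)])
  show "range (\<lambda>z. r(x := g z)) \<subseteq> families D"
    using fun_upd_families[OF assms(2,3)] by blast
qed

text \<open>Along a coordinate line the norm grows at most affinely in \<open>\<bar>z\<bar>\<close>,
  and a power is dominated by an exponential. The result is the growth condition of Stein's
  identity.\<close>

lemma tame_line_bound:
  assumes "finite D" "tame D \<Psi>" "r \<in> families D" "x \<in> D"
  shows "\<exists>C\<ge>0. \<forall>z. \<bar>\<Psi> (r(x := r x + c * z))\<bar> \<le> C * exp \<bar>z\<bar>"
proof -
  obtain C k where C: "C \<ge> 0" "\<And>v. v \<in> families D \<Longrightarrow> \<bar>\<Psi> v\<bar> \<le> C * (1 + L2_set v D) ^ k"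
    using assms(2) polynomial_growth_nonneg unfolding tame_def by blast
  \<comment> \<open>\<open>A\<close> dominates every coefficient of \<open>1 + (\<Sum>y\<in>D.
    \<bar>r y\<bar>) + \<bar>c\<bar> * \<bar>z\<bar>\<close>, so this quantity is at most
    \<open>A * (1 + \<bar>z\<bar>)\<close>. The factor \<open>exp 1\<close> below comes from
    \<open>exp (1 + \<bar>z\<bar>)\<close>.\<close>
  define A where "A = 1 + (\<Sum>y\<in>D. \<bar>r y\<bar>) + \<bar>c\<bar>"
  have A: "A \<ge> 0" unfolding A_def by (intro add_nonneg_nonneg sum_nonneg) auto
  have "\<bar>\<Psi> (r(x := r x + c * z))\<bar> \<le> (C * A ^ k * fact k * exp 1) * exp \<bar>z\<bar>" for z
  proof -
    have "L2_set (r(x := r x + c * z)) D \<le> (\<Sum>y\<in>D. \<bar>(r(x := r x + c * z)) y\<bar>)"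
      by (rule L2_set_le_sum_abs)
    also have "\<dots> \<le> (\<Sum>y\<in>D. \<bar>r y\<bar> + (if y = x then \<bar>c * z\<bar> else 0))"
      by (intro sum_mono) auto
    also have "\<dots> = (\<Sum>y\<in>D. \<bar>r y\<bar>) + \<bar>c\<bar> * \<bar>z\<bar>"
      using assms(1,4) by (simp add: sum.distrib abs_mult)
    finally have "1 + L2_set (r(x := r x + c * z)) D \<le> 1 + (\<Sum>y\<in>D. \<bar>r y\<bar>) + \<bar>c\<bar> * \<bar>z\<bar>"
      by simp
    also have "\<dots> \<le> A * (1 + \<bar>z\<bar>)"
      unfolding A_def by (simp add: algebra_simps sum_nonneg)
    finally have "(1 + L2_set (r(x := r x + c * z)) D) ^ k \<le> (A * (1 + \<bar>z\<bar>)) ^ k"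
      by (intro power_mono) (auto simp: L2_set_nonneg)
    also have "\<dots> \<le> A ^ k * (fact k * exp (1 + \<bar>z\<bar>))"
      unfolding power_mult_distrib using A
      by (intro mult_left_mono power_le_fact_mult_exp) auto
    finally have "C * (1 + L2_set (r(x := r x + c * z)) D) ^ k \<le> C * (A ^ k * (fact k * exp (1 + \<bar>z\<bar>)))"
      using C(1) by (rule mult_left_mono)
    then show ?thesis
      using C(2)[OF fun_upd_families[OF assms(3,4)], of "r x + c * z"] by (simp add: exp_add ac_simps)
  qed
  moreover have "0 \<le> C * A ^ k * fact k * exp 1"
    using A C(1) by simp
  ultimately show ?thesis by blast
qed

text \<open>Two sigma-algebras have to be reconciled. Countability of the index type makes the
  inclusion of the product space into the function space Borel measurable, and
  \<open>families D\<close> is closed there, so extension by zero of a function continuous on it is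
  Borel.\<close>

lemma tame_measurable:
  fixes \<Psi> :: "('i :: countable \<Rightarrow> real) \<Rightarrow> real"
  assumes "finite D" "tame D \<Psi>"
  shows "\<Psi> \<in> borel_measurable (Pi\<^sub>M D (\<lambda>_. borel))"
proof -
  have id: "(\<lambda>v. v) \<in> measurable (Pi\<^sub>M D (\<lambda>_. borel)) (borel :: ('i \<Rightarrow> real) measure)"
  proof (rule measurable_coordinatewise_then_product)
    fix i :: 'i
    show "(\<lambda>v. v i) \<in> borel_measurable (Pi\<^sub>M D (\<lambda>_. borel :: real measure))"
    proof (cases "i \<in> D")
      \<comment> \<open>Off \<open>D\<close> all families take the value \<open>undefined\<close>,
        so such a coordinate is constant.\<close>
      case False
      then have "(\<lambda>v. v i) \<in> borel_measurable (Pi\<^sub>M D (\<lambda>_. borel :: real measure))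
          \<longleftrightarrow> (\<lambda>v. undefined :: real) \<in> borel_measurable (Pi\<^sub>M D (\<lambda>_. borel :: real measure))"
        by (intro measurable_cong) (auto simp: space_PiM PiE_iff extensional_def)
      then show ?thesis by simp
    qed simp
  qed
  have "closed (families D)"
  proof -
    have eq: "families D = (\<Inter>i\<in>- D. {v :: 'i \<Rightarrow> real. v i = undefined})"
      by (auto simp: PiE_iff extensional_def)
    have "closed {v :: 'i \<Rightarrow> real. v i = undefined}" for i
      by (intro closed_Collect_eq continuous_intros continuous_on_product_coordinates)
    then show ?thesis
      unfolding eq by (intro closed_INT) auto
  qed
  then have "(\<lambda>v. indicator (families D) v *\<^sub>R \<Psi> v) \<in> borel_measurable borel"
    using assms(2) by (intro borel_measurable_continuous_on_indicator) (auto simp: tame_def)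
  from measurable_compose[OF id this]
  have "(\<lambda>v. indicator (families D) v *\<^sub>R \<Psi> v) \<in> borel_measurable (Pi\<^sub>M D (\<lambda>_. borel))" .
  then show ?thesis
    by (subst measurable_cong[where g = "\<lambda>v. indicator (families D) v *\<^sub>R \<Psi> v"]) (auto simp: space_PiM)
qed

text \<open>The class to which integration by parts applies. It asks for one derivative only, which
  makes stability under products immediate.\<close>

definition tame1 :: "'i set \<Rightarrow> (('i \<Rightarrow> real) \<Rightarrow> real) \<Rightarrow> bool"
  where "tame1 D \<Psi> \<longleftrightarrow> tame D \<Psi> \<and>
    (\<forall>x\<in>D. tame D (partial x \<Psi>) \<and>
      (\<forall>v\<in>families D. (\<lambda>t. \<Psi> (v(x := t))) differentiable at (v x)))"

text \<open>The definition gives differentiability at the base point; moving the base point to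
  \<open>v(x := u)\<close> gives it everywhere on the line.\<close>

lemma tame1_has_derivative:
  assumes "tame1 D \<Psi>" "x \<in> D" "v \<in> families D"
  shows "((\<lambda>t. \<Psi> (v(x := t))) has_real_derivative partial x \<Psi> (v(x := u))) (at u)"
proof -
  have "(\<lambda>t. \<Psi> ((v(x := u))(x := t))) differentiable at ((v(x := u)) x)"
    using assms fun_upd_families[of v D x u] unfolding tame1_def by blast
  then show ?thesis
    by (simp add: partial_def DERIV_deriv_iff_real_differentiable)
qed

lemma partialI:
  assumes "((\<lambda>t. \<Psi> (v(x := t))) has_real_derivative d) (at (v x))"
  shows "partial x \<Psi> v = d"
  unfolding partial_def using assms by (rule DERIV_imp_deriv)

lemma tame1_mult_derivative:
  assumes "tame1 D \<Phi>" "tame1 D \<Psi>" "x \<in> D" "v \<in> families D"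
  shows "((\<lambda>t. \<Phi> (v(x := t)) * \<Psi> (v(x := t))) has_real_derivative
    partial x \<Phi> v * \<Psi> v + \<Phi> v * partial x \<Psi> v) (at (v x))"
  using DERIV_mult[OF tame1_has_derivative[OF assms(1,3,4), of "v x"] tame1_has_derivative[OF assms(2,3,4), of "v x"]]
  by (simp add: ac_simps)

lemma tame1_mult:
  assumes "tame1 D \<Phi>" "tame1 D \<Psi>"
  shows "tame1 D (\<lambda>v. \<Phi> v * \<Psi> v)"
  unfolding tame1_def
proof (intro conjI ballI)
  show "tame D (\<lambda>v. \<Phi> v * \<Psi> v)"
    using assms by (simp add: tame1_def tame_mult)
  fix x assume x: "x \<in> D"
  have "tame D (\<lambda>v. partial x \<Phi> v * \<Psi> v + \<Phi> v * partial x \<Psi> v)"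
    using assms x by (simp add: tame1_def tame_add tame_mult)
  then show "tame D (partial x (\<lambda>v. \<Phi> v * \<Psi> v))"
    by (rule tame_cong) (rule partialI[OF tame1_mult_derivative[OF assms x], symmetric])
  fix v assume v: "v \<in> families D"
  show "(\<lambda>t. \<Phi> (v(x := t)) * \<Psi> (v(x := t))) differentiable at (v x)"
    using tame1_mult_derivative[OF assms x v] real_differentiable_def by blast
qed

lemma partial_mult:
  "tame1 D \<Phi> \<Longrightarrow> tame1 D \<Psi> \<Longrightarrow> x \<in> D \<Longrightarrow> v \<in> families D \<Longrightarrow>
    partial x (\<lambda>v. \<Phi> v * \<Psi> v) v = partial x \<Phi> v * \<Psi> v + \<Phi> v * partial x \<Psi> v"
  by (rule partialI) (rule tame1_mult_derivative)

lemma smooth_fun_tame1_partials: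
  assumes "smooth_fun D \<Phi>" "\<forall>xs\<in>lists D. polynomial_growth D (partials xs \<Phi>)" "xs \<in> lists D"
  shows "tame1 D (partials xs \<Phi>)"
proof -
  have tame: "tame D (partials ys \<Phi>)" if "ys \<in> lists D" for ys
    using assms that by (simp add: tame_def smooth_fun_def)
  have "tame D (partial x (partials xs \<Phi>))" if "x \<in> D" for x
    using tame[of "x # xs"] that assms(3) by (simp add: partials_def)
  then show ?thesis
    using assms tame unfolding tame1_def smooth_fun_def by blast
qed

section \<open>Polynomials in the coordinates\<close>

text \<open>Polynomial functions rather than formal polynomials; the index bounds the degree and
  need not equal it. Multiplication by a single coordinate as a generator suits inductions on
  derivatives and on the Hermite recursion.\<close>

inductive Pol :: "'i set \<Rightarrow> nat \<Rightarrow> (('i \<Rightarrow> real) \<Rightarrow> real) \<Rightarrow> bool" for D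
  where
    Pol_const: "Pol D n (\<lambda>v. c)"
  | Pol_add: "Pol D n p \<Longrightarrow> Pol D n q \<Longrightarrow> Pol D n (\<lambda>v. p v + q v)"
  | Pol_coordinate_mult: "x \<in> D \<Longrightarrow> Pol D n p \<Longrightarrow> Pol D (Suc n) (\<lambda>v. v x * p v)"

lemma Pol_mono: "Pol D n p \<Longrightarrow> n \<le> m \<Longrightarrow> Pol D m p"
proof (induction arbitrary: m rule: Pol.induct)
  case (Pol_coordinate_mult x n p)
  then show ?case by (cases m) (auto intro: Pol.intros)
qed (auto intro: Pol.intros)

lemma Pol_cmult: "Pol D n p \<Longrightarrow> Pol D n (\<lambda>v. c * p v)"
proof (induction rule: Pol.induct)
  case (Pol_coordinate_mult x n p)
  then show ?case
    using Pol.Pol_coordinate_mult[of x D n "\<lambda>v. c * p v"] by (simp add: mult.left_commute)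
qed (auto simp: distrib_left intro: Pol.intros)

lemma Pol_diff: "Pol D n p \<Longrightarrow> Pol D n q \<Longrightarrow> Pol D n (\<lambda>v. p v - q v)"
  using Pol_add[OF _ Pol_cmult[of D n q "-1"], of p] by simp

lemma Pol_sum: "(\<And>i. i \<in> I \<Longrightarrow> Pol D n (p i)) \<Longrightarrow> Pol D n (\<lambda>v. \<Sum>i\<in>I. p i v)"
  by (induction I rule: infinite_finite_induct) (auto intro: Pol.intros)

lemma Pol_mult:
  assumes "Pol D n p" "Pol D m q"
  shows "Pol D (n + m) (\<lambda>v. p v * q v)"
  using assms(1)
proof (induction rule: Pol.induct)
  case (Pol_const n c)
  have "Pol D (n + m) q" using assms(2) by (rule Pol_mono) simp
  then show ?case by (rule Pol_cmult)
qed (auto simp: distrib_right mult.assoc intro: Pol.intros)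

lemma Pol_power: "Pol D n p \<Longrightarrow> Pol D (k * n) (\<lambda>v. p v ^ k)"
  by (induction k) (auto intro: Pol_const Pol_mult)

lemma Pol_prod:
  "finite I \<Longrightarrow> (\<And>i. i \<in> I \<Longrightarrow> Pol D (n i) (p i)) \<Longrightarrow> Pol D (\<Sum>i\<in>I. n i) (\<lambda>v. \<Prod>i\<in>I. p i v)"
  by (induction I rule: finite_induct) (auto intro: Pol_const Pol_mult)

lemma Pol_coordinate: "x \<in> D \<Longrightarrow> Pol D (Suc 0) (\<lambda>v. v x)"
  using Pol_coordinate_mult[OF _ Pol_const[of D 0 1], of x] by simp

lemma Pol_linear: "Pol D (Suc 0) (\<lambda>v. \<Sum>x\<in>D. a x * v x)"
  by (intro Pol_sum Pol_cmult Pol_coordinate)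

lemma Pol_prod_list: "set xs \<subseteq> D \<Longrightarrow> Pol D (length xs) (\<lambda>v. \<Prod>x\<leftarrow>xs. v x)"
  by (induction xs) (auto intro: Pol.intros)

lemma Pol_0: "Pol D n p \<Longrightarrow> n = 0 \<Longrightarrow> \<exists>c. p = (\<lambda>v. c)"
proof (induction rule: Pol.induct)
  case (Pol_add n p q)
  then obtain c d where "p = (\<lambda>v. c)" "q = (\<lambda>v. d)" by auto
  then show ?case by auto
qed auto

text \<open>A candidate \<open>p'\<close> is built along the induction, since \<open>partial\<close>
  can be evaluated only once differentiability is known. Degree 0 is recorded separately because
  there the derivative is zero, not merely of degree \<open>0 - 1 = 0\<close>.\<close>

lemma Pol_derivative:
  assumes "Pol D n p"
  shows "\<exists>p'. (n = 0 \<longrightarrow> p' = (\<lambda>v. 0)) \<and> (\<forall>k. n = Suc k \<longrightarrow> Pol D k p') \<and>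
    (\<forall>v t. ((\<lambda>t. p (v(x := t))) has_real_derivative p' (v(x := t))) (at t))"
  using assms
proof (induction rule: Pol.induct)
  case (Pol_const n c)
  show ?case by (intro exI[of _ "\<lambda>v. 0"]) (auto intro: Pol.intros)
next
  case (Pol_add n p q)
  obtain p' where p': "n = 0 \<longrightarrow> p' = (\<lambda>v. 0)" "\<forall>k. n = Suc k \<longrightarrow> Pol D k p'"
    "\<forall>v t. ((\<lambda>t. p (v(x := t))) has_real_derivative p' (v(x := t))) (at t)"
    using Pol_add.IH(1) by blast
  obtain q' where q': "n = 0 \<longrightarrow> q' = (\<lambda>v. 0)" "\<forall>k. n = Suc k \<longrightarrow> Pol D k q'"
    "\<forall>v t. ((\<lambda>t. q (v(x := t))) has_real_derivative q' (v(x := t))) (at t)"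
    using Pol_add.IH(2) by blast
  have "((\<lambda>t. p (v(x := t)) + q (v(x := t))) has_real_derivative p' (v(x := t)) + q' (v(x := t))) (at t)" for v t
    using p'(3) q'(3) by (intro DERIV_add) blast+
  moreover have "\<forall>k. n = Suc k \<longrightarrow> Pol D k (\<lambda>v. p' v + q' v)" "n = 0 \<longrightarrow> (\<lambda>v. p' v + q' v) = (\<lambda>v. 0)"
    using p'(1,2) q'(1,2) by (simp_all add: Pol.Pol_add)
  ultimately show ?case
    by blast
next
  case (Pol_coordinate_mult y n p)
  obtain p' where p': "n = 0 \<longrightarrow> p' = (\<lambda>v. 0)" "\<forall>k. n = Suc k \<longrightarrow> Pol D k p'"
    "\<forall>v t. ((\<lambda>t. p (v(x := t))) has_real_derivative p' (v(x := t))) (at t)"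
    using Pol_coordinate_mult.IH by blast
  define d :: real where "d = (if y = x then 1 else 0)"
  define q where "q = (\<lambda>v. d * p v + v y * p' v)"
  \<comment> \<open>For \<open>n = 0\<close> this would have degree 1 if \<open>p'\<close> were an
    arbitrary constant; it is the clause \<open>p' = (\<lambda>v. 0)\<close> that saves the
    bound.\<close>
  have "Pol D n (\<lambda>v. v y * p' v)"
    using p' Pol_coordinate_mult.hyps(1) by (cases n) (auto intro: Pol.intros)
  then have "Pol D n q"
    unfolding q_def by (intro Pol.Pol_add Pol_cmult Pol_coordinate_mult.hyps)
  moreover have "((\<lambda>t. (v(x := t)) y * p (v(x := t))) has_real_derivative q (v(x := t))) (at t)" for v t
  proof -
    have "((\<lambda>t. (v(x := t)) y) has_real_derivative d) (at t)"
      by (auto simp: d_def)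
    from DERIV_mult[OF this p'(3)[rule_format, of v t]] show ?thesis
      by (simp add: q_def add.commute mult.commute)
  qed
  ultimately have "(Suc n = 0 \<longrightarrow> q = (\<lambda>v. 0)) \<and> (\<forall>k. Suc n = Suc k \<longrightarrow> Pol D k q) \<and>
    (\<forall>v t. ((\<lambda>t. (v(x := t)) y * p (v(x := t))) has_real_derivative q (v(x := t))) (at t))"
    by simp
  then show ?case by blast
qed

lemma Pol_has_derivative:
  assumes "Pol D n p"
  shows "((\<lambda>t. p (v(x := t))) has_real_derivative partial x p (v(x := t))) (at t)"
proof -
  obtain p' where p': "\<forall>v t. ((\<lambda>t. p (v(x := t))) has_real_derivative p' (v(x := t))) (at t)"
    using Pol_derivative[OF assms, of x] by auto
  have "partial x p w = p' w" for w
    using p'[rule_format, of w "w x"] by (intro partialI) simp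
  then show ?thesis using p' by simp
qed

lemma
  assumes "Pol D n p"
  shows Pol_partial_Suc: "n = Suc k \<Longrightarrow> Pol D k (partial x p)"
    and Pol_partial_0: "n = 0 \<Longrightarrow> partial x p = (\<lambda>v. 0)"
proof -
  obtain p' where p': "n = 0 \<longrightarrow> p' = (\<lambda>v. 0)" "\<forall>k. n = Suc k \<longrightarrow> Pol D k p'"
    "\<forall>v t. ((\<lambda>t. p (v(x := t))) has_real_derivative p' (v(x := t))) (at t)"
    using Pol_derivative[OF assms, of x] by auto
  have "partial x p = p'"
    using p'(3)[rule_format, of w "w x" for w] by (intro ext partialI) simp
  with p' show "n = Suc k \<Longrightarrow> Pol D k (partial x p)" "n = 0 \<Longrightarrow> partial x p = (\<lambda>v. 0)"
    by auto
qed

lemma Pol_partial: "Pol D n p \<Longrightarrow> Pol D (n - 1) (partial x p)"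
  using Pol_partial_Suc[of D n p] Pol_partial_0[of D n p] by (cases n) (auto intro: Pol_const)

lemma Pol_tame:
  assumes "finite D" "Pol D n p"
  shows "tame D p"
  using assms(2) by (induction rule: Pol.induct)
    (auto intro: tame_const tame_add tame_mult tame_coordinate[OF assms(1)])

lemma Pol_tame1: "finite D \<Longrightarrow> Pol D n p \<Longrightarrow> tame1 D p"
  unfolding tame1_def
  using Pol_has_derivative[of D n p v x "v x" for v x]
  by (auto intro: Pol_tame Pol_partial simp: real_differentiable_def)

section \<open>Gaussian integration by parts\<close>

lemma integrable_power_add:
  fixes X Y :: "'a \<Rightarrow> real"
  assumes "integrable M (\<lambda>w. X w ^ k)" "integrable M (\<lambda>w. Y w ^ k)"
    and nonneg: "\<And>w. 0 \<le> X w" "\<And>w. 0 \<le> Y w"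
    and [measurable]: "X \<in> borel_measurable M" "Y \<in> borel_measurable M"
  shows "integrable M (\<lambda>w. (X w + Y w) ^ k)"
proof (rule Bochner_Integration.integrable_bound)
  show "integrable M (\<lambda>w. 2 ^ k * (X w ^ k + Y w ^ k))"
    using assms by simp
  have "(a + b) ^ k \<le> 2 ^ k * (a ^ k + b ^ k)" if "0 \<le> a" "0 \<le> b" for a b :: real
  proof -
    have "(a + b) ^ k \<le> (2 * max a b) ^ k"
      using that by (intro power_mono) auto
    also have "\<dots> \<le> 2 ^ k * (a ^ k + b ^ k)"
      using that by (auto simp: power_mult_distrib max_def)
    finally show ?thesis .
  qed
  then show "AE w in M. norm ((X w + Y w) ^ k) \<le> norm (2 ^ k * (X w ^ k + Y w ^ k))"
    using nonneg by (intro AE_I2) simp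
qed simp

locale gaussian_family = prob_space M for M :: "'w measure" +
  fixes D :: "'i :: countable set" and f :: "'i \<Rightarrow> 'w \<Rightarrow> real"
  assumes finite_D: "finite D"
    and gaussian: "centred_gaussian_vector M D f"
    and nondegenerate: "nondegenerate M D f"
begin

definition lin :: "('i \<Rightarrow> real) \<Rightarrow> 'w \<Rightarrow> real"
  where "lin a w = (\<Sum>x\<in>D. a x * f x w)"

definition F :: "'w \<Rightarrow> 'i \<Rightarrow> real"
  where "F w = restrict (\<lambda>x. f x w) D"

lemma lin_gaussian: "centred_gaussian M (lin a)"
  using gaussian by (simp add: centred_gaussian_vector_def lin_def[abs_def])

lemma lin_measurable [measurable]: "lin a \<in> borel_measurable M"
  using lin_gaussian by (simp add: centred_gaussian_def)

lemma lin_L2: "lin a \<in> L2 M"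
  using centred_gaussian_integrable_power_abs[OF lin_gaussian, of a 2] by (simp add: L2_def)

lemma lin_indicator: "x \<in> D \<Longrightarrow> lin (\<lambda>y. if y = x then c else 0) = (\<lambda>w. c * f x w)"
  using finite_D by (simp add: lin_def fun_eq_iff if_distrib[of "\<lambda>c. c * _"] cong: if_cong)

lemma f_eq_lin: "x \<in> D \<Longrightarrow> f x = lin (\<lambda>y. if y = x then 1 else 0)"
  by (simp add: lin_indicator)

lemma f_L2: "x \<in> D \<Longrightarrow> f x \<in> L2 M"
  by (simp only: f_eq_lin lin_L2)

lemma f_measurable: "x \<in> D \<Longrightarrow> f x \<in> borel_measurable M"
  by (simp only: f_eq_lin lin_measurable)

lemma F_families: "F w \<in> families D"
  by (simp add: F_def)

lemma F_apply: "x \<in> D \<Longrightarrow> F w x = f x w"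
  by (simp add: F_def)

lemma F_measurable [measurable]: "F \<in> measurable M (Pi\<^sub>M D (\<lambda>_. borel))"
  unfolding F_def[abs_def] by (intro measurable_restrict) (simp add: f_measurable)

lemma lin_eq_F: "lin a w = (\<Sum>x\<in>D. a x * F w x)"
  by (simp add: lin_def F_apply)

section \<open>Moments of functions of the Gaussian vector\<close>

lemma tame_F_measurable: "tame D \<Psi> \<Longrightarrow> (\<lambda>w. \<Psi> (F w)) \<in> borel_measurable M"
  using measurable_compose[OF F_measurable tame_measurable[OF finite_D]] .

lemma integrable_power_sum_abs: "S \<subseteq> D \<Longrightarrow> integrable M (\<lambda>w. (1 + (\<Sum>x\<in>S. \<bar>f x w\<bar>)) ^ k)"
proof (induction S rule: infinite_finite_induct)
  case (infinite S)
  then show ?case using finite_D finite_subset by blast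
next
  case empty
  then show ?case by simp
next
  case (insert x S)
  have [measurable]: "f y \<in> borel_measurable M" if "y \<in> S" for y
    using insert.prems that f_measurable by auto
  have [measurable]: "f x \<in> borel_measurable M"
    using insert.prems f_measurable by auto
  have "integrable M (\<lambda>w. ((1 + (\<Sum>x\<in>S. \<bar>f x w\<bar>)) + \<bar>f x w\<bar>) ^ k)"
  proof (rule integrable_power_add)
    show "integrable M (\<lambda>w. \<bar>f x w\<bar> ^ k)"
      using centred_gaussian_integrable_power_abs[OF lin_gaussian] f_eq_lin[of x] insert.prems by auto
  qed (use insert in \<open>auto intro: sum_nonneg add_nonneg_nonneg\<close>)
  then show ?case
    using insert.hyps by (simp add: ac_simps)
qed

lemma tame_integrable:
  assumes "tame D \<Psi>"
  shows "integrable M (\<lambda>w. \<Psi> (F w))"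
proof -
  obtain C k where C: "C \<ge> 0" "\<And>v. v \<in> families D \<Longrightarrow> \<bar>\<Psi> v\<bar> \<le> C * (1 + L2_set v D) ^ k"
    using assms polynomial_growth_nonneg unfolding tame_def by blast
  show ?thesis
  proof (rule Bochner_Integration.integrable_bound)
    show "integrable M (\<lambda>w. C * (1 + (\<Sum>x\<in>D. \<bar>f x w\<bar>)) ^ k)"
      using integrable_power_sum_abs by simp
    show "AE w in M. norm (\<Psi> (F w)) \<le> norm (C * (1 + (\<Sum>x\<in>D. \<bar>f x w\<bar>)) ^ k)"
    proof (intro AE_I2)
      fix w
      have "L2_set (F w) D \<le> (\<Sum>x\<in>D. \<bar>f x w\<bar>)"
        using L2_set_le_sum_abs[of "F w" D] by (simp add: F_apply)
      then have "C * (1 + L2_set (F w) D) ^ k \<le> C * (1 + (\<Sum>x\<in>D. \<bar>f x w\<bar>)) ^ k"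
        using C(1) by (intro mult_left_mono power_mono) (auto simp: L2_set_nonneg)
      then show "norm (\<Psi> (F w)) \<le> norm (C * (1 + (\<Sum>x\<in>D. \<bar>f x w\<bar>)) ^ k)"
        using C(2)[OF F_families, of w] C(1) by (simp add: abs_mult power_abs sum_nonneg)
    qed
  qed (rule tame_F_measurable[OF assms])
qed

lemma tame_L2: "tame D \<Psi> \<Longrightarrow> (\<lambda>w. \<Psi> (F w)) \<in> L2 M"
  using tame_integrable[OF tame_mult[of D \<Psi> \<Psi>]] tame_F_measurable
  by (simp add: L2_def power2_eq_square)

lemma tame_linear: "tame D (\<lambda>v. \<Sum>x\<in>D. a x * v x)"
  by (rule Pol_tame[OF finite_D Pol_linear])

section \<open>The dual variables\<close>

lemma inner_lin_left: "Y \<in> L2 M \<Longrightarrow> L2_inner M (lin a) Y = (\<Sum>x\<in>D. a x * L2_inner M (f x) Y)"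
  unfolding lin_def[abs_def] by (rule L2_inner_sum_left) (auto intro: f_L2)

lemma inner_lin_right: "Y \<in> L2 M \<Longrightarrow> L2_inner M Y (lin a) = (\<Sum>x\<in>D. a x * L2_inner M Y (f x))"
  using inner_lin_left by (simp add: L2_inner_commute)

lemma inner_lin_pos:
  assumes "x \<in> D" "a x \<noteq> 0"
  shows "L2_inner M (lin a) (lin a) > 0"
proof -
  have "L2_inner M (lin a) (lin a) = (\<Sum>x\<in>D. \<Sum>y\<in>D. a x * L2_inner M (f x) (f y) * a y)"
    by (subst inner_lin_left[OF lin_L2]) (simp add: inner_lin_right f_L2 sum_distrib_left ac_simps)
  then show ?thesis
    using nondegenerate assms unfolding nondegenerate_def by auto
qed

text \<open>The variable dual to \<open>f x\<close> is the residual of \<open>f x\<close> after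
  projection onto the other coordinates, divided by its variance. Its coefficient at
  \<open>x\<close> is 1, so non-degeneracy makes that variance positive.\<close>

lemma dual_basis_exists: "\<exists>B. \<forall>x\<in>D. \<forall>y\<in>D. L2_inner M (lin (B x)) (f y) = (if x = y then 1 else 0)"
proof -
  have "\<exists>b. \<forall>y\<in>D. L2_inner M (lin b) (f y) = (if x = y then 1 else 0)" if x: "x \<in> D" for x
  proof -
    obtain c where c: "\<forall>y\<in>D-{x}. L2_inner M (\<lambda>w. f x w - (\<Sum>i\<in>D-{x}. c i * f i w)) (f y) = 0"
      using L2_projection_exists[of "D - {x}" f M "f x"] finite_D f_L2 x by auto
    define b where "b = (\<lambda>y. if y = x then 1 else - c y)"
    have "(\<Sum>i\<in>D-{x}. b i * f i w) = - (\<Sum>i\<in>D-{x}. c i * f i w)" for w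
      by (simp add: b_def flip: sum_negf)
    then have b: "lin b = (\<lambda>w. f x w - (\<Sum>i\<in>D-{x}. c i * f i w))"
      by (intro ext) (simp add: lin_def sum.remove[OF finite_D x], simp add: b_def)
    have pos: "L2_inner M (lin b) (lin b) > 0"
      by (rule inner_lin_pos[OF x]) (simp add: b_def)
    have orth: "L2_inner M (lin b) (f y) = 0" if "y \<in> D - {x}" for y
      using c that by (simp add: b)
    \<comment> \<open>Expanding the second factor leaves only the term at \<open>x\<close>, where
      \<open>b x = 1\<close>; thus the covariance with \<open>f x\<close> equals the variance, which
      fixes the scaling \<open>k\<close>.\<close>
    have "L2_inner M (lin b) (lin b) = b x * L2_inner M (lin b) (f x)"
      using orth sum.remove[OF finite_D x, of "\<lambda>y. b y * L2_inner M (lin b) (f y)"]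
      by (simp add: inner_lin_right lin_L2)
    then have fx: "L2_inner M (lin b) (f x) = L2_inner M (lin b) (lin b)"
      by (simp add: b_def)
    define k where "k = 1 / L2_inner M (lin b) (lin b)"
    have "lin (\<lambda>y. k * b y) = (\<lambda>w. k * lin b w)"
      by (simp add: lin_def fun_eq_iff sum_distrib_left mult.assoc)
    then have "L2_inner M (lin (\<lambda>y. k * b y)) (f y) = k * L2_inner M (lin b) (f y)" for y
      by (simp add: L2_inner_cmult_left)
    then have "L2_inner M (lin (\<lambda>y. k * b y)) (f y) = (if x = y then 1 else 0)" if "y \<in> D" for y
      using fx orth[of y] pos that by (cases "y = x") (auto simp: k_def)
    then show ?thesis by blast
  qed
  then show ?thesis by (rule bchoice[OF ballI])
qed

text \<open>On \<open>D\<close> this is the inverse of the covariance matrix.\<close>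

definition B :: "'i \<Rightarrow> 'i \<Rightarrow> real"
  where "B = (SOME B. \<forall>x\<in>D. \<forall>y\<in>D. L2_inner M (lin (B x)) (f y) = (if x = y then 1 else 0))"

lemma inner_dual: "x \<in> D \<Longrightarrow> y \<in> D \<Longrightarrow> L2_inner M (lin (B x)) (f y) = (if x = y then 1 else 0)"
  using someI_ex[OF dual_basis_exists] unfolding B_def by blast

text \<open>Pairing with a dual variable reads off a coefficient. In particular \<open>B x x\<close>
  is the variance of \<open>lin (B x)\<close>.\<close>

lemma inner_dual_lin: "x \<in> D \<Longrightarrow> L2_inner M (lin (B x)) (lin a) = a x"
  using finite_D by (simp add: inner_lin_right lin_L2 inner_dual if_distrib[of "\<lambda>c. _ * c"] cong: if_cong)

lemma B_diag_pos:
  assumes "x \<in> D"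
  shows "B x x > 0"
proof -
  have "\<exists>y\<in>D. B x y \<noteq> 0"
  proof (rule ccontr)
    assume "\<not> (\<exists>y\<in>D. B x y \<noteq> 0)"
    then have "L2_inner M (lin (B x)) (f x) = 0"
      using assms by (simp add: inner_lin_left f_L2)
    then show False using inner_dual[OF assms assms] by simp
  qed
  then obtain y where "y \<in> D" "B x y \<noteq> 0" by blast
  then have "L2_inner M (lin (B x)) (lin (B x)) > 0"
    by (rule inner_lin_pos)
  then show ?thesis using assms by (simp add: inner_dual_lin)
qed

text \<open>The residual \<open>lin u\<close> of \<open>f x\<close> after projection onto the dual
  variables is orthogonal to all of them, and these pairings are the coefficients of
  \<open>u\<close>, so \<open>u\<close> vanishes on \<open>D\<close>. As the coefficients themselves
  vanish, the identity holds for every \<open>v\<close> and not only almost everywhere.\<close>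

lemma coordinate_in_span_dual:
  assumes x: "x \<in> D"
  shows "\<exists>c. \<forall>v. v x = (\<Sum>y\<in>D. c y * (\<Sum>z\<in>D. B y z * v z))"
proof -
  obtain c where c: "\<forall>y\<in>D. L2_inner M (\<lambda>w. f x w - (\<Sum>i\<in>D. c i * lin (B i) w)) (lin (B y)) = 0"
    using L2_projection_exists[of D "\<lambda>y. lin (B y)" M "f x"] finite_D f_L2[OF x] lin_L2 by auto
  define u where "u = (\<lambda>z. (if z = x then 1 else 0) - (\<Sum>y\<in>D. c y * B y z))"
  have lincomb: "(\<Sum>z\<in>D. u z * v z) = v x - (\<Sum>y\<in>D. c y * (\<Sum>z\<in>D. B y z * v z))" for v
  proof -
    have "(\<Sum>z\<in>D. u z * v z) = (\<Sum>z\<in>D. (if z = x then v z else 0)) - (\<Sum>z\<in>D. \<Sum>y\<in>D. c y * B y z * v z)"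
      unfolding u_def left_diff_distrib sum_subtractf sum_distrib_right
      by (intro arg_cong2[where f = "(-)"] sum.cong) auto
    also have "(\<Sum>z\<in>D. \<Sum>y\<in>D. c y * B y z * v z) = (\<Sum>y\<in>D. \<Sum>z\<in>D. c y * B y z * v z)"
      by (rule sum.swap)
    finally show ?thesis
      using x finite_D by (simp add: sum_distrib_left mult.assoc)
  qed
  have "lin u = (\<lambda>w. f x w - (\<Sum>i\<in>D. c i * lin (B i) w))"
    by (rule ext) (simp only: lin_def lincomb)
  with c have "u y = 0" if "y \<in> D" for y
    using inner_dual_lin[OF that, of u] that by (simp add: L2_inner_commute)
  then have "v x = (\<Sum>y\<in>D. c y * (\<Sum>z\<in>D. B y z * v z))" for v
    using lincomb[of v] by simp
  then show ?thesis by blast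
qed

text \<open>Variances of orthogonal combinations add, and the characteristic function turns the sum
  into a product.\<close>

lemma iexp_uncorrelated:
  assumes "L2_inner M (lin a) (lin b) = 0"
  shows "(CLINT w|M. iexp (lin a w) * iexp (lin b w)) = (CLINT w|M. iexp (lin a w)) * (CLINT w|M. iexp (lin b w))"
proof -
  have sum: "lin (\<lambda>x. a x + b x) = (\<lambda>w. lin a w + lin b w)"
    by (simp add: lin_def fun_eq_iff distrib_right sum.distrib)
  have "L2_inner M (lin (\<lambda>x. a x + b x)) (lin (\<lambda>x. a x + b x)) = L2_inner M (lin a) (lin a) + L2_inner M (lin b) (lin b)"
    unfolding sum using assms by (intro L2_pythagoras lin_L2)
  then have "(CLINT w|M. iexp (lin (\<lambda>x. a x + b x) w)) =
      of_real (exp (- L2_inner M (lin a) (lin a) / 2)) * of_real (exp (- L2_inner M (lin b) (lin b) / 2))"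
    by (simp add: centred_gaussian_iexp[OF lin_gaussian] field_simps flip: of_real_mult exp_add)
  then show ?thesis
    by (simp add: sum centred_gaussian_iexp[OF lin_gaussian] distrib_left exp_add)
qed

text \<open>Uncorrelated jointly Gaussian variables are independent. Subtracting expectations turns
  the factorisation of exponentials into the vanishing of an integral, to which Fourier uniqueness
  applies twice: in \<open>lin b\<close>, and then in the whole family
  \<open>lin (R y)\<close>.\<close>

lemma distr_pair_uncorrelated:
  assumes orth: "\<And>y. y \<in> D \<Longrightarrow> L2_inner M (lin (R y)) (lin b) = 0"
  defines "G \<equiv> \<lambda>w. restrict (\<lambda>y. lin (R y) w) D"
  shows "distr M (Pi\<^sub>M D (\<lambda>_. borel)) G \<Otimes>\<^sub>M distr M borel (lin b) =
    distr M (Pi\<^sub>M D (\<lambda>_. borel) \<Otimes>\<^sub>M borel) (\<lambda>w. (G w, lin b w))"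
proof -
  let ?N = "Pi\<^sub>M D (\<lambda>_. borel :: real measure)"
  have G [measurable]: "G \<in> measurable M ?N"
    unfolding G_def by (intro measurable_restrict) auto
  interpret N1: prob_space "distr M ?N G" by (rule prob_space_distr) simp
  interpret N2: prob_space "distr M borel (lin b)" by (rule prob_space_distr) simp
  have comb: "(\<Sum>y\<in>D. a y * lin (R y) w) = lin (\<lambda>x. \<Sum>y\<in>D. a y * R y x) w" for a w
    unfolding lin_def sum_distrib_left sum_distrib_right by (subst sum.swap) (simp add: ac_simps)
  have scale: "t * lin b w = lin (\<lambda>x. t * b x) w" for t w
    by (simp add: lin_def sum_distrib_left mult.assoc)
  have orth': "L2_inner M (lin (\<lambda>x. \<Sum>y\<in>D. a y * R y x)) (lin (\<lambda>x. t * b x)) = 0" for a t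
  proof -
    have "L2_inner M (lin (\<lambda>x. t * b x)) (lin (\<lambda>x. \<Sum>y\<in>D. a y * R y x)) = t * (\<Sum>y\<in>D. a y * L2_inner M (lin b) (lin (R y)))"
      unfolding scale[symmetric, abs_def] comb[symmetric, abs_def] L2_inner_cmult_left
      by (subst L2_inner_sum_right) (auto intro: lin_L2)
    then show ?thesis
      using orth by (simp add: L2_inner_commute)
  qed
  have int_iexp: "integrable M (\<lambda>w. iexp (lin a w))" for a
    by (intro integrable_const_bound[where B = 1]) auto
  \<comment> \<open>The exponential of the family is kept and centred; only the exponential in
    \<open>lin b\<close> is exchanged for an indicator.\<close>
  have step1: "(CLINT w|M. (iexp (lin a w) - (CLINT w|M. iexp (lin a w))) * indicator A (lin b w)) = 0"
    if a: "a = (\<lambda>x. \<Sum>y\<in>D. c y * R y x)" and A: "A \<in> sets borel" for a c A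
  proof (rule fourier_unique_complex[OF _ lin_measurable _ A])
    fix t
    have "(CLINT w|M. iexp (lin a w) * iexp (lin (\<lambda>x. t * b x) w)) =
        (CLINT w|M. iexp (lin a w)) * (CLINT w|M. iexp (lin (\<lambda>x. t * b x) w))"
      unfolding a by (rule iexp_uncorrelated[OF orth'])
    moreover have "integrable M (\<lambda>w. iexp (lin a w) * iexp (lin (\<lambda>x. t * b x) w))"
      using int_iexp by (intro integrable_mult_bounded) auto
    ultimately show "(CLINT w|M. (iexp (lin a w) - (CLINT w|M. iexp (lin a w))) * iexp (t * lin b w)) = 0"
      unfolding scale left_diff_distrib using int_iexp by simp
  qed (use int_iexp in auto)
  show ?thesis
  proof (rule pair_measure_eqI)
    fix A' A assume "A' \<in> sets (distr M ?N G)" "A \<in> sets (distr M borel (lin b))"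
    then have [measurable]: "A' \<in> sets ?N" "A \<in> sets borel" by auto
    interpret J: prob_space "distr M (?N \<Otimes>\<^sub>M borel) (\<lambda>w. (G w, lin b w))"
      by (rule prob_space_distr) simp
    define p where "p = (LINT w|M. indicator A (lin b w) :: real)"
    have int_A: "integrable M (\<lambda>w. indicator A (lin b w) :: real)" "integrable M (\<lambda>w. indicator A' (G w) :: real)"
      "integrable M (\<lambda>w. indicator A (lin b w) * indicator A' (G w) :: real)"
      by (auto intro!: integrable_const_bound[where B = 1] simp: indicator_def)
    \<comment> \<open>Now the centred indicator of \<open>lin b\<close> is the weight, and the
      exponentials of the family are exchanged for the indicator of \<open>A'\<close>.\<close>
    have "(LINT w|M. (indicator A (lin b w) - p) * indicator A' (restrict (\<lambda>y. lin (R y) w) D)) = 0"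
    proof (rule fourier_unique_family[OF finite_D])
      fix a :: "'i \<Rightarrow> real"
      let ?a = "\<lambda>x. \<Sum>y\<in>D. a y * R y x"
      have "(CLINT w|M. (iexp (lin ?a w) - (CLINT w|M. iexp (lin ?a w))) * indicator A (lin b w)) = 0"
        by (rule step1) auto
      moreover have "integrable M (\<lambda>w. iexp (lin ?a w) * indicator A (lin b w))"
        using int_iexp norm_indicator_le_one by (intro integrable_mult_bounded) auto
      moreover have ind: "indicator A (lin b w) = complex_of_real (indicator A (lin b w))" for w
        by (simp add: indicator_def)
      ultimately have "(CLINT w|M. iexp (lin ?a w) * of_real (indicator A (lin b w))) = (CLINT w|M. iexp (lin ?a w)) * of_real p"
        unfolding left_diff_distrib ind p_def using int_A(1) by simp
      moreover have "integrable M (\<lambda>w. iexp (lin ?a w) * of_real (indicator A (lin b w)))"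
        using int_iexp norm_indicator_le_one[of A] by (intro integrable_mult_bounded) auto
      ultimately show "(CLINT w|M. of_real (indicator A (lin b w) - p) * iexp (\<Sum>y\<in>D. a y * lin (R y) w)) = 0"
        unfolding comb of_real_diff left_diff_distrib using int_iexp by (simp add: mult.commute)
    next
      show "integrable M (\<lambda>w. (indicator A (lin b w) - p) * indicator A' (restrict (\<lambda>y. lin (R y) w) D))"
        using int_A unfolding G_def by (simp add: left_diff_distrib)
    qed (use int_A in auto)
    then have "(LINT w|M. (indicator A (lin b w) - p) * indicator A' (G w)) = 0"
      by (simp add: G_def)
    then have "(LINT w|M. indicator A (lin b w) * indicator A' (G w)) = p * (LINT w|M. indicator A' (G w))"
      using int_A by (simp add: left_diff_distrib)
    moreover have "p = measure (distr M borel (lin b)) A"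
    proof -
      have "p = (LINT x|distr M borel (lin b). indicator A x)"
        unfolding p_def by (rule integral_distr[symmetric]) auto
      then show ?thesis by simp
    qed
    moreover have "(LINT w|M. indicator A' (G w)) = measure (distr M ?N G) A'"
    proof -
      have "(LINT w|M. indicator A' (G w) :: real) = (LINT x|distr M ?N G. indicator A' x)"
        by (rule integral_distr[symmetric]) auto
      then show ?thesis
        using sets.sets_into_space[OF \<open>A' \<in> sets ?N\<close>] by (simp add: Int_absorb2)
    qed
    moreover have "(LINT w|M. indicator A (lin b w) * indicator A' (G w) :: real) =
        measure (distr M (?N \<Otimes>\<^sub>M borel) (\<lambda>w. (G w, lin b w))) (A' \<times> A)"
    proof -
      have "(LINT w|M. indicator A (lin b w) * indicator A' (G w) :: real) = (LINT w|M. indicator (A' \<times> A) (G w, lin b w))"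
        by (intro Bochner_Integration.integral_cong) (auto simp: indicator_def)
      also have "\<dots> = (LINT x|distr M (?N \<Otimes>\<^sub>M borel) (\<lambda>w. (G w, lin b w)). indicator (A' \<times> A) x)"
        by (rule integral_distr[symmetric]) auto
      finally show ?thesis
        using sets.sets_into_space[of "A' \<times> A" "?N \<Otimes>\<^sub>M borel"] by (simp add: Int_absorb2)
    qed
    ultimately show "emeasure (distr M ?N G) A' * emeasure (distr M borel (lin b)) A =
        emeasure (distr M (?N \<Otimes>\<^sub>M borel) (\<lambda>w. (G w, lin b w))) (A' \<times> A)"
      by (simp add: N1.emeasure_eq_measure N2.emeasure_eq_measure J.emeasure_eq_measure mult.commute flip: ennreal_mult)
  qed (auto intro!: N1.sigma_finite_measure_axioms N2.sigma_finite_measure_axioms)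
qed

text \<open>The variables \<open>f y - [y = x] Z / Var Z\<close> with \<open>Z = lin (B x)\<close> are uncorrelated with \<open>Z\<close>, hence jointly
  independent of it, so Stein's identity applies in \<open>Z\<close> with the remaining variables frozen.\<close>

theorem gaussian_integration_by_parts:
  assumes x: "x \<in> D" and G: "tame1 D G"
  shows "(LINT w|M. lin (B x) w * G (F w)) = (LINT w|M. partial x G (F w))"
proof -
  let ?N = "Pi\<^sub>M D (\<lambda>_. borel :: real measure)"
  define Z where "Z = lin (B x)"
  \<comment> \<open>This is the regression coefficient of \<open>f x\<close> on \<open>Z\<close>:
    their covariance is 1 and the variance of \<open>Z\<close> is \<open>B x x\<close>. The other
    \<open>f y\<close> have covariance 0 with \<open>Z\<close> and need no correction.\<close>
  define c where "c = 1 / B x x"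
  have c: "c > 0" using B_diag_pos[OF x] by (simp add: c_def)
  have [measurable]: "Z \<in> borel_measurable M" by (simp add: Z_def)
  define R where "R y z = (if z = y then 1 else 0) - (if y = x then c * B x z else 0)" for y z
  have lin_R: "lin (R y) w = f y w - (if y = x then c * Z w else 0)" if "y \<in> D" for y w
  proof -
    have "lin (R y) w = lin (\<lambda>z. if z = y then 1 else 0) w - (if y = x then c * Z w else 0)"
      by (simp add: lin_def R_def Z_def left_diff_distrib sum_subtractf sum_distrib_left mult.assoc)
    then show ?thesis using that by (simp add: lin_indicator)
  qed
  define V where "V w = restrict (\<lambda>y. lin (R y) w) D" for w
  have V [measurable]: "V \<in> measurable M ?N"
    unfolding V_def[abs_def] by (intro measurable_restrict) auto
  have pair: "distr M ?N V \<Otimes>\<^sub>M distr M borel Z = distr M (?N \<Otimes>\<^sub>M borel) (\<lambda>w. (V w, Z w))"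
    unfolding V_def[abs_def] Z_def
  proof (rule distr_pair_uncorrelated)
    \<comment> \<open>The inner product is the coefficient \<open>R y x\<close>, which is 0 for
      \<open>y \<noteq> x\<close> and \<open>1 - c * B x x = 0\<close> for
      \<open>y = x\<close>.\<close>
    fix y assume "y \<in> D"
    then show "L2_inner M (lin (R y)) (lin (B x)) = 0"
      using inner_dual_lin[OF x, of "R y"] B_diag_pos[OF x]
      by (auto simp: L2_inner_commute[of M "lin (R y)"] R_def c_def)
  qed
  \<comment> \<open>\<open>U\<close> undoes the subtraction of \<open>c * Z\<close> at coordinate
    \<open>x\<close> and so recovers the original vector from the independent pair.\<close>
  define U where "U p = (fst p)(x := fst p x + c * snd p)" for p :: "('i \<Rightarrow> real) \<times> real"
  have U_F: "U (V w, Z w) = F w" for w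
    using x by (auto simp: U_def V_def F_def lin_R fun_eq_iff)
  have "(\<lambda>p. (fst p)(x := fst p x + c * snd p)) \<in> measurable (?N \<Otimes>\<^sub>M borel) ?N"
    using x by (intro measurable_fun_upd[where J = D]) auto
  then have [measurable]: "U \<in> measurable (?N \<Otimes>\<^sub>M borel) ?N"
    by (simp add: U_def[abs_def])
  have tame: "tame D G" "tame D (partial x G)"
    using G x by (auto simp: tame1_def)
  have [measurable]: "G \<in> borel_measurable ?N" "partial x G \<in> borel_measurable ?N"
    using tame finite_D by (auto intro: tame_measurable)
  define K where "K p = snd p * G (U p) - partial x G (U p)" for p
  have K [measurable]: "K \<in> borel_measurable (?N \<Otimes>\<^sub>M borel)"
    unfolding K_def by measurable
  have K_F: "K (V w, Z w) = Z w * G (F w) - partial x G (F w)" for w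
    by (simp add: K_def U_F)
  have int1: "integrable M (\<lambda>w. Z w * G (F w))"
    using tame_integrable[OF tame_mult[OF tame_linear tame(1)]] by (simp add: Z_def lin_eq_F)
  have int2: "integrable M (\<lambda>w. partial x G (F w))"
    by (rule tame_integrable[OF tame(2)])
  have int: "integrable (distr M (?N \<Otimes>\<^sub>M borel) (\<lambda>w. (V w, Z w))) K"
    using int1 int2 by (subst integrable_distr_eq) (auto simp: K_F)
  interpret N1: prob_space "distr M ?N V" by (rule prob_space_distr) simp
  interpret N2: prob_space "distr M borel Z" by (rule prob_space_distr) simp
  interpret N12: pair_sigma_finite "distr M ?N V" "distr M borel Z" ..
  have "L2_inner M Z Z = B x x"
    unfolding Z_def by (rule inner_dual_lin[OF x])
  then have Z2: "L2_inner M Z Z \<noteq> 0"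
    using B_diag_pos[OF x] by simp
  then have "\<not> (AE w in M. Z w = 0)"
    using L2_inner_self_eq_0_iff[of Z M] by (auto simp: Z_def lin_L2)
  then obtain s where s: "s > 0" "distributed M lborel Z (\<lambda>t. ennreal (normal_density 0 s t))"
    using lin_gaussian[of "B x"] by (auto simp: centred_gaussian_def Z_def)
  have s2: "s\<^sup>2 = 1 / c"
    using normal_second_moment[OF s] \<open>L2_inner M Z Z = B x x\<close> by (simp add: c_def)
  \<comment> \<open>Along the line through \<open>r\<close> in direction \<open>x\<close> the chain
    rule produces a factor \<open>c\<close>; the variance \<open>s\<^sup>2 = 1 / c\<close> in
    Stein's identity cancels it, leaving exactly \<open>K\<close>.\<close>
  have inner0: "(LINT z|distr M borel Z. K (r, z)) = 0" if r: "r \<in> families D" for r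
  proof -
    define \<phi> where "\<phi> z = G (r(x := r x + c * z))" for z
    define \<phi>' where "\<phi>' z = c * partial x G (r(x := r x + c * z))" for z
    obtain C1 where C1: "C1 \<ge> 0" "\<And>z. \<bar>\<phi> z\<bar> \<le> C1 * exp \<bar>z\<bar>"
      using tame_line_bound[OF finite_D tame(1) r x, of c] by (auto simp: \<phi>_def)
    obtain C2 where C2: "C2 \<ge> 0" "\<And>z. \<bar>partial x G (r(x := r x + c * z))\<bar> \<le> C2 * exp \<bar>z\<bar>"
      using tame_line_bound[OF finite_D tame(2) r x, of c] by auto
    have bound': "\<bar>\<phi>' z\<bar> \<le> (c * C2) * exp \<bar>z\<bar>" for z
      using C2(2)[of z] c by (simp add: \<phi>'_def abs_mult)
    have "(\<phi> has_real_derivative \<phi>' z) (at z)" for z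
    proof -
      have "((\<lambda>z. r x + c * z) has_real_derivative c) (at z)"
        by (auto intro!: derivative_eq_intros)
      from DERIV_chain2[OF tame1_has_derivative[OF G x r] this]
      show ?thesis by (simp add: \<phi>_def[abs_def] \<phi>'_def mult.commute)
    qed
    moreover have "continuous_on UNIV \<phi>'"
      unfolding \<phi>'_def[abs_def]
      by (intro continuous_on_mult continuous_on_const tame_line_continuous[OF tame(2) r x] continuous_intros)
    moreover have "\<bar>\<phi> z\<bar> \<le> (C1 + c * C2) * exp \<bar>z\<bar>" "\<bar>\<phi>' z\<bar> \<le> (C1 + c * C2) * exp \<bar>z\<bar>" for z
      using C1 C2(1) c bound'[of z]
      by (auto simp: distrib_right intro: order_trans[OF C1(2)] order_trans[OF bound'])
    ultimately have "(LINT w|M. Z w * \<phi> (Z w) - s\<^sup>2 * \<phi>' (Z w)) = 0"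
      by (rule centred_normal_stein[OF s])
    moreover have "Z w * \<phi> (Z w) - s\<^sup>2 * \<phi>' (Z w) = K (r, Z w)" for w
      using c by (simp add: K_def U_def \<phi>_def \<phi>'_def s2)
    moreover have "(LINT z|distr M borel Z. K (r, z)) = (LINT w|M. K (r, Z w))"
      using r by (intro integral_distr) (auto simp: space_PiM)
    ultimately show ?thesis by simp
  qed
  have "(LINT w|M. K (V w, Z w)) = integral\<^sup>L (distr M (?N \<Otimes>\<^sub>M borel) (\<lambda>w. (V w, Z w))) K"
    by (rule integral_distr[symmetric]) auto
  also have "\<dots> = (LINT r|distr M ?N V. LINT z|distr M borel Z. K (r, z))"
    using N12.integral_fst'[of K] int by (simp add: pair)
  also have "\<dots> = (LINT r|distr M ?N V. 0)"
    by (intro Bochner_Integration.integral_cong) (auto simp: inner0 space_PiM)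
  finally have "(LINT w|M. K (V w, Z w)) = 0" by simp
  then show ?thesis
    using int1 int2 by (simp add: K_F) (simp add: Z_def)
qed

lemma tame_orthogonal_if_polynomials_orthogonal:
  assumes R: "R \<in> L2 M" and orth: "\<And>n p. Pol D n p \<Longrightarrow> L2_inner M R (\<lambda>w. p (F w)) = 0"
    and \<Phi>: "tame D \<Phi>"
  shows "L2_inner M R (\<lambda>w. \<Phi> (F w)) = 0"
proof -
  have [measurable]: "R \<in> borel_measurable M" using R by auto
  \<comment> \<open>Exponential moments put \<open>exp \<bar>lin a w\<bar>\<close> in the same space
    as \<open>R\<close>, so their product is integrable. It dominates all partial sums of the
    exponential series multiplied by \<open>R\<close>.\<close>
  have exp_L2: "(\<lambda>w. exp \<bar>lin a w\<bar>) \<in> L2 M" for a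
    using centred_gaussian_integrable_exp_abs[OF lin_gaussian, of 2 a]
    by (simp add: L2_def exp_double)
  have int_R: "integrable M R"
    using L2_mult_integrable[OF R, of "\<lambda>_. 1"] by (simp add: L2_def)
  have iexp_zero: "(CLINT w|M. of_real (R w) * iexp (\<Sum>x\<in>D. a x * f x w)) = 0" for a
  proof -
    define s where "s n w = of_real (R w) * (\<Sum>k<n. (\<i> * of_real (lin a w)) ^ k /\<^sub>R fact k)" for n w
    have [measurable]: "s n \<in> borel_measurable M" for n
      unfolding s_def by measurable
    have "(\<lambda>n. CLINT w|M. s n w) \<longlonglongrightarrow> (CLINT w|M. of_real (R w) * iexp (lin a w))"
    proof (rule integral_dominated_convergence)
      show "integrable M (\<lambda>w. \<bar>R w * exp \<bar>lin a w\<bar>\<bar>)"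
        by (intro integrable_abs L2_mult_integrable R exp_L2)
      show "AE w in M. (\<lambda>n. s n w) \<longlonglongrightarrow> of_real (R w) * iexp (lin a w)"
        unfolding s_def using exp_converges[of "\<i> * of_real (lin a _)"]
        by (intro AE_I2 tendsto_mult tendsto_const) (simp add: sums_def)
      show "AE w in M. norm (s n w) \<le> \<bar>R w * exp \<bar>lin a w\<bar>\<bar>" for n
      proof (intro AE_I2)
        fix w
        have "norm (\<Sum>k<n. (\<i> * of_real (lin a w)) ^ k /\<^sub>R fact k) \<le> (\<Sum>k<n. \<bar>lin a w\<bar> ^ k /\<^sub>R fact k)"
          by (intro order_trans[OF norm_sum] sum_mono) (simp add: norm_mult norm_power)
        also have "\<dots> \<le> exp \<bar>lin a w\<bar>"
          using exp_converges[of "\<bar>lin a w\<bar>"] sum_le_suminf[of "\<lambda>k. \<bar>lin a w\<bar> ^ k /\<^sub>R fact k" "{..<n}"]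
          by (simp add: sums_iff)
        finally show "norm (s n w) \<le> \<bar>R w * exp \<bar>lin a w\<bar>\<bar>"
          by (simp add: s_def norm_mult abs_mult mult_left_mono)
      qed
    qed auto
    moreover have "(CLINT w|M. s n w) = 0" for n
    proof -
      \<comment> \<open>Each term of the series is, up to a scalar, \<open>R\<close> times a power
        of a linear form, and such powers are polynomials in \<open>F\<close>.\<close>
      have pol: "Pol D (k * Suc 0) (\<lambda>v. (\<Sum>x\<in>D. a x * v x) ^ k)" for k
        by (rule Pol_power[OF Pol_linear])
      have int: "integrable M (\<lambda>w. R w * lin a w ^ k)" for k
        using L2_mult_integrable[OF R tame_L2[OF Pol_tame[OF finite_D pol[of k]]]] by (simp add: lin_eq_F)
      have "(LINT w|M. R w * lin a w ^ k) = 0" for k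
        using orth[OF pol[of k]] by (simp add: L2_inner_def lin_eq_F)
      then have zero: "(CLINT w|M. complex_of_real (R w * lin a w ^ k)) = 0" for k
        by (simp only: integral_complex_of_real of_real_0)
      have "s n w = (\<Sum>k<n. (\<i> ^ k /\<^sub>R fact k) * complex_of_real (R w * lin a w ^ k))" for w
        by (simp add: s_def sum_distrib_left power_mult_distrib ac_simps)
      then have "(CLINT w|M. s n w) = (\<Sum>k<n. (\<i> ^ k /\<^sub>R fact k) * (CLINT w|M. complex_of_real (R w * lin a w ^ k)))"
        using int by (simp only: Bochner_Integration.integral_sum integrable_mult_right integral_mult_right_zero
          integrable_of_real)
      then show ?thesis by (simp only: zero mult_zero_right sum.neutral_const)
    qed
    ultimately show ?thesis
      by (simp add: lin_def LIMSEQ_const_iff)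
  qed
  have int: "integrable M (\<lambda>w. R w * \<Phi> (restrict (\<lambda>x. f x w) D))"
    using L2_mult_integrable[OF R tame_L2[OF \<Phi>]] unfolding F_def .
  have "(LINT w|M. R w * \<Phi> (restrict (\<lambda>x. f x w) D)) = 0"
    by (rule fourier_unique_family[OF finite_D int_R f_measurable iexp_zero tame_measurable[OF finite_D \<Phi>] int])
  then show ?thesis
    by (simp add: L2_inner_def F_def)
qed

end

section \<open>Hermite polynomials in the dual variables\<close>

lemma sum_lists_Suc:
  assumes "finite D"
  shows "(\<Sum>xs | set xs \<subseteq> D \<and> length xs = Suc m. g xs) =
    (\<Sum>x\<in>D. \<Sum>xs | set xs \<subseteq> D \<and> length xs = m. g (x # xs))"
proof -
  let ?E = "{xs. set xs \<subseteq> D \<and> length xs = m}"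
  have "(\<Sum>xs | set xs \<subseteq> D \<and> length xs = Suc m. g xs) = (\<Sum>(x, xs)\<in>D \<times> ?E. g (x # xs))"
    by (rule sum.reindex_bij_witness[of _ "\<lambda>(x, xs). x # xs" "\<lambda>xs. (hd xs, tl xs)"])
       (auto simp: length_Suc_conv)
  then show ?thesis
    using finite_lists_length_eq[OF assms, of m] assms by (simp add: sum.cartesian_product)
qed

text \<open>The homogeneous polynomial with coefficient \<open>a xs\<close> at the monomial of
  \<open>xs\<close>, written by peeling off the first index so that it can be differentiated by
  induction. Symmetry of \<open>a\<close> is a hypothesis of the lemmas, not part of the
  definition.\<close>

primrec symmetric_form :: "'i set \<Rightarrow> nat \<Rightarrow> ('i list \<Rightarrow> real) \<Rightarrow> ('i \<Rightarrow> real) \<Rightarrow> real"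
  where
    "symmetric_form D 0 a = (\<lambda>v. a [])"
  | "symmetric_form D (Suc m) a = (\<lambda>v. \<Sum>x\<in>D. v x * symmetric_form D m (\<lambda>xs. a (x # xs)) v)"

lemma Pol_symmetric_form: "Pol D m (symmetric_form D m a)"
  by (induction m arbitrary: a) (auto intro!: Pol_const Pol_sum Pol_coordinate_mult)

lemma symmetric_form_eq_sum:
  "finite D \<Longrightarrow> symmetric_form D m a v = (\<Sum>xs | set xs \<subseteq> D \<and> length xs = m. a xs * (\<Prod>x\<leftarrow>xs. v x))"
proof (induction m arbitrary: a)
  case 0
  have "{xs. set xs \<subseteq> D \<and> xs = []} = {[]}" by auto
  then show ?case by simp
next
  case (Suc m)
  then show ?case
    by (simp add: sum_lists_Suc sum_distrib_left ac_simps)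
qed

text \<open>By symmetry each of the \<open>m\<close> index slots contributes the same. The product
  rule yields the first slot directly, and the induction hypothesis yields the remaining ones. For
  \<open>m = 0\<close> the factor \<open>real m\<close> makes the truncated \<open>m - 1\<close>
  harmless.\<close>

lemma partial_symmetric_form:
  assumes sym: "\<And>xs ys. mset xs = mset ys \<Longrightarrow> a xs = a ys" and D: "finite D" "y \<in> D"
  shows "partial y (symmetric_form D m a) = (\<lambda>v. real m * symmetric_form D (m - 1) (\<lambda>xs. a (y # xs)) v)"
  using sym
proof (induction m arbitrary: a)
  case 0
  show ?case by (intro ext partialI) simp
next
  case (Suc m)
  let ?g = "\<lambda>x. symmetric_form D m (\<lambda>xs. a (x # xs))"
  have IH: "partial y (?g x) = (\<lambda>v. real m * symmetric_form D (m - 1) (\<lambda>xs. a (x # y # xs)) v)" for x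
    by (rule Suc.IH) (auto intro: Suc.prems)
  \<comment> \<open>Moving \<open>y\<close> to the front lets the inner sums be reassembled into the
    form with coefficients \<open>a (y # xs)\<close>.\<close>
  have swap: "(\<lambda>xs. a (x # y # xs)) = (\<lambda>xs. a (y # x # xs))" for x
    by (intro ext Suc.prems) simp
  show ?case
  proof (intro ext partialI)
    fix v
    have "((\<lambda>t. (v(y := t)) x * ?g x (v(y := t))) has_real_derivative
        (if x = y then ?g x v else 0) + v x * partial y (?g x) v) (at (v y))" for x
    proof -
      have "((\<lambda>t. (v(y := t)) x) has_real_derivative (if x = y then 1 else 0)) (at (v y))"
        by auto
      moreover have "((\<lambda>t. ?g x (v(y := t))) has_real_derivative partial y (?g x) v) (at (v y))"
        using Pol_has_derivative[OF Pol_symmetric_form, of D m "\<lambda>xs. a (x # xs)" v y "v y"] by simp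
      ultimately have "((\<lambda>t. (v(y := t)) x * ?g x (v(y := t))) has_real_derivative
          (if x = y then 1 else 0) * ?g x (v(y := v y)) + partial y (?g x) v * (v(y := v y)) x) (at (v y))"
        by (rule DERIV_mult)
      then show ?thesis
        by (cases "x = y") (simp_all only: refl fun_upd_triv if_True if_False mult_1 mult_zero_left mult.commute)
    qed
    then have "((\<lambda>t. \<Sum>x\<in>D. (v(y := t)) x * ?g x (v(y := t))) has_real_derivative
        (\<Sum>x\<in>D. (if x = y then ?g x v else 0) + v x * partial y (?g x) v)) (at (v y))"
      by (rule DERIV_sum)
    moreover have "(\<Sum>x\<in>D. v x * partial y (?g x) v) = real m * ?g y v"
    proof (cases m)
      case 0
      then show ?thesis unfolding IH by simp
    next
      case (Suc k)
      then have "(\<Sum>x\<in>D. v x * partial y (?g x) v) = (\<Sum>x\<in>D. real m * (v x * symmetric_form D k (\<lambda>xs. a (y # x # xs)) v))"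
        unfolding IH swap by (simp add: mult.left_commute)
      also have "\<dots> = real m * ?g y v"
        using Suc by (simp add: sum_distrib_left)
      finally show ?thesis .
    qed
    ultimately show "((\<lambda>t. symmetric_form D (Suc m) a (v(y := t))) has_real_derivative
        real (Suc m) * symmetric_form D (Suc m - 1) (\<lambda>xs. a (y # xs)) v) (at (v y))"
      using D by (simp add: sum.distrib distrib_right)
  qed
qed

context gaussian_family
begin

section \<open>Hermite polynomials and their pairings\<close>

definition dual :: "'i \<Rightarrow> ('i \<Rightarrow> real) \<Rightarrow> real"
  where "dual y v = (\<Sum>x\<in>D. B y x * v x)"

text \<open>The operator applied at each letter, multiplication by \<open>dual y\<close> minus
  \<open>partial y\<close>, is the adjoint of \<open>partial y\<close> under the Gaussian pairing
  \<open>ip\<close>.\<close>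

primrec herm :: "'i list \<Rightarrow> ('i \<Rightarrow> real) \<Rightarrow> real"
  where
    "herm [] = (\<lambda>v. 1)"
  | "herm (y # ys) = (\<lambda>v. dual y v * herm ys v - partial y (herm ys) v)"

definition ip :: "(('i \<Rightarrow> real) \<Rightarrow> real) \<Rightarrow> (('i \<Rightarrow> real) \<Rightarrow> real) \<Rightarrow> real"
  where "ip \<Phi> \<Psi> = L2_inner M (\<lambda>w. \<Phi> (F w)) (\<lambda>w. \<Psi> (F w))"

lemma ip_commute: "ip \<Phi> \<Psi> = ip \<Psi> \<Phi>"
  by (simp add: ip_def L2_inner_commute)

lemma Pol_L2: "Pol D n p \<Longrightarrow> (\<lambda>w. p (F w)) \<in> L2 M"
  by (intro tame_L2 Pol_tame[OF finite_D])

lemma Pol_dual: "Pol D (Suc 0) (dual y)"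
  unfolding dual_def[abs_def] by (rule Pol_linear)

lemma Pol_dual_mult: "Pol D n p \<Longrightarrow> Pol D (Suc n) (\<lambda>v. dual y v * p v)"
  using Pol_mult[OF Pol_dual] by simp

lemma Pol_herm: "Pol D (length ys) (herm ys)"
proof (induction ys)
  case (Cons y ys)
  then have "Pol D (Suc (length ys)) (partial y (herm ys))"
    by (intro Pol_mono[OF Pol_partial]) auto
  with Cons show ?case by (simp add: Pol_diff Pol_dual_mult)
qed (simp add: Pol_const)

lemma herm_L2: "(\<lambda>w. herm ys (F w)) \<in> L2 M"
  by (rule Pol_L2[OF Pol_herm])

text \<open>Integration by parts is applied to the product \<open>G v * herm ys v\<close>; the term
  in which \<open>herm ys\<close> is differentiated cancels against the correction in the
  recursion.\<close>

lemma ip_herm_Cons: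
  assumes G: "tame1 D G" and y: "y \<in> D"
  shows "ip G (herm (y # ys)) = ip (partial y G) (herm ys)"
proof -
  have h: "tame1 D (herm ys)"
    by (rule Pol_tame1[OF finite_D Pol_herm])
  have tame: "tame D G" "tame D (partial y G)" "tame D (herm ys)" "tame D (partial y (herm ys))"
    using G h y by (auto simp: tame1_def)
  have int: "integrable M (\<lambda>w. partial y G (F w) * herm ys (F w))"
    "integrable M (\<lambda>w. G (F w) * partial y (herm ys) (F w))"
    using tame_integrable[OF tame_mult] tame by blast+
  have "tame D (\<lambda>v. dual y v * (G v * herm ys v))"
    by (intro tame_mult tame Pol_tame[OF finite_D Pol_dual])
  from tame_integrable[OF this]
  have int3: "integrable M (\<lambda>w. dual y (F w) * (G (F w) * herm ys (F w)))" .
  have "(LINT w|M. dual y (F w) * (G (F w) * herm ys (F w))) = (LINT w|M. partial y (\<lambda>v. G v * herm ys v) (F w))"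
    using gaussian_integration_by_parts[OF y tame1_mult[OF G h]] by (simp add: dual_def lin_eq_F)
  also have "\<dots> = (LINT w|M. partial y G (F w) * herm ys (F w) + G (F w) * partial y (herm ys) (F w))"
    by (simp add: partial_mult[OF G h y F_families])
  finally have "(LINT w|M. dual y (F w) * (G (F w) * herm ys (F w))) =
      (LINT w|M. partial y G (F w) * herm ys (F w)) + (LINT w|M. G (F w) * partial y (herm ys) (F w))"
    using int by simp
  moreover have "ip G (herm (y # ys)) =
      (LINT w|M. dual y (F w) * (G (F w) * herm ys (F w)) - G (F w) * partial y (herm ys) (F w))"
    unfolding ip_def L2_inner_def by (intro Bochner_Integration.integral_cong) (auto simp: algebra_simps)
  ultimately show ?thesis
    using int int3 by (simp add: ip_def L2_inner_def)
qed

text \<open>Each letter of \<open>ys\<close> moves one derivative onto \<open>p\<close>, which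
  vanishes before the letters are used up.\<close>

lemma ip_herm_low_degree:
  "set ys \<subseteq> D \<Longrightarrow> Pol D k p \<Longrightarrow> k < length ys \<Longrightarrow> ip p (herm ys) = 0"
proof (induction ys arbitrary: k p)
  case (Cons y ys)
  have eq: "ip p (herm (y # ys)) = ip (partial y p) (herm ys)"
    using Cons.prems by (intro ip_herm_Cons Pol_tame1[OF finite_D]) auto
  show ?case
  proof (cases k)
    case 0
    then have "partial y p = (\<lambda>v. 0)"
      using Pol_partial_0[OF Cons.prems(2)] by simp
    then show ?thesis
      unfolding eq by (simp add: ip_def L2_inner_def)
  next
    case (Suc j)
    then show ?thesis
      unfolding eq using Pol_partial_Suc[OF Cons.prems(2)] Cons.prems by (intro Cons.IH[of j]) auto
  qed
qed simp

lemma ip_herm_herm: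
  assumes "set xs \<subseteq> D" "set ys \<subseteq> D" "length xs \<noteq> length ys"
  shows "ip (herm xs) (herm ys) = 0"
proof (cases "length xs < length ys")
  case True
  then show ?thesis using ip_herm_low_degree[OF assms(2) Pol_herm] by blast
next
  case False
  then have "ip (herm ys) (herm xs) = 0"
    using assms by (intro ip_herm_low_degree[OF assms(1) Pol_herm]) auto
  then show ?thesis by (simp add: ip_commute)
qed

text \<open>Only the multiplications raise the degree, so the leading part is a product of dual
  variables. That product does not see the order of \<open>ys\<close>.\<close>

lemma herm_leading_term: "length ys = Suc n \<Longrightarrow> Pol D n (\<lambda>v. herm ys v - (\<Prod>y\<leftarrow>ys. dual y v))"
proof (induction ys arbitrary: n)
  case (Cons y ys)
  have partial: "Pol D n (partial y (herm ys))"
    using Cons.prems by (intro Pol_mono[OF Pol_partial[OF Pol_herm]]) auto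
  have "Pol D n (\<lambda>v. dual y v * (herm ys v - (\<Prod>y\<leftarrow>ys. dual y v)))"
  proof (cases n)
    case 0
    then show ?thesis using Cons.prems by (simp add: Pol_const)
  next
    case (Suc k)
    then show ?thesis using Cons by (auto intro!: Pol_dual_mult)
  qed
  from Pol_diff[OF this partial] show ?case
    by (simp add: algebra_simps)
qed simp

text \<open>The common leading term cancels in the difference \<open>d\<close>, leaving a polynomial
  of lower degree. Both Hermite polynomials are orthogonal to it, so \<open>d\<close> is orthogonal
  to itself.\<close>

lemma herm_permute_AE:
  assumes "mset xs = mset ys" "set xs \<subseteq> D"
  shows "AE w in M. herm xs (F w) = herm ys (F w)"
proof (cases "length xs")
  case 0
  then show ?thesis using assms by simp
next
  case (Suc n)
  have ys: "set ys \<subseteq> D" "length ys = Suc n"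
    using assms Suc mset_eq_setD mset_eq_length by metis+
  define d where "d = (\<lambda>v. herm xs v - herm ys v)"
  have "(\<Prod>y\<leftarrow>xs. dual y v) = (\<Prod>y\<leftarrow>ys. dual y v)" for v
    using assms(1) by (metis mset_map prod_mset_prod_list)
  then have d: "Pol D n d"
    using Pol_diff[OF herm_leading_term[OF Suc] herm_leading_term[OF ys(2)]] by (simp add: d_def)
  have "ip d (herm xs) = 0" "ip d (herm ys) = 0"
    using assms ys Suc by (auto intro!: ip_herm_low_degree[OF _ d])
  moreover have "ip d d = ip (herm xs) d - ip (herm ys) d"
    unfolding ip_def using L2_inner_diff_left[OF herm_L2 herm_L2 Pol_L2[OF d], of xs ys] by (simp add: d_def)
  ultimately have "ip d d = 0" by (simp add: ip_commute)
  then have "AE w in M. d (F w) = 0"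
    using L2_inner_self_eq_0_iff[OF Pol_L2[OF d]] by (simp add: ip_def)
  then show ?thesis by (simp add: d_def)
qed

lemma ip_herm_permute:
  assumes "tame D G" "mset xs = mset ys" "set xs \<subseteq> D"
  shows "ip G (herm xs) = ip G (herm ys)"
proof -
  have "L2_inner M (\<lambda>w. herm xs (F w)) (\<lambda>w. G (F w)) = L2_inner M (\<lambda>w. herm ys (F w)) (\<lambda>w. G (F w))"
    using herm_permute_AE[OF assms(2,3)] tame_L2[OF assms(1)] herm_L2
    by (intro L2_inner_cong_AE) (auto intro: L2_measurable)
  then show ?thesis by (simp add: ip_def L2_inner_commute)
qed

text \<open>The head of \<open>ys\<close> is applied first and therefore ends up innermost, which is
  why the list is reversed.\<close>

lemma ip_partials_herm:
  assumes \<Phi>: "smooth_fun D \<Phi>" "\<forall>xs\<in>lists D. polynomial_growth D (partials xs \<Phi>)"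
  shows "set ys \<subseteq> D \<Longrightarrow> xs \<in> lists D \<Longrightarrow>
    ip (partials xs \<Phi>) (herm ys) = (LINT w|M. partials (rev ys @ xs) \<Phi> (F w))"
proof (induction ys arbitrary: xs)
  case Nil
  then show ?case by (simp add: ip_def L2_inner_def)
next
  case (Cons y ys)
  have "ip (partials xs \<Phi>) (herm (y # ys)) = ip (partial y (partials xs \<Phi>)) (herm ys)"
    using Cons.prems by (intro ip_herm_Cons smooth_fun_tame1_partials \<Phi>) auto
  also have "partial y (partials xs \<Phi>) = partials (y # xs) \<Phi>"
    by (simp add: partials_def)
  finally show ?case
    using Cons by simp
qed

lemma ip_symmetric_form_herm:
  assumes "\<And>xs ys. mset xs = mset ys \<Longrightarrow> a xs = a ys" "set ys \<subseteq> D" "length ys = m"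
  shows "ip (symmetric_form D m a) (herm ys) = fact m * a ys"
  using assms
proof (induction ys arbitrary: a m)
  case Nil
  from Nil.prems(3) show ?case by (simp add: ip_def L2_inner_def prob_space)
next
  case (Cons y ys)
  from Cons.prems(3) obtain k where k: "m = Suc k" "length ys = k" by auto
  have "ip (symmetric_form D m a) (herm (y # ys)) = ip (partial y (symmetric_form D m a)) (herm ys)"
    using Cons.prems(2) by (intro ip_herm_Cons Pol_tame1[OF finite_D Pol_symmetric_form]) auto
  also have "partial y (symmetric_form D m a) = (\<lambda>v. real m * symmetric_form D k (\<lambda>xs. a (y # xs)) v)"
    using partial_symmetric_form[of a D y m, OF Cons.prems(1) finite_D] Cons.prems(2) k(1) by simp
  also have "ip \<dots> (herm ys) = real m * ip (symmetric_form D k (\<lambda>xs. a (y # xs))) (herm ys)"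
    by (simp only: ip_def L2_inner_cmult_left)
  also have "ip (symmetric_form D k (\<lambda>xs. a (y # xs))) (herm ys) = fact k * a (y # ys)"
  proof (rule Cons.IH)
    show "mset xs = mset zs \<Longrightarrow> a (y # xs) = a (y # zs)" for xs zs
      by (rule Cons.prems(1)) simp
  qed (use Cons.prems(2) k in auto)
  finally show ?case using k by simp
qed

section \<open>Hermite polynomials span the polynomials\<close>

definition herm_combination :: "nat \<Rightarrow> (('i \<Rightarrow> real) \<Rightarrow> real) \<Rightarrow> bool"
  where "herm_combination n p \<longleftrightarrow>
    (\<exists>c. p = (\<lambda>v. \<Sum>ys | set ys \<subseteq> D \<and> length ys \<le> n. c ys * herm ys v))"

lemma herm_combination_herm:
  assumes "set ys \<subseteq> D" "length ys \<le> n"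
  shows "herm_combination n (herm ys)"
proof -
  have "herm ys v = (\<Sum>xs | set xs \<subseteq> D \<and> length xs \<le> n. (if xs = ys then 1 else 0) * herm xs v)" for v
    using assms finite_lists_length_le[OF finite_D, of n]
    by (simp add: if_distrib[of "\<lambda>c. c * _"] cong: if_cong)
  then show ?thesis
    unfolding herm_combination_def by (intro exI[of _ "\<lambda>xs. if xs = ys then 1 else 0"] ext)
qed

lemma herm_combination_add:
  assumes "herm_combination n p" "herm_combination n q"
  shows "herm_combination n (\<lambda>v. p v + q v)"
proof -
  obtain c d where "p = (\<lambda>v. \<Sum>ys | set ys \<subseteq> D \<and> length ys \<le> n. c ys * herm ys v)"
    "q = (\<lambda>v. \<Sum>ys | set ys \<subseteq> D \<and> length ys \<le> n. d ys * herm ys v)"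
    using assms unfolding herm_combination_def by blast
  then show ?thesis
    unfolding herm_combination_def
    by (intro exI[of _ "\<lambda>ys. c ys + d ys"]) (simp add: distrib_right sum.distrib)
qed

lemma herm_combination_cmult:
  assumes "herm_combination n p"
  shows "herm_combination n (\<lambda>v. k * p v)"
proof -
  obtain c where "p = (\<lambda>v. \<Sum>ys | set ys \<subseteq> D \<and> length ys \<le> n. c ys * herm ys v)"
    using assms unfolding herm_combination_def by blast
  then show ?thesis
    unfolding herm_combination_def
    by (intro exI[of _ "\<lambda>ys. k * c ys"]) (simp add: sum_distrib_left mult.assoc)
qed

lemma herm_combination_sum:
  "(\<And>i. i \<in> I \<Longrightarrow> herm_combination n (p i)) \<Longrightarrow> herm_combination n (\<lambda>v. \<Sum>i\<in>I. p i v)"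
proof (induction I rule: infinite_finite_induct)
  case (insert i I)
  then show ?case by (simp add: herm_combination_add)
qed (use herm_combination_cmult[OF herm_combination_herm[of "[]" n], of 0] in simp_all)

lemma herm_combination_mono:
  assumes "herm_combination m p" "m \<le> n"
  shows "herm_combination n p"
proof -
  obtain c where "p = (\<lambda>v. \<Sum>ys | set ys \<subseteq> D \<and> length ys \<le> m. c ys * herm ys v)"
    using assms unfolding herm_combination_def by blast
  moreover have "herm_combination n (\<lambda>v. \<Sum>ys | set ys \<subseteq> D \<and> length ys \<le> m. c ys * herm ys v)"
    using assms(2) by (intro herm_combination_sum herm_combination_cmult herm_combination_herm) auto
  ultimately show ?thesis by simp
qed

text \<open>A coordinate is a combination of dual variables, and the recursion reads \<open>dual y v
  * herm ys v = herm (y # ys) v + partial y (herm ys) v\<close>. The last term has lower degree and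
  falls under the induction hypothesis. All identities are pointwise.\<close>

lemma Pol_herm_combination: "Pol D n p \<Longrightarrow> herm_combination n p"
proof (induction n arbitrary: p)
  case 0
  then obtain c where "p = (\<lambda>v. c)" using Pol_0 by blast
  then show ?case
    using herm_combination_cmult[OF herm_combination_herm[of "[]" 0], of c] by simp
next
  case (Suc n)
  \<comment> \<open>The degree is a separate variable \<open>m\<close> so that rule induction on
    \<open>Pol\<close> applies inside the induction on \<open>n\<close>.\<close>
  have "herm_combination (Suc n) p" if "Pol D m p" "m = Suc n" for m p
    using that
  proof (induction rule: Pol.induct)
    case (Pol_const k c)
    then show ?case
      using herm_combination_cmult[OF herm_combination_herm[of "[]" k], of c] by simp
  next
    case (Pol_add k p q)
    then show ?case by (simp add: herm_combination_add)
  next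
    case (Pol_coordinate_mult x k p)
    then have "herm_combination n p" using Suc.IH by simp
    then obtain c where c: "p = (\<lambda>v. \<Sum>ys | set ys \<subseteq> D \<and> length ys \<le> n. c ys * herm ys v)"
      unfolding herm_combination_def by blast
    obtain d where d: "\<And>v. v x = (\<Sum>y\<in>D. d y * dual y v)"
      using coordinate_in_span_dual[OF Pol_coordinate_mult.hyps(1)] unfolding dual_def by blast
    have "v x * p v = (\<Sum>y\<in>D. d y * (\<Sum>ys | set ys \<subseteq> D \<and> length ys \<le> n.
        c ys * (herm (y # ys) v + partial y (herm ys) v)))" for v
      unfolding d[of v] sum_distrib_right
      by (intro sum.cong refl) (simp add: c sum_distrib_left ac_simps)
    moreover have "herm_combination (Suc n) (\<lambda>v. \<Sum>y\<in>D. d y * (\<Sum>ys | set ys \<subseteq> D \<and> length ys \<le> n.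
        c ys * (herm (y # ys) v + partial y (herm ys) v)))"
    proof (intro herm_combination_sum herm_combination_cmult herm_combination_add herm_combination_herm)
      fix y ys assume ys: "ys \<in> {ys. set ys \<subseteq> D \<and> length ys \<le> n}"
      then have "Pol D n (partial y (herm ys))"
        by (intro Pol_mono[OF Pol_partial[OF Pol_herm]]) auto
      then show "herm_combination (Suc n) (partial y (herm ys))"
        using Suc.IH herm_combination_mono by (meson le_SucI order_refl)
    qed auto
    ultimately show ?case by simp
  qed
  then show ?case using Suc.prems by blast
qed

end

section \<open>The homogeneous chaos\<close>

lemma finite_multi_indices: "finite (multi_indices n m)"
  unfolding multi_indices_def by (rule finite_subset[of _ "{..<n} \<rightarrow>\<^sub>E {..m}"]) (auto intro: finite_PiE)

lemma multi_indices_shift: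
  assumes "\<alpha> \<in> multi_indices n m" "j < n"
  shows "\<alpha>(j := Suc (\<alpha> j)) \<in> multi_indices n (Suc m)"
proof -
  have "(\<Sum>i<n. (\<alpha>(j := Suc (\<alpha> j))) i) = (\<Sum>i<n. \<alpha> i + (if i = j then 1 else 0))"
    by (intro sum.cong) auto
  also have "\<dots> = Suc (\<Sum>i<n. \<alpha> i)"
    using assms(2) by (simp add: sum.distrib)
  finally have "(\<Sum>i<n. (\<alpha>(j := Suc (\<alpha> j))) i) \<le> Suc m"
    using assms(1) by (simp add: multi_indices_def)
  moreover have "\<alpha>(j := Suc (\<alpha> j)) \<in> {..<n} \<rightarrow>\<^sub>E {..Suc m}"
    using assms unfolding multi_indices_def by (auto simp: PiE_iff extensional_def le_SucI)
  ultimately show ?thesis by (simp add: multi_indices_def)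
qed

section \<open>Closures of polynomial spaces and the chaos as a span of Hermite polynomials\<close>

context gaussian_family
begin

abbreviation "H \<equiv> gaussian_hilbert_space M D f"

text \<open>A finite span is closed, so the closure contributes only modifications on null
  sets.\<close>

lemma gaussian_hilbert_space_AE_lin:
  assumes "X \<in> gaussian_hilbert_space M D f"
  shows "\<exists>a. AE w in M. X w = lin a w"
  unfolding lin_def
proof (rule L2_span_closed[OF finite_D f_L2])
  show "X \<in> L2 M"
    using assms by (simp add: gaussian_hilbert_space_def L2_closure_def)
  fix \<epsilon> :: real assume "\<epsilon> > 0"
  then show "\<exists>c. L2_dist M X (\<lambda>w. \<Sum>x\<in>D. c x * f x w) < \<epsilon>"
    using assms unfolding gaussian_hilbert_space_def L2_closure_def by blast
qed

lemma f_in_H: "x \<in> D \<Longrightarrow> f x \<in> H"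
proof -
  assume x: "x \<in> D"
  have "f x \<in> range (\<lambda>a w. \<Sum>x\<in>D. a x * f x w)"
    using f_eq_lin[OF x] by (intro range_eqI[where x = "\<lambda>y. if y = x then 1 else 0"]) (simp add: lin_def[abs_def])
  then show "f x \<in> H"
    unfolding gaussian_hilbert_space_def
    by (intro L2_closureI[of _ _ "f x"] f_L2 x) (simp_all add: L2_dist_def)
qed

lemma polynomials_AE_Pol:
  assumes "P \<in> polynomials H m"
  shows "\<exists>p. Pol D m p \<and> (AE w in M. P w = p (F w))"
proof -
  obtain n X c where P: "P = (\<lambda>w. \<Sum>\<alpha>\<in>multi_indices n m. c \<alpha> * (\<Prod>i<n. X i w ^ \<alpha> i))" and X: "\<forall>i<n. X i \<in> H"
    using assms unfolding polynomials_def by blast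
  have "\<forall>i. \<exists>a. i < n \<longrightarrow> (AE w in M. X i w = lin a w)"
    using X gaussian_hilbert_space_AE_lin by blast
  then obtain a where a: "\<And>i. i < n \<Longrightarrow> AE w in M. X i w = lin (a i) w"
    by metis
  define p where "p = (\<lambda>v. \<Sum>\<alpha>\<in>multi_indices n m. c \<alpha> * (\<Prod>i<n. (\<Sum>x\<in>D. a i x * v x) ^ \<alpha> i))"
  have "Pol D m (\<lambda>v. \<Prod>i<n. (\<Sum>x\<in>D. a i x * v x) ^ \<alpha> i)" if "\<alpha> \<in> multi_indices n m" for \<alpha>
  proof (rule Pol_mono)
    show "Pol D (\<Sum>i<n. \<alpha> i * Suc 0) (\<lambda>v. \<Prod>i<n. (\<Sum>x\<in>D. a i x * v x) ^ \<alpha> i)"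
      by (intro Pol_prod Pol_power Pol_linear) simp
    show "(\<Sum>i<n. \<alpha> i * Suc 0) \<le> m"
      using that by (simp add: multi_indices_def)
  qed
  then have "Pol D m p"
    unfolding p_def by (intro Pol_sum Pol_cmult)
  moreover have "AE w in M. \<forall>i\<in>{..<n}. X i w = lin (a i) w"
    using a by (intro AE_finite_allI) auto
  then have "AE w in M. P w = p (F w)"
    by eventually_elim (simp add: P p_def lin_eq_F)
  ultimately show ?thesis by blast
qed

text \<open>After enumerating \<open>D\<close>, multiplication by a coordinate raises one entry of
  the multi-index by 1. The representation is exact, not only almost everywhere.\<close>

lemma Pol_in_polynomials:
  assumes "Pol D m p"
  shows "(\<lambda>w. p (F w)) \<in> polynomials H m"
proof -
  obtain e where e: "bij_betw e {0..<card D} D"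
    using ex_bij_betw_nat_finite[OF finite_D] by blast
  let ?n = "card D"
  define mon where "mon \<alpha> w = (\<Prod>i<?n. f (e i) w ^ \<alpha> i)" for \<alpha> :: "nat \<Rightarrow> nat" and w
  have "\<exists>c. \<forall>w. p (F w) = (\<Sum>\<alpha>\<in>multi_indices ?n m. c \<alpha> * mon \<alpha> w)"
    using assms
  proof (induction rule: Pol.induct)
    case (Pol_const m k)
    \<comment> \<open>Multi-indices are extensional, so the zero index has to be
      \<open>undefined\<close> beyond \<open>card D\<close>.\<close>
    define z where "z = (\<lambda>i\<in>{..<?n}. 0 :: nat)"
    have "z \<in> multi_indices ?n m"
      by (auto simp: z_def multi_indices_def)
    moreover have "mon z w = 1" for w by (simp add: mon_def z_def)
    ultimately have "k = (\<Sum>\<alpha>\<in>multi_indices ?n m. (if \<alpha> = z then k else 0) * mon \<alpha> w)" for w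
      by (simp add: finite_multi_indices if_distrib[of "\<lambda>c. c * _"] cong: if_cong)
    then show ?case by (intro exI[of _ "\<lambda>\<alpha>. if \<alpha> = z then k else 0"] allI)
  next
    case (Pol_add m p q)
    then obtain c d where "\<forall>w. p (F w) = (\<Sum>\<alpha>\<in>multi_indices ?n m. c \<alpha> * mon \<alpha> w)"
      "\<forall>w. q (F w) = (\<Sum>\<alpha>\<in>multi_indices ?n m. d \<alpha> * mon \<alpha> w)" by blast
    then show ?case
      by (intro exI[of _ "\<lambda>\<alpha>. c \<alpha> + d \<alpha>"]) (simp add: distrib_right sum.distrib)
  next
    case (Pol_coordinate_mult x m p)
    then obtain c where c: "\<And>w. p (F w) = (\<Sum>\<alpha>\<in>multi_indices ?n m. c \<alpha> * mon \<alpha> w)" by blast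
    obtain j where j: "j < ?n" "e j = x"
      using e Pol_coordinate_mult.hyps(1) unfolding bij_betw_def by force
    define s where "s \<alpha> = \<alpha>(j := Suc (\<alpha> j))" for \<alpha> :: "nat \<Rightarrow> nat"
    define s' where "s' \<beta> = \<beta>(j := \<beta> j - 1)" for \<beta> :: "nat \<Rightarrow> nat"
    have s': "s' (s \<alpha>) = \<alpha>" for \<alpha> by (simp add: s_def s'_def)
    then have inj: "inj_on s A" for A by (metis inj_onI)
    have mon_s: "mon (s \<alpha>) w = f x w * mon \<alpha> w" for \<alpha> w
    proof -
      have "mon (s \<alpha>) w = (\<Prod>i<?n. (if i = j then f x w else 1) * f (e i) w ^ \<alpha> i)"
        unfolding mon_def s_def using j(2) by (intro prod.cong) auto
      then show ?thesis using j(1) by (simp add: prod.distrib mon_def)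
    qed
    let ?S = "s ` multi_indices ?n m"
    have sub: "?S \<subseteq> multi_indices ?n (Suc m)"
      using multi_indices_shift[OF _ j(1)] by (auto simp: s_def)
    \<comment> \<open>The shift \<open>s\<close> is injective but not onto: coefficients are carried
      over along its left inverse \<open>s'\<close> and are 0 off its image.\<close>
    define c' where "c' \<beta> = (if \<beta> \<in> ?S then c (s' \<beta>) else 0)" for \<beta>
    have "F w x * p (F w) = (\<Sum>\<beta>\<in>multi_indices ?n (Suc m). c' \<beta> * mon \<beta> w)" for w
    proof -
      have "(\<Sum>\<beta>\<in>multi_indices ?n (Suc m). c' \<beta> * mon \<beta> w) = (\<Sum>\<beta>\<in>?S. c' \<beta> * mon \<beta> w)"
        using sub by (intro sum.mono_neutral_right finite_multi_indices) (auto simp: c'_def)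
      also have "\<dots> = (\<Sum>\<beta>\<in>?S. c (s' \<beta>) * mon \<beta> w)"
        by (intro sum.cong) (simp_all add: c'_def)
      also have "\<dots> = (\<Sum>\<alpha>\<in>multi_indices ?n m. c \<alpha> * mon (s \<alpha>) w)"
        by (simp add: sum.reindex[OF inj] s')
      finally show ?thesis
        using Pol_coordinate_mult.hyps(1) by (simp add: c mon_s F_apply sum_distrib_left mult.left_commute)
    qed
    then show ?case by blast
  qed
  then obtain c where c: "\<And>w. p (F w) = (\<Sum>\<alpha>\<in>multi_indices ?n m. c \<alpha> * (\<Prod>i<?n. f (e i) w ^ \<alpha> i))"
    unfolding mon_def by blast
  have "f (e i) \<in> H" if "i < ?n" for i
    using bij_betwE[OF e] that f_in_H by simp
  then show ?thesis
    unfolding polynomials_def c[abs_def]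
    by (intro CollectI exI[of _ ?n] exI[of _ "\<lambda>i. f (e i)"] exI[of _ c]) auto
qed

text \<open>Up to null sets, polynomials of degree at most \<open>m\<close> are the span of the
  finitely many \<open>herm ys\<close> with \<open>length ys \<le> m\<close>, and such a span is
  closed.\<close>

lemma closure_polynomials_iff:
  "Y \<in> L2_closure M (polynomials H m) \<longleftrightarrow> Y \<in> L2 M \<and> (\<exists>p. Pol D m p \<and> (AE w in M. Y w = p (F w)))"
proof (intro iffI conjI)
  assume Y: "Y \<in> L2_closure M (polynomials H m)"
  then show Y2: "Y \<in> L2 M" by (simp add: L2_closure_def)
  let ?L = "{ys. set ys \<subseteq> D \<and> length ys \<le> m}"
  have "\<exists>c. AE w in M. Y w = (\<Sum>ys\<in>?L. c ys * herm ys (F w))"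
  proof (rule L2_span_closed[OF finite_lists_length_le[OF finite_D] herm_L2 Y2])
    fix \<epsilon> :: real assume "\<epsilon> > 0"
    then obtain P where P: "P \<in> polynomials H m" "P \<in> L2 M" "L2_dist M Y P < \<epsilon>"
      using Y by (auto simp: L2_closure_def)
    obtain p where p: "Pol D m p" "AE w in M. P w = p (F w)"
      using polynomials_AE_Pol[OF P(1)] by blast
    obtain c where c: "p = (\<lambda>v. \<Sum>ys\<in>?L. c ys * herm ys v)"
      using Pol_herm_combination[OF p(1)] unfolding herm_combination_def by blast
    have [measurable]: "(\<lambda>w. p (F w)) \<in> borel_measurable M" "Y \<in> borel_measurable M" "P \<in> borel_measurable M"
      using Pol_L2[OF p(1)] Y2 P(2) by auto
    have "L2_dist M Y (\<lambda>w. p (F w)) = L2_dist M Y P"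
      unfolding L2_dist_def using p(2) by (intro arg_cong[where f = sqrt] integral_cong_AE) auto
    then show "\<exists>c. L2_dist M Y (\<lambda>w. \<Sum>ys\<in>?L. c ys * herm ys (F w)) < \<epsilon>"
      using P(3) unfolding c by (intro exI[of _ c]) simp
  qed
  then obtain c where "AE w in M. Y w = (\<Sum>ys\<in>?L. c ys * herm ys (F w))" by blast
  moreover have "Pol D m (\<lambda>v. \<Sum>ys\<in>?L. c ys * herm ys v)"
    by (intro Pol_sum Pol_cmult) (auto intro: Pol_mono[OF Pol_herm])
  ultimately show "\<exists>p. Pol D m p \<and> (AE w in M. Y w = p (F w))" by blast
next
  assume "Y \<in> L2 M \<and> (\<exists>p. Pol D m p \<and> (AE w in M. Y w = p (F w)))"
  then obtain p where Y: "Y \<in> L2 M" and p: "Pol D m p" "AE w in M. Y w = p (F w)" by blast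
  have "AE w in M. (Y w - p (F w))\<^sup>2 = 0" using p(2) by eventually_elim simp
  then have "L2_dist M Y (\<lambda>w. p (F w)) = 0"
    unfolding L2_dist_def by (simp add: integral_eq_zero_AE)
  then show "Y \<in> L2_closure M (polynomials H m)"
    by (rule L2_closureI[OF Y Pol_in_polynomials[OF p(1)] Pol_L2[OF p(1)]])
qed

definition homogeneous :: "nat \<Rightarrow> ('w \<Rightarrow> real) \<Rightarrow> bool"
  where "homogeneous m Z \<longleftrightarrow> Z \<in> L2 M \<and>
    (\<exists>c. AE w in M. Z w = (\<Sum>ys | set ys \<subseteq> D \<and> length ys = m. c ys * herm ys (F w)))"

lemma homogeneous_inner:
  assumes "homogeneous m Z" "Y \<in> L2 M"
    and zero: "\<And>ys. set ys \<subseteq> D \<Longrightarrow> length ys = m \<Longrightarrow> L2_inner M Y (\<lambda>w. herm ys (F w)) = 0"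
  shows "L2_inner M Y Z = 0"
proof -
  let ?E = "{ys. set ys \<subseteq> D \<and> length ys = m}"
  obtain c where Z: "Z \<in> L2 M" and c: "AE w in M. Z w = (\<Sum>ys\<in>?E. c ys * herm ys (F w))"
    using assms(1) unfolding homogeneous_def by blast
  have "L2_inner M Z Y = L2_inner M (\<lambda>w. \<Sum>ys\<in>?E. c ys * herm ys (F w)) Y"
    using c Z assms(2) L2_sum[of ?E "\<lambda>ys w. herm ys (F w)" M c] herm_L2
    by (intro L2_inner_cong_AE) (auto intro: L2_measurable)
  also have "\<dots> = 0"
    using zero herm_L2 assms(2) by (subst L2_inner_sum_left) (auto simp: L2_inner_commute[of M _ Y])
  finally show ?thesis by (simp add: L2_inner_commute)
qed

lemma homogeneous_diff:
  assumes "homogeneous m Z" "homogeneous m Z'"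
  shows "homogeneous m (\<lambda>w. Z w - Z' w)"
proof -
  let ?E = "{ys. set ys \<subseteq> D \<and> length ys = m}"
  obtain c c' where "AE w in M. Z w = (\<Sum>ys\<in>?E. c ys * herm ys (F w))"
    "AE w in M. Z' w = (\<Sum>ys\<in>?E. c' ys * herm ys (F w))"
    using assms unfolding homogeneous_def by blast
  then have "AE w in M. Z w - Z' w = (\<Sum>ys\<in>?E. (c ys - c' ys) * herm ys (F w))"
    by eventually_elim (simp add: left_diff_distrib sum_subtractf)
  moreover have "(\<lambda>w. Z w - Z' w) \<in> L2 M"
    using assms by (intro L2_diff) (auto simp: homogeneous_def)
  ultimately show ?thesis
    unfolding homogeneous_def by (intro conjI exI[of _ "\<lambda>ys. c ys - c' ys"])
qed

text \<open>The difference is itself a combination of the test functions, hence orthogonal to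
  itself. No orthogonality among the \<open>herm ys\<close> of equal length is involved.\<close>

lemma homogeneous_unique:
  assumes "homogeneous m Z" "homogeneous m Z'"
    and "\<And>ys. set ys \<subseteq> D \<Longrightarrow> length ys = m \<Longrightarrow>
      L2_inner M Z (\<lambda>w. herm ys (F w)) = L2_inner M Z' (\<lambda>w. herm ys (F w))"
  shows "AE w in M. Z w = Z' w"
proof -
  let ?U = "\<lambda>w. Z w - Z' w"
  have L2: "Z \<in> L2 M" "Z' \<in> L2 M" using assms by (auto simp: homogeneous_def)
  then have U: "?U \<in> L2 M" by (rule L2_diff)
  have "L2_inner M ?U ?U = 0"
    using assms(3) L2 herm_L2
    by (intro homogeneous_inner[OF homogeneous_diff[OF assms(1,2)] U]) (simp add: L2_inner_diff_left)
  then show ?thesis using L2_inner_self_eq_0_iff[OF U] by simp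
qed

lemma homogeneous_sum:
  assumes "finite I" "\<And>i. i \<in> I \<Longrightarrow> homogeneous m (Z i)"
  shows "homogeneous m (\<lambda>w. \<Sum>i\<in>I. k i * Z i w)"
proof -
  let ?E = "{ys. set ys \<subseteq> D \<and> length ys = m}"
  have "\<forall>i\<in>I. \<exists>c. AE w in M. Z i w = (\<Sum>ys\<in>?E. c ys * herm ys (F w))"
    using assms(2) unfolding homogeneous_def by blast
  from bchoice[OF this] obtain c where c: "\<forall>i\<in>I. AE w in M. Z i w = (\<Sum>ys\<in>?E. c i ys * herm ys (F w))"
    by blast
  have "AE w in M. \<forall>i\<in>I. Z i w = (\<Sum>ys\<in>?E. c i ys * herm ys (F w))"
    using c assms(1) by (intro AE_finite_allI) blast+
  then have "AE w in M. (\<Sum>i\<in>I. k i * Z i w) = (\<Sum>ys\<in>?E. (\<Sum>i\<in>I. k i * c i ys) * herm ys (F w))"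
  proof eventually_elim
    case (elim w)
    then have "(\<Sum>i\<in>I. k i * Z i w) = (\<Sum>i\<in>I. \<Sum>ys\<in>?E. k i * c i ys * herm ys (F w))"
      by (intro sum.cong) (auto simp: sum_distrib_left mult.assoc)
    also have "\<dots> = (\<Sum>ys\<in>?E. \<Sum>i\<in>I. k i * c i ys * herm ys (F w))"
      by (rule sum.swap)
    finally show ?case by (simp add: sum_distrib_right)
  qed
  moreover have "(\<lambda>w. \<Sum>i\<in>I. k i * Z i w) \<in> L2 M"
    using assms(2) by (intro L2_sum) (auto simp: homogeneous_def)
  ultimately show ?thesis
    unfolding homogeneous_def by (intro conjI exI[of _ "\<lambda>ys. \<Sum>i\<in>I. k i * c i ys"])
qed

text \<open>For positive degree, orthogonality to lower-degree polynomials removes exactly the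
  shorter Hermite polynomials. Degree 0 is separate because there the chaos is defined as the
  constants; the only list is \<open>[]\<close> and \<open>herm []\<close> is 1.\<close>

lemma chaos_iff_homogeneous: "Z \<in> chaos M H m \<longleftrightarrow> homogeneous m Z"
proof (cases m)
  case 0
  have E: "{ys. set ys \<subseteq> D \<and> length ys = 0} = {[]}" by auto
  have "(\<exists>c. AE w in M. Z w = c) \<longleftrightarrow> (\<exists>c :: 'i list \<Rightarrow> real. AE w in M. Z w = c [])"
  proof
    assume "\<exists>c. AE w in M. Z w = c"
    then obtain k where "AE w in M. Z w = k" by blast
    then show "\<exists>c :: 'i list \<Rightarrow> real. AE w in M. Z w = c []"
      by (intro exI[of _ "\<lambda>_. k"])
  qed blast
  then show ?thesis
    unfolding 0 homogeneous_def chaos.simps E by simp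
next
  case (Suc n)
  let ?E = "{ys. set ys \<subseteq> D \<and> length ys = m}"
  let ?L = "\<lambda>n. {ys. set ys \<subseteq> D \<and> length ys \<le> n}"
  have orth: "L2_inner M (\<lambda>w. \<Sum>ys\<in>?E. c ys * herm ys (F w)) (\<lambda>w. p (F w)) = 0" if "Pol D n p" for c p
  proof -
    have "L2_inner M (\<lambda>w. herm ys (F w)) (\<lambda>w. p (F w)) = 0" if "ys \<in> ?E" for ys
      using ip_herm_low_degree[OF _ \<open>Pol D n p\<close>, of ys] that Suc by (simp add: ip_def L2_inner_commute)
    then show ?thesis
      by (subst L2_inner_sum_left[OF herm_L2 Pol_L2[OF that]]) simp
  qed
  have Pol_sum_herm: "Pol D k (\<lambda>v. \<Sum>ys\<in>A. c ys * herm ys v)" if "A \<subseteq> ?L k" for k A c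
    using that by (intro Pol_sum Pol_cmult) (auto intro: Pol_mono[OF Pol_herm])
  show ?thesis
  proof
    assume "Z \<in> chaos M H m"
    then have Z: "Z \<in> L2_closure M (polynomials H m)"
      and ZY: "\<forall>Y\<in>L2_closure M (polynomials H n). L2_inner M Z Y = 0"
      by (auto simp: Suc)
    from Z obtain p where Z2: "Z \<in> L2 M" and p: "Pol D m p" "AE w in M. Z w = p (F w)"
      unfolding closure_polynomials_iff by blast
    obtain c where c: "p = (\<lambda>v. \<Sum>ys\<in>?L m. c ys * herm ys v)"
      using Pol_herm_combination[OF p(1)] unfolding herm_combination_def by blast
    \<comment> \<open>\<open>Z\<close> splits into a lower-degree part \<open>A\<close> and a top
      part \<open>T\<close>. Both \<open>Z\<close> and \<open>T\<close> are orthogonal to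
      \<open>A\<close>, so \<open>A\<close> has norm 0.\<close>
    define A where "A = (\<lambda>v. \<Sum>ys\<in>?L n. c ys * herm ys v)"
    define T where "T = (\<lambda>v. \<Sum>ys\<in>?E. c ys * herm ys v)"
    have A: "Pol D n A" and T: "Pol D m T"
      unfolding A_def T_def by (auto intro!: Pol_sum_herm)
    have "?L m = ?L n \<union> ?E" "?L n \<inter> ?E = {}"
      using Suc by auto
    then have split: "p v = A v + T v" for v
      unfolding c A_def T_def using finite_D
      by (simp add: sum.union_disjoint finite_lists_length_le finite_lists_length_eq)
    have "(\<lambda>w. A (F w)) \<in> L2_closure M (polynomials H n)"
      unfolding closure_polynomials_iff using A Pol_L2[OF A] by auto
    then have "L2_inner M Z (\<lambda>w. A (F w)) = 0" using ZY by blast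
    moreover have "L2_inner M Z (\<lambda>w. A (F w)) = L2_inner M (\<lambda>w. A (F w) + T (F w)) (\<lambda>w. A (F w))"
      using p(2) Z2 L2_add[OF Pol_L2[OF A] Pol_L2[OF T]] Pol_L2[OF A]
      by (intro L2_inner_cong_AE) (auto simp: split intro: L2_measurable)
    moreover have "L2_inner M (\<lambda>w. T (F w)) (\<lambda>w. A (F w)) = 0"
      unfolding T_def by (rule orth[OF A])
    ultimately have "L2_inner M (\<lambda>w. A (F w)) (\<lambda>w. A (F w)) = 0"
      using Pol_L2[OF A] Pol_L2[OF T] by (simp add: L2_inner_add_left)
    then have "AE w in M. A (F w) = 0"
      using L2_inner_self_eq_0_iff[OF Pol_L2[OF A]] by simp
    with p(2) have "AE w in M. Z w = (\<Sum>ys\<in>?E. c ys * herm ys (F w))"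
      by eventually_elim (simp add: split T_def)
    then show "homogeneous m Z"
      unfolding homogeneous_def using Z2 by blast
  next
    assume hom: "homogeneous m Z"
    then obtain c where Z: "Z \<in> L2 M" and c: "AE w in M. Z w = (\<Sum>ys\<in>?E. c ys * herm ys (F w))"
      unfolding homogeneous_def by blast
    have T: "Pol D m (\<lambda>v. \<Sum>ys\<in>?E. c ys * herm ys v)"
      by (rule Pol_sum_herm) auto
    have "Z \<in> L2_closure M (polynomials H m)"
      unfolding closure_polynomials_iff using Z c T by blast
    moreover have "L2_inner M Z Y = 0" if Y: "Y \<in> L2_closure M (polynomials H n)" for Y
    proof -
      obtain p where Y2: "Y \<in> L2 M" and p: "Pol D n p" "AE w in M. Y w = p (F w)"
        using Y unfolding closure_polynomials_iff by blast
      have "L2_inner M Y (\<lambda>w. herm ys (F w)) = 0" if "set ys \<subseteq> D" "length ys = m" for ys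
      proof -
        have "L2_inner M Y (\<lambda>w. herm ys (F w)) = ip p (herm ys)"
          unfolding ip_def using p(2) Y2 Pol_L2[OF p(1)] herm_L2
          by (intro L2_inner_cong_AE) (auto intro: L2_measurable)
        then show ?thesis
          using ip_herm_low_degree[OF that(1) p(1)] that(2) Suc by simp
      qed
      from homogeneous_inner[OF hom Y2 this] show ?thesis
        by (simp add: L2_inner_commute)
    qed
    ultimately show "Z \<in> chaos M H m"
      by (simp add: Suc)
  qed
qed

text \<open>The properties of the chosen version are available only once some projection is known to
  exist; projecting onto the finite span of the \<open>herm ys\<close> of length \<open>m\<close>
  provides one.\<close>

lemma
  assumes X: "X \<in> L2 M"
  shows homogeneous_chaos_proj: "homogeneous m (chaos_proj M H m X)"
    and inner_chaos_proj: "set ys \<subseteq> D \<Longrightarrow> length ys = m \<Longrightarrow>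
      L2_inner M (chaos_proj M H m X) (\<lambda>w. herm ys (F w)) = L2_inner M X (\<lambda>w. herm ys (F w))"
proof -
  let ?E = "{ys. set ys \<subseteq> D \<and> length ys = m}"
  have hom_herm: "homogeneous m (\<lambda>w. herm ys (F w))" if "ys \<in> ?E" for ys
  proof -
    have "herm ys v = (\<Sum>xs\<in>?E. (if xs = ys then 1 else 0) * herm xs v)" for v
      using that finite_lists_length_eq[OF finite_D, of m]
      by (simp add: if_distrib[of "\<lambda>c. c * _"] cong: if_cong)
    then show ?thesis
      unfolding homogeneous_def using herm_L2
      by (intro conjI exI[of _ "\<lambda>xs. if xs = ys then 1 else 0"] AE_I2)
  qed
  obtain c where c: "\<forall>ys\<in>?E. L2_inner M (\<lambda>w. X w - (\<Sum>xs\<in>?E. c xs * herm xs (F w))) (\<lambda>w. herm ys (F w)) = 0"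
    using L2_projection_exists[OF finite_lists_length_eq[OF finite_D, of m], of "\<lambda>ys w. herm ys (F w)" M X] X herm_L2
    by blast
  define Z where "Z = (\<lambda>w. \<Sum>xs\<in>?E. c xs * herm xs (F w))"
  have hom: "homogeneous m Z"
    unfolding homogeneous_def Z_def using L2_sum[of ?E "\<lambda>ys w. herm ys (F w)" M c] herm_L2 by auto
  then have Z: "Z \<in> L2 M" by (simp add: homogeneous_def)
  have orth: "L2_inner M (\<lambda>w. X w - Z w) Y = 0" if "Y \<in> chaos M H m" for Y
  proof (rule homogeneous_inner[OF _ L2_diff[OF X Z]])
    show "homogeneous m Y"
      using that unfolding chaos_iff_homogeneous .
    show "L2_inner M (\<lambda>w. X w - Z w) (\<lambda>w. herm ys (F w)) = 0" if "set ys \<subseteq> D" "length ys = m" for ys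
      using bspec[OF c, of ys] that by (simp add: Z_def)
  qed
  have ex: "\<exists>Z. Z \<in> chaos M H m \<and> (\<forall>Y\<in>chaos M H m. L2_inner M (\<lambda>w. X w - Z w) Y = 0)"
    using hom orth by (intro exI[of _ Z] conjI ballI) (simp_all only: chaos_iff_homogeneous)
  from someI_ex[OF ex] have proj: "chaos_proj M H m X \<in> chaos M H m"
    "\<forall>Y\<in>chaos M H m. L2_inner M (\<lambda>w. X w - chaos_proj M H m X w) Y = 0"
    unfolding chaos_proj_def by blast+
  then show h: "homogeneous m (chaos_proj M H m X)"
    unfolding chaos_iff_homogeneous by blast
  assume "set ys \<subseteq> D" "length ys = m"
  then have "(\<lambda>w. herm ys (F w)) \<in> chaos M H m"
    using hom_herm[of ys] by (simp only: chaos_iff_homogeneous) simp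
  from bspec[OF proj(2) this]
  have "L2_inner M (\<lambda>w. X w - chaos_proj M H m X w) (\<lambda>w. herm ys (F w)) = 0" .
  then show "L2_inner M (chaos_proj M H m X) (\<lambda>w. herm ys (F w)) = L2_inner M X (\<lambda>w. herm ys (F w))"
    using h X herm_L2 by (simp add: homogeneous_def L2_inner_diff_left)
qed

section \<open>The chaos expansion\<close>

text \<open>Testing against Hermite polynomials of degree \<open>m\<close> removes every projection:
  \<open>\<Phi>\<close> and the monomials pair with them exactly as their projections do. The
  equation holds almost everywhere since both sides involve chosen versions.\<close>

lemma chaos_proj_formula:
  assumes \<Phi>: "smooth_fun D \<Phi>" "\<forall>xs\<in>lists D. polynomial_growth D (partials xs \<Phi>)"
  shows "AE w in M. chaos_proj M H m (\<lambda>w. \<Phi> (F w)) w = 1 / fact m *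
    (\<Sum>xs | set xs \<subseteq> D \<and> length xs = m. wick M H (map f xs) w * (LINT w'|M. partials xs \<Phi> (F w')))"
proof -
  let ?E = "{xs. set xs \<subseteq> D \<and> length xs = m}"
  have tame: "tame D \<Phi>"
    using smooth_fun_tame1_partials[OF \<Phi>, of "[]"] by (simp add: partials_def tame1_def)
  define a where "a xs = (if set xs \<subseteq> D then LINT w|M. partials xs \<Phi> (F w) else 0)" for xs
  have a_herm: "a xs = ip \<Phi> (herm xs)" if "set xs \<subseteq> D" for xs
  proof -
    \<comment> \<open>The pairing returns derivatives in reversed order, so it is started from
      \<open>rev xs\<close>; permutation invariance of the pairing then restores
      \<open>xs\<close>.\<close>
    have "ip \<Phi> (herm (rev xs)) = a xs"
      using ip_partials_herm[OF \<Phi>, of "rev xs" "[]"] that by (simp add: a_def partials_def)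
    then show ?thesis
      using ip_herm_permute[OF tame, of "rev xs" xs] that by simp
  qed
  have sym: "a xs = a ys" if "mset xs = mset ys" for xs ys
  proof -
    have "set xs = set ys" using that by (rule mset_eq_setD)
    then show ?thesis
      using a_herm[of xs] a_herm[of ys] ip_herm_permute[OF tame that] by (auto simp: a_def)
  qed
  define X where "X xs w = (\<Prod>x\<leftarrow>xs. F w x)" for xs :: "'i list" and w
  have X_L2: "X xs \<in> L2 M" if "xs \<in> ?E" for xs
    unfolding X_def using that by (intro Pol_L2[OF Pol_prod_list]) auto
  have wick: "wick M H (map f xs) = chaos_proj M H m (X xs)" if "xs \<in> ?E" for xs
  proof -
    have "map (\<lambda>x. f x w) xs = map (F w) xs" for w
      using that by (auto simp: F_apply)
    then have "(\<lambda>w. \<Prod>Y\<leftarrow>map f xs. Y w) = X xs"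
      by (intro ext) (simp only: X_def map_map o_def)
    then show ?thesis
      using that by (simp add: wick_def)
  qed
  define Z where "Z = (\<lambda>w. \<Sum>xs\<in>?E. (a xs / fact m) * chaos_proj M H m (X xs) w)"
  have "AE w in M. chaos_proj M H m (\<lambda>w. \<Phi> (F w)) w = Z w"
  proof (rule homogeneous_unique)
    show "homogeneous m (chaos_proj M H m (\<lambda>w. \<Phi> (F w)))"
      by (rule homogeneous_chaos_proj[OF tame_L2[OF tame]])
    show "homogeneous m Z"
      unfolding Z_def
      by (intro homogeneous_sum homogeneous_chaos_proj X_L2 finite_lists_length_eq finite_D)
    fix ys assume ys: "set ys \<subseteq> D" "length ys = m"
    have L2: "chaos_proj M H m (X xs) \<in> L2 M" if "xs \<in> ?E" for xs
      using homogeneous_chaos_proj[OF X_L2[OF that]] by (simp add: homogeneous_def)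
    \<comment> \<open>Under this pairing each Wick product may be replaced by its plain monomial,
      and the sum becomes a symmetric form evaluated at \<open>F\<close>.\<close>
    have "L2_inner M Z (\<lambda>w. herm ys (F w)) = (\<Sum>xs\<in>?E. (a xs / fact m) * L2_inner M (X xs) (\<lambda>w. herm ys (F w)))"
      unfolding Z_def by (subst L2_inner_sum_left[OF L2 herm_L2]) (auto simp: inner_chaos_proj X_L2 ys)
    also have "\<dots> = L2_inner M (\<lambda>w. \<Sum>xs\<in>?E. (a xs / fact m) * X xs w) (\<lambda>w. herm ys (F w))"
      by (rule L2_inner_sum_left[OF X_L2 herm_L2, symmetric]) simp
    also have "(\<lambda>w. \<Sum>xs\<in>?E. (a xs / fact m) * X xs w) = (\<lambda>w. (1 / fact m) * symmetric_form D m a (F w))"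
      by (simp add: symmetric_form_eq_sum[OF finite_D] X_def sum_divide_distrib)
    also have "L2_inner M \<dots> (\<lambda>w. herm ys (F w)) = (1 / fact m) * ip (symmetric_form D m a) (herm ys)"
      by (simp only: L2_inner_cmult_left ip_def)
    also have "\<dots> = a ys"
      using ip_symmetric_form_herm[OF sym ys] by simp
    also have "\<dots> = L2_inner M (chaos_proj M H m (\<lambda>w. \<Phi> (F w))) (\<lambda>w. herm ys (F w))"
      using a_herm[OF ys(1)] inner_chaos_proj[OF tame_L2[OF tame] ys] by (simp add: ip_def)
    finally show "L2_inner M (chaos_proj M H m (\<lambda>w. \<Phi> (F w))) (\<lambda>w. herm ys (F w)) = L2_inner M Z (\<lambda>w. herm ys (F w))"
      by simp
  qed
  moreover have "Z w = 1 / fact m *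
      (\<Sum>xs\<in>?E. wick M H (map f xs) w * (LINT w'|M. partials xs \<Phi> (F w')))" for w
    unfolding Z_def sum_distrib_left by (intro sum.cong) (auto simp: wick a_def)
  ultimately show ?thesis by simp
qed

text \<open>The partial sums converge to some \<open>Y\<close>. The difference \<open>R\<close>
  between \<open>X\<close> and \<open>Y\<close> is orthogonal to \<open>X\<close>, because it is
  orthogonal to all polynomials, and to \<open>Y\<close>, because it is orthogonal to every partial
  sum; so \<open>R\<close> is orthogonal to itself.\<close>

lemma chaos_expansion:
  assumes tame: "tame D \<Phi>"
  shows "L2_tendsto M
    (\<lambda>N w. (LINT w'|M. \<Phi> (F w')) + (\<Sum>m=1..N. chaos_proj M H m (\<lambda>w. \<Phi> (F w)) w)) (\<lambda>w. \<Phi> (F w))"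
proof -
  define X where "X = (\<lambda>w. \<Phi> (F w))"
  have X: "X \<in> L2 M" unfolding X_def by (rule tame_L2[OF tame])
  \<comment> \<open>For degree 0 the expectation itself is used instead of a chosen version of the
    projection, so the partial sums coincide literally with those claimed.\<close>
  define q where "q m = (if m = 0 then (\<lambda>w. LINT w'|M. X w') else chaos_proj M H m X)" for m
  have hom: "homogeneous m (q m)" for m
  proof (cases "m = 0")
    case True
    have "(\<lambda>w. LINT w'|M. X w') \<in> chaos M H 0"
      by (auto simp: L2_def)
    then show ?thesis
      unfolding chaos_iff_homogeneous by (simp add: q_def True)
  qed (simp add: q_def homogeneous_chaos_proj[OF X])
  then have q: "q m \<in> L2 M" for m by (simp add: homogeneous_def)
  have inner_q: "L2_inner M (q m) (\<lambda>w. herm ys (F w)) = L2_inner M X (\<lambda>w. herm ys (F w))"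
    if "set ys \<subseteq> D" "length ys = m" for m ys
    using that inner_chaos_proj[OF X, of ys m] by (cases "m = 0") (simp_all add: q_def L2_inner_def prob_space)
  have inner_q_neq: "L2_inner M (q m) (\<lambda>w. herm ys (F w)) = 0" if "set ys \<subseteq> D" "length ys \<noteq> m" for m ys
  proof -
    have "L2_inner M (\<lambda>w. herm ys (F w)) (q m) = 0"
      using ip_herm_herm that by (intro homogeneous_inner[OF hom herm_L2]) (auto simp: ip_def)
    then show ?thesis by (simp add: L2_inner_commute)
  qed
  have orth: "L2_inner M (q m) (q n) = 0" if "m \<noteq> n" for m n
    using that inner_q_neq by (intro homogeneous_inner[OF hom q]) auto
  have proj: "L2_inner M X (q m) = L2_inner M (q m) (q m)" for m
  proof -
    have "L2_inner M (\<lambda>w. X w - q m w) (q m) = 0"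
      using inner_q X q herm_L2 by (intro homogeneous_inner[OF hom] L2_diff) (auto simp: L2_inner_diff_left)
    then show ?thesis using X q by (simp add: L2_inner_diff_left)
  qed
  define S where "S N = (\<lambda>w. \<Sum>m\<le>N. q m w)" for N
  obtain Y where Y: "Y \<in> L2 M" and dist: "(\<lambda>N. L2_dist M (S N) Y) \<longlonglongrightarrow> 0"
    and weak: "\<And>V. V \<in> L2 M \<Longrightarrow> (\<lambda>N. L2_inner M (S N) V) \<longlonglongrightarrow> L2_inner M Y V"
    using L2_orthogonal_series[of q X, OF q X orth proj] unfolding S_def by blast
  have S: "S N \<in> L2 M" for N
    unfolding S_def using L2_sum[of "{..N}" q M "\<lambda>_. 1"] q by simp
  have inner_S: "L2_inner M (S N) V = (\<Sum>m\<le>N. L2_inner M (q m) V)" if "V \<in> L2 M" for V N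
    unfolding S_def using L2_inner_sum_left[of "{..N}" q M V "\<lambda>_. 1"] q that by simp
  define R where "R = (\<lambda>w. X w - Y w)"
  have R: "R \<in> L2 M" unfolding R_def by (intro L2_diff X Y)
  have R_herm: "L2_inner M R (\<lambda>w. herm ys (F w)) = 0" if ys: "set ys \<subseteq> D" for ys
  proof -
    \<comment> \<open>Once \<open>N\<close> reaches \<open>length ys\<close> only the component of
      that degree contributes, so the pairings are eventually constant and their limit is
      known.\<close>
    have "L2_inner M (S N) (\<lambda>w. herm ys (F w)) = L2_inner M X (\<lambda>w. herm ys (F w))" if "N \<ge> length ys" for N
    proof -
      have "L2_inner M (S N) (\<lambda>w. herm ys (F w)) = (\<Sum>m\<le>N. if m = length ys then L2_inner M X (\<lambda>w. herm ys (F w)) else 0)"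
        unfolding inner_S[OF herm_L2] using ys by (intro sum.cong) (auto simp: inner_q inner_q_neq)
      then show ?thesis using that by simp
    qed
    then have "(\<lambda>N. L2_inner M (S N) (\<lambda>w. herm ys (F w))) \<longlonglongrightarrow> L2_inner M X (\<lambda>w. herm ys (F w))"
      by (intro tendsto_eventually eventually_sequentiallyI)
    with weak[OF herm_L2] have "L2_inner M Y (\<lambda>w. herm ys (F w)) = L2_inner M X (\<lambda>w. herm ys (F w))"
      by (rule LIMSEQ_unique)
    then show ?thesis
      unfolding R_def using X Y herm_L2 by (simp add: L2_inner_diff_left)
  qed
  have "L2_inner M R (\<lambda>w. p (F w)) = 0" if p: "Pol D n p" for n p
  proof -
    obtain c where "p = (\<lambda>v. \<Sum>ys | set ys \<subseteq> D \<and> length ys \<le> n. c ys * herm ys v)"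
      using Pol_herm_combination[OF p] unfolding herm_combination_def by blast
    then show ?thesis
      using R_herm by (simp add: L2_inner_sum_right[OF herm_L2 R])
  qed
  then have RX: "L2_inner M R X = 0"
    unfolding X_def by (rule tame_orthogonal_if_polynomials_orthogonal[OF R _ tame])
  \<comment> \<open>Each \<open>q m\<close> is a combination of Hermite polynomials; orthogonality
    to the partial sums passes to \<open>Y\<close> in the limit.\<close>
  have "L2_inner M R (q m) = 0" for m
    using R_herm by (intro homogeneous_inner[OF hom R])
  then have "L2_inner M (S N) R = 0" for N
    by (simp add: inner_S[OF R] L2_inner_commute[of M "q _" R])
  with weak[OF R] have "L2_inner M Y R = 0"
    by (simp add: LIMSEQ_const_iff)
  then have "L2_inner M R R = 0"
    using RX L2_inner_diff_left[OF X Y R] by (simp add: R_def[symmetric] L2_inner_commute[of M X R])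
  then have AE: "AE w in M. X w = Y w"
    using L2_inner_self_eq_0_iff[OF R] by (simp add: R_def)
  have "L2_dist M (S N) X = L2_dist M (S N) Y" for N
    unfolding L2_dist_def using AE S X Y
    by (intro arg_cong[where f = sqrt] integral_cong_AE) (auto intro: L2_measurable)
  with dist have tendsto: "L2_tendsto M S X"
    using S X by (simp add: L2_tendsto_def)
  have "S N w = (LINT w'|M. X w') + (\<Sum>m=1..N. chaos_proj M H m X w)" for N w
  proof -
    have "{..N} = insert 0 {1..N}" by auto
    then have "S N w = q 0 w + (\<Sum>m=1..N. q m w)"
      unfolding S_def by simp
    also have "(\<Sum>m=1..N. q m w) = (\<Sum>m=1..N. chaos_proj M H m X w)"
      by (intro sum.cong) (auto simp: q_def)
    finally show ?thesis by (simp add: q_def)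
  qed
  then have "S = (\<lambda>N w. (LINT w'|M. X w') + (\<Sum>m=1..N. chaos_proj M H m X w))"
    by (intro ext)
  with tendsto show ?thesis
    unfolding X_def by simp
qed

end

theorem proposition2p2:
  fixes M :: "'w measure"
    and D :: "(int ^ 'd::finite) set"
    and f :: "int ^ 'd \<Rightarrow> 'w \<Rightarrow> real"
    and \<Phi> :: "(int ^ 'd \<Rightarrow> real) \<Rightarrow> real"
  assumes "prob_space M"
    and "finite D"
    and "centred_gaussian_vector M D f"
    and "nondegenerate M D f"
    and "smooth_fun D \<Phi>"
    and "\<forall>xs\<in>lists D. polynomial_growth D (partials xs \<Phi>)"
  shows "let H = gaussian_hilbert_space M D f;
             F = (\<lambda>w. restrict (\<lambda>x. f x w) D);
             Q = (\<lambda>m. chaos_proj M H m (\<lambda>w. \<Phi> (F w)))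
         in L2_tendsto M
              (\<lambda>N w. (LINT w'|M. \<Phi> (F w')) + (\<Sum>m=1..N. Q m w))
              (\<lambda>w. \<Phi> (F w)) \<and>
            (\<forall>m\<ge>1. AE w in M.
               Q m w = 1 / fact m *
                 (\<Sum>xs | set xs \<subseteq> D \<and> length xs = m.
                    wick M H (map f xs) w * (LINT w'|M. partials xs \<Phi> (F w'))))"
proof -
  interpret gaussian_family M D f
    using assms(1-4) by (simp add: gaussian_family_def gaussian_family_axioms_def)
  have F: "F = (\<lambda>w. restrict (\<lambda>x. f x w) D)"
    by (rule ext) (rule F_def)
  have "tame D \<Phi>"
    using smooth_fun_tame1_partials[OF assms(5,6), of "[]"] by (simp add: partials_def tame1_def)
  then show ?thesis
    unfolding Let_def using chaos_expansion chaos_proj_formula[OF assms(5,6)]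
    unfolding F by blast
qed

end
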